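(* Let $\rho\in C^\infty(\mathbb{R},(0,\infty))$ satisfy $\rho(0)>0$, $\rho'(0)=0$, $\rho''(0)>0$, and for $a>0$ let $$\mathcal{M}_a=\{(x,y)\in\mathbb{R}\times\mathbb{R}^{n-1}:\ |y|=\rho(x),\ |x|\le a\}.$$ For $n\ge 3$ and all sufficiently small $a>0$, the mirror $\mathcal{M}_a$ traps a family of rays of dimension $2n-3$.
   Context: $L_n=\{(u,p): u\in S^{n-1},\ p\in u^\perp\}$ is the space of oriented lines in $\mathbb{R}^n$; $(u,p)$ represents the line $p+\mathbb{R}u$ traversed in direction $u$. It is a smooth manifold of dimension $2n-2$. A trap is a finite collection of compact embedded $C^\infty$ hypersurfaces (the mirrors, each possibly with boundary) in $\mathbb{R}^n$; here the trap consists of the single mirror $\mathcal{M}_a$. Rays move along straight lines at unit speed and are reflected specularly at interior points of the mirrors. A trajectory is nonsingular if it has no tangential collisions with the mirrors, no collisions with the boundaries of the mirrors, no multiple collisions (simultaneous collisions with more than one mirror), and no accumulation of collisions in finite time. A trap traps a family of rays $F$, where $F\subset L_n$ is a smooth embedded submanifold, if there is a ball $B_R$ containing the trap in its interior such that, for every $\ell\in F$, the billiard trajectory coming from infinity along $\ell$ enters $B_R$, remains within $B_R$ for all subsequent time, and is nonsingular. *)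

theory Defs
  imports "HOL-Analysis.Analysis"
begin

section \<open>Smooth maps, charts and embedded submanifolds\<close>

text \<open>
  \<open>C\<^sup>k\<close> regularity on an open set, by iterated directional derivatives; in finite dimension
  this is the usual notion, and it avoids changing the codomain type at every derivative.
\<close>

primrec Ck_on :: "nat \<Rightarrow> 'a set \<Rightarrow> ('a::real_normed_vector \<Rightarrow> 'b::real_normed_vector) \<Rightarrow> bool" where
  "Ck_on 0 S f \<longleftrightarrow> continuous_on S f"
| "Ck_on (Suc k) S f \<longleftrightarrow>
     (\<forall>x\<in>S. f differentiable (at x)) \<and> (\<forall>v. Ck_on k S (\<lambda>x. frechet_derivative f (at x) v))"

definition smooth_on :: "'a set \<Rightarrow> ('a::real_normed_vector \<Rightarrow> 'b::real_normed_vector) \<Rightarrow> bool" where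
  "smooth_on S f \<longleftrightarrow> (\<forall>k. Ck_on k S f)"

definition diffeo_between ::
    "'a set \<Rightarrow> 'b set \<Rightarrow> ('a::real_normed_vector \<Rightarrow> 'b::real_normed_vector) \<Rightarrow> bool" where
  "diffeo_between U V \<phi> \<longleftrightarrow>
     open U \<and> open V \<and> \<phi> ` U = V \<and> smooth_on U \<phi> \<and>
     (\<exists>\<psi>. smooth_on V \<psi> \<and> (\<forall>x\<in>U. \<psi> (\<phi> x) = x))"

text \<open>
  \<open>F\<close> is an embedded \<open>d\<close>-dimensional \<open>C\<^sup>\<infinity>\<close> submanifold of \<open>N\<close>, where \<open>N\<close> is itself a
  submanifold of a Euclidean space: near each of its points, \<open>F\<close> is a \<open>d\<close>-dimensional slice
  in a chart of \<open>N\<close>. Charts of \<open>N\<close> are restrictions of ambient diffeomorphisms straightening \<open>N\<close>.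
  The empty set qualifies for every \<open>d\<close>.
\<close>

definition embedded_submanifold_in :: "'a::euclidean_space set \<Rightarrow> nat \<Rightarrow> 'a set \<Rightarrow> bool" where
  "embedded_submanifold_in N d F \<longleftrightarrow>
     F \<subseteq> N \<and>
     (\<forall>x\<in>F. \<exists>U V S W. \<exists>\<phi> :: 'a \<Rightarrow> 'a.
        x \<in> U \<and> diffeo_between U V \<phi> \<and>
        subspace S \<and> subspace W \<and> W \<subseteq> S \<and> dim W = d \<and>
        \<phi> ` (U \<inter> N) = V \<inter> S \<and> \<phi> ` (U \<inter> F) = V \<inter> W)"


section \<open>Mirrors and traps\<close>

definition mirror_interior :: "'a::euclidean_space set \<Rightarrow> 'a set" where
  "mirror_interior M =
     {x \<in> M. \<exists>U V H. \<exists>\<phi> :: 'a \<Rightarrow> 'a.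
        x \<in> U \<and> diffeo_between U V \<phi> \<and>
        subspace H \<and> dim H = DIM('a) - 1 \<and> \<phi> ` (U \<inter> M) = V \<inter> H}"

definition mirror_boundary :: "'a::euclidean_space set \<Rightarrow> 'a set" where
  "mirror_boundary M = M - mirror_interior M"

text \<open>
  A mirror is a compact embedded hypersurface, possibly with boundary: around a boundary point
  there is a chart straightening \<open>M\<close> to a half-hyperplane and sending the point to its edge.
\<close>

definition mirror :: "'a::euclidean_space set \<Rightarrow> bool" where
  "mirror M \<longleftrightarrow>
     compact M \<and>
     (\<forall>x \<in> mirror_boundary M. \<exists>U V H b. \<exists>\<phi> :: 'a \<Rightarrow> 'a.
        x \<in> U \<and> diffeo_between U V \<phi> \<and>
        subspace H \<and> dim H = DIM('a) - 1 \<and> b \<in> H \<and> b \<noteq> 0 \<and> \<phi> x \<bullet> b = 0 \<and>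
        \<phi> ` (U \<inter> M) = V \<inter> {h \<in> H. 0 \<le> h \<bullet> b})"

definition trap :: "'a::euclidean_space set set \<Rightarrow> bool" where
  "trap T \<longleftrightarrow> finite T \<and> (\<forall>M\<in>T. mirror M)"

text \<open>Only used at interior points of a mirror, where the tangent space is a hyperplane.\<close>

definition tangent_space :: "'a::euclidean_space set \<Rightarrow> 'a \<Rightarrow> 'a set" where
  "tangent_space M x =
     {v. \<exists>e>0. \<exists>c. smooth_on {-e<..<e} c \<and> c ` {-e<..<e} \<subseteq> M \<and> c 0 = x \<and>
           (c has_vector_derivative v) (at 0)}"

definition unit_normal :: "'a::euclidean_space set \<Rightarrow> 'a \<Rightarrow> 'a \<Rightarrow> bool" where
  "unit_normal M x \<nu> \<longleftrightarrow> norm \<nu> = 1 \<and> (\<forall>w \<in> tangent_space M x. w \<bullet> \<nu> = 0)"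

definition specular_reflection :: "'a::euclidean_space \<Rightarrow> 'a \<Rightarrow> 'a" where
  "specular_reflection \<nu> v = v - (2 * (v \<bullet> \<nu>)) *\<^sub>R \<nu>"


section \<open>Billiard trajectories\<close>

definition collision_times :: "'a::euclidean_space set set \<Rightarrow> (real \<Rightarrow> 'a) \<Rightarrow> real set" where
  "collision_times T \<gamma> = {t. \<gamma> t \<in> \<Union>T}"

text \<open>
  The incoming and outgoing velocities at time \<open>t\<close> are the one-sided derivatives there. The
  reflection law is imposed only where it is meaningful, at interior points of a single mirror;
  the other collisions are excluded by nonsingularity.
\<close>

definition billiard_trajectory :: "'a::euclidean_space set set \<Rightarrow> (real \<Rightarrow> 'a) \<Rightarrow> bool" where
  "billiard_trajectory T \<gamma> \<longleftrightarrow>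
     continuous_on UNIV \<gamma> \<and>
     (\<forall>s t. s < t \<and> {s<..<t} \<inter> collision_times T \<gamma> = {} \<longrightarrow>
        (\<exists>v. norm v = 1 \<and> (\<forall>r\<in>{s..t}. \<gamma> r = \<gamma> s + (r - s) *\<^sub>R v))) \<and>
     (\<forall>t. \<forall>M\<in>T. \<gamma> t \<in> mirror_interior M \<and> (\<forall>M'\<in>T. \<gamma> t \<in> M' \<longrightarrow> M' = M) \<longrightarrow>
        (\<exists>v \<nu>. (\<gamma> has_vector_derivative v) (at_left t) \<and>
               unit_normal M (\<gamma> t) \<nu> \<and>
               (\<gamma> has_vector_derivative specular_reflection \<nu> v) (at_right t)))"

definition nonsingular :: "'a::euclidean_space set set \<Rightarrow> (real \<Rightarrow> 'a) \<Rightarrow> bool" where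
  "nonsingular T \<gamma> \<longleftrightarrow>
     (\<forall>t. \<forall>M\<in>T. \<gamma> t \<in> M \<longrightarrow>
        (\<forall>v. (\<gamma> has_vector_derivative v) (at_left t) \<longrightarrow> v \<notin> tangent_space M (\<gamma> t)) \<and>
        \<gamma> t \<notin> mirror_boundary M \<and>
        (\<forall>M'\<in>T. \<gamma> t \<in> M' \<longrightarrow> M' = M)) \<and>
     (\<forall>s t. finite (collision_times T \<gamma> \<inter> {s..t}))"


section \<open>Oriented lines and trapping\<close>

text \<open>The pair \<open>(u, p)\<close> stands for the line \<open>p + \<real>u\<close> traversed in direction \<open>u\<close>.\<close>

definition oriented_lines :: "('a::euclidean_space \<times> 'a) set" where
  "oriented_lines = {(u, p). u \<in> sphere 0 1 \<and> p \<bullet> u = 0}"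

definition comes_from_infinity_along :: "(real \<Rightarrow> 'a::euclidean_space) \<Rightarrow> 'a \<times> 'a \<Rightarrow> bool" where
  "comes_from_infinity_along \<gamma> l \<longleftrightarrow> (\<exists>t0. \<forall>t\<le>t0. \<gamma> t = snd l + t *\<^sub>R fst l)"

text \<open>
  In the following definition \<open>t1\<close> is the time of entry into the ball. A nonsingular trajectory
  is determined by its incoming line, so the existential quantifier over \<open>\<gamma>\<close> refers to
  the trajectory coming along \<open>l\<close>.
\<close>

definition traps_family ::
    "'a::euclidean_space set set \<Rightarrow> nat \<Rightarrow> ('a \<times> 'a) set \<Rightarrow> bool" where
  "traps_family T d F \<longleftrightarrow>
     trap T \<and>
     embedded_submanifold_in oriented_lines d F \<and>
     (\<exists>R>0. \<Union>T \<subseteq> interior (cball 0 R) \<and>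
        (\<forall>l\<in>F. \<exists>\<gamma>. billiard_trajectory T \<gamma> \<and> nonsingular T \<gamma> \<and>
           comes_from_infinity_along \<gamma> l \<and>
           (\<exists>t1. (\<forall>t<t1. \<gamma> t \<notin> cball 0 R) \<and> (\<forall>t\<ge>t1. \<gamma> t \<in> cball 0 R))))"

text \<open>
  The ambient space is \<open>\<real> \<times> \<real>\<^sup>n\<^sup>-\<^sup>1\<close>, with \<open>n - 1 = CARD('m)\<close>; the norm and
  inner product of the product type are the Euclidean ones.
\<close>

definition rotational_mirror :: "(real \<Rightarrow> real) \<Rightarrow> real \<Rightarrow> (real \<times> (real ^ 'm)) set" where
  "rotational_mirror \<rho> a = {(x, y). norm y = \<rho> x \<and> \<bar>x\<bar> \<le> a}"

end

theory Submission
  imports Defs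
begin

text \<open>
  A trajectory in \<open>\<real> \<times> \<real>\<^sup>n\<^sup>-\<^sup>1\<close> that bounces off the surface of revolution conserves its angular momentum about the
  axis. For a fixed squared angular momentum \<open>j\<close> the axial coordinates \<open>x\<^sub>k\<close> of its bounces therefore satisfy an explicit
  second-order difference equation, with fixed point \<open>x = 0\<close> because \<open>\<rho>\<close> is critical there. The condition
  \<open>\<rho>''(0) > 0\<close> makes the linearization strictly diagonally dominant, so for every small incoming slope \<open>w\<close> there is
  exactly one small bounded solution. It is a fixed point of a contraction in the supremum norm, and it depends smoothly on
  \<open>(w, j)\<close>: its derivatives solve linear equations of the same diagonally dominant form, which a discrete maximum principle
  controls. These solutions never leave the neck. They correspond to the lines satisfying one smooth equation, that is, to a
  hypersurface in the space of lines, of dimension \<open>2n - 3\<close>. For given small \<open>a\<close> an open piece of it consists of lines that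
  enter through the end \<open>x = a\<close> without touching the mirror and have their first bounce just inside.
\<close>

section \<open>Families with uniform bounds on all derivatives\<close>

text \<open>In general the angular momentum about the axis is a bivector. A reflection changes the
  radial velocity by a multiple of the radial position, so the motion across the axis stays in one
  plane, and the squared norm \<open>j\<close> of the bivector is all that the axial equations see.
  With \<open>w\<close> this leaves two parameters in every dimension. The main obstacle is smooth
  dependence of an infinite sequence of unknowns. In place of an implicit function theorem for
  bounded sequences, all estimates are uniform in the bounce index, and the order of
  differentiability is raised by an induction over all contracting systems at once, since
  differentiating such a system yields another one. A second obstacle is that a trapped ray must
  have come from infinity. Backwards from the first bounce at \<open>X 0\<close>, the time
  \<open>\<rho> 0 / 2\<close> moves the ray by \<open>\<rho> 0 / 2 * \<bar>w\<bar>\<close> along the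
  axis, too early for it to meet the surface again. If \<open>a\<close> lies strictly between the
  two axial positions, the ray came through the end of the mirror; the intermediate value theorem
  finds such a slope for every small \<open>a\<close>.\<close>

text \<open>
  Uniform \<open>C\<^sup>m\<^sup>,\<^sup>1\<close> bounds over an indexed family of functions. Asking for a Lipschitz bound at every order, and not
  only for a bound, lets first-order Taylor remainders be quadratic uniformly in the index.
\<close>

definition bounded_lipschitz_family ::
    "'a set \<Rightarrow> ('i \<Rightarrow> 'a::real_normed_vector \<Rightarrow> 'b::real_normed_vector) \<Rightarrow> bool" where
  "bounded_lipschitz_family S f \<longleftrightarrow>
     (\<exists>B. (\<forall>i. \<forall>x\<in>S. norm (f i x) \<le> B) \<and>
          (\<forall>i. \<forall>x\<in>S. \<forall>y\<in>S. norm (f i x - f i y) \<le> B * norm (x - y)))"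

text \<open>The bounds may depend on the direction \<open>v\<close>; linearity and a finite basis
  recover uniformity over directions. The index carries no structure, so the notion covers a single
  function as well as an infinite sequence.\<close>

primrec Ck_family :: "nat \<Rightarrow> 'a set \<Rightarrow> ('i \<Rightarrow> 'a::real_normed_vector \<Rightarrow> 'b::real_normed_vector) \<Rightarrow> bool" where
  "Ck_family 0 S f \<longleftrightarrow> bounded_lipschitz_family S f"
| "Ck_family (Suc m) S f \<longleftrightarrow>
     bounded_lipschitz_family S f \<and> (\<forall>i. \<forall>x\<in>S. f i differentiable (at x)) \<and>
     (\<forall>v. Ck_family m S (\<lambda>i x. frechet_derivative (f i) (at x) v))"

declare Ck_family.simps [simp del]

lemma Ck_family_0:
  "Ck_family 0 S f \<longleftrightarrow>
     (\<exists>B. (\<forall>i. \<forall>x\<in>S. norm (f i x) \<le> B) \<and>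
          (\<forall>i. \<forall>x\<in>S. \<forall>y\<in>S. norm (f i x - f i y) \<le> B * norm (x - y)))"
  by (simp add: Ck_family.simps bounded_lipschitz_family_def)

lemma Ck_family_Suc [simp]:
  "Ck_family (Suc m) S f \<longleftrightarrow>
     Ck_family 0 S f \<and> (\<forall>i. \<forall>x\<in>S. f i differentiable (at x)) \<and>
     (\<forall>v. Ck_family m S (\<lambda>i x. frechet_derivative (f i) (at x) v))"
  by (simp add: Ck_family.simps)

lemma Ck_family_0I:
  assumes "\<And>i x. x \<in> S \<Longrightarrow> norm (f i x) \<le> B"
    and "\<And>i x y. x \<in> S \<Longrightarrow> y \<in> S \<Longrightarrow> norm (f i x - f i y) \<le> C * norm (x - y)"
  shows "Ck_family 0 S f"
proof -
  have "norm (f i x) \<le> max B C" if "x \<in> S" for i x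
    using assms(1)[OF that, of i] by linarith
  moreover have "norm (f i x - f i y) \<le> max B C * norm (x - y)" if "x \<in> S" "y \<in> S" for i x y
    using assms(2)[OF that, of i] by (meson max.cobounded2 mult_right_mono norm_ge_zero order_trans)
  ultimately show ?thesis
    unfolding Ck_family_0 by blast
qed

lemma Ck_family_0D:
  assumes "Ck_family 0 S f"
  shows "\<exists>B\<ge>0. (\<forall>i. \<forall>x\<in>S. norm (f i x) \<le> B) \<and>
    (\<forall>i. \<forall>x\<in>S. \<forall>y\<in>S. norm (f i x - f i y) \<le> B * norm (x - y))"
proof -
  obtain B where B: "\<And>i x. x \<in> S \<Longrightarrow> norm (f i x) \<le> B"
    "\<And>i x y. x \<in> S \<Longrightarrow> y \<in> S \<Longrightarrow> norm (f i x - f i y) \<le> B * norm (x - y)"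
    using assms unfolding Ck_family_0 by blast
  have "norm (f i x) \<le> max B 0" if "x \<in> S" for i x
    using B(1)[OF that, of i] by linarith
  moreover have "norm (f i x - f i y) \<le> max B 0 * norm (x - y)" if "x \<in> S" "y \<in> S" for i x y
    using B(2)[OF that, of i] by (meson max.cobounded1 mult_right_mono norm_ge_zero order_trans)
  ultimately show ?thesis
    by (intro exI[of _ "max B 0"]) auto
qed

lemma Ck_family_imp_0: "Ck_family m S f \<Longrightarrow> Ck_family 0 S f"
  by (cases m) auto

lemma Ck_family_SucD: "Ck_family (Suc m) S f \<Longrightarrow> Ck_family m S f"
proof (induction m arbitrary: f)
  case (Suc m)
  then show ?case by (metis Ck_family_Suc)
qed simp

lemma Ck_family_derivative:
  "Ck_family (Suc m) S f \<Longrightarrow> x \<in> S \<Longrightarrow> (f i has_derivative frechet_derivative (f i) (at x)) (at x)"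
  by (simp add: frechet_derivative_works)

lemma Ck_family_cong:
  assumes "open S" "\<And>i x. x \<in> S \<Longrightarrow> f i x = g i x" "Ck_family m S f"
  shows "Ck_family m S g"
  using assms(2,3)
proof (induction m arbitrary: f g)
  case 0
  then show ?case by (simp add: Ck_family_0)
next
  case (Suc m)
  have 0: "Ck_family 0 S g"
    using Suc.prems by (simp add: Ck_family_0)
  have D: "(g i has_derivative frechet_derivative (f i) (at x)) (at x)" if "x \<in> S" for i x
    by (rule has_derivative_transform_within_open[OF Ck_family_derivative[OF Suc.prems(2) that] \<open>open S\<close> that])
      (use Suc.prems in auto)
  have "Ck_family m S (\<lambda>i x. frechet_derivative (g i) (at x) v)" for v
  proof (rule Suc.IH)
    show "Ck_family m S (\<lambda>i x. frechet_derivative (f i) (at x) v)"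
      using Suc.prems by simp
    show "frechet_derivative (f i) (at x) v = frechet_derivative (g i) (at x) v" if "x \<in> S" for i x
      using frechet_derivative_at[OF D[OF that]] by metis
  qed
  with 0 D show ?case
    unfolding Ck_family_Suc differentiable_def by blast
qed

lemma Ck_family_SucI:
  assumes "open S" "Ck_family 0 S f"
    and "\<And>i x. x \<in> S \<Longrightarrow> (f i has_derivative D i x) (at x)"
    and "\<And>v. Ck_family m S (\<lambda>i x. D i x v)"
  shows "Ck_family (Suc m) S f"
proof -
  have "Ck_family m S (\<lambda>i x. frechet_derivative (f i) (at x) v)" for v
    by (rule Ck_family_cong[OF assms(1) _ assms(4)[of v]])
      (metis assms(3) frechet_derivative_at)
  with assms show ?thesis
    unfolding Ck_family_Suc differentiable_def by blast
qed

text \<open>Shifting the index keeps every bound; this is how the neighbours \<open>k - 1\<close>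
  and \<open>Suc k\<close> of an entry enter the estimates.\<close>

lemma Ck_family_reindex: "Ck_family m S f \<Longrightarrow> Ck_family m S (\<lambda>i. f (r i))"
proof (induction m arbitrary: f)
  case 0
  then show ?case unfolding Ck_family_0 by blast
next
  case (Suc m)
  have "Ck_family 0 S (\<lambda>i. f (r i))"
    using Suc.prems unfolding Ck_family_Suc Ck_family_0 by blast
  moreover have "Ck_family m S (\<lambda>i x. frechet_derivative (f (r i)) (at x) v)" for v
    using Suc.IH[of "\<lambda>i x. frechet_derivative (f i) (at x) v"] Suc.prems by simp
  ultimately show ?case using Suc.prems by simp
qed

text \<open>Serves the bounce equations, the first of which differs in form from all later
  ones.\<close>

lemma Ck_family_If:
  fixes f g :: "'i \<Rightarrow> 'a::real_normed_vector \<Rightarrow> 'b::real_normed_vector"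
  assumes "Ck_family m S f" "Ck_family m S g"
  shows "Ck_family m S (\<lambda>i. if P i then f i else g i)"
proof -
  have base: "Ck_family 0 S (\<lambda>i. if P i then f i else g i)"
    if fg: "Ck_family 0 S f" "Ck_family 0 S g" for f g :: "'i \<Rightarrow> 'a \<Rightarrow> 'b"
  proof -
    obtain B where "B \<ge> 0" and B: "\<And>i x. x \<in> S \<Longrightarrow> norm (f i x) \<le> B"
      "\<And>i x y. x \<in> S \<Longrightarrow> y \<in> S \<Longrightarrow> norm (f i x - f i y) \<le> B * norm (x - y)"
      using Ck_family_0D[OF fg(1)] by blast
    obtain C where "C \<ge> 0" and C: "\<And>i x. x \<in> S \<Longrightarrow> norm (g i x) \<le> C"
      "\<And>i x y. x \<in> S \<Longrightarrow> y \<in> S \<Longrightarrow> norm (g i x - g i y) \<le> C * norm (x - y)"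
      using Ck_family_0D[OF fg(2)] by blast
    show ?thesis
    proof (rule Ck_family_0I[of _ _ "max B C" "max B C"], goal_cases)
      case (1 i x)
      show ?case using B(1)[OF 1, of i] C(1)[OF 1, of i] by auto
    next
      case (2 i x y)
      have "B * norm (x - y) \<le> max B C * norm (x - y)" "C * norm (x - y) \<le> max B C * norm (x - y)"
        by (intro mult_right_mono; simp)+
      then show ?case using B(2)[OF 2, of i] C(2)[OF 2, of i] by auto
    qed
  qed
  show ?thesis
    using assms
  proof (induction m arbitrary: f g)
    case 0
    then show ?case by (rule base)
  next
    case (Suc m)
    have eq: "(\<lambda>i x. frechet_derivative (if P i then f i else g i) (at x) v) =
        (\<lambda>i. if P i then (\<lambda>x. frechet_derivative (f i) (at x) v)
              else (\<lambda>x. frechet_derivative (g i) (at x) v))" for v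
      by auto
    show ?case
      unfolding Ck_family_Suc eq using Suc base[of f g] by simp
  qed
qed

lemma Ck_family_const: "Ck_family m S (\<lambda>i x. c)"
proof (induction m arbitrary: c)
  case 0
  show ?case by (rule Ck_family_0I[of _ _ "norm c" 0]) auto
next
  case (Suc m)
  then show ?case by (auto intro: Ck_family_0I[of _ _ "norm c" 0])
qed

lemma Ck_family_add:
  fixes f g :: "'i \<Rightarrow> 'a::real_normed_vector \<Rightarrow> 'b::real_normed_vector"
  assumes "open S" "Ck_family m S f" "Ck_family m S g"
  shows "Ck_family m S (\<lambda>i x. f i x + g i x)"
proof -
  have base: "Ck_family 0 S (\<lambda>i x. f i x + g i x)"
    if fg: "Ck_family 0 S f" "Ck_family 0 S g" for f g :: "'i \<Rightarrow> 'a \<Rightarrow> 'b"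
  proof -
    obtain B where "B \<ge> 0" and B: "\<And>i x. x \<in> S \<Longrightarrow> norm (f i x) \<le> B"
      "\<And>i x y. x \<in> S \<Longrightarrow> y \<in> S \<Longrightarrow> norm (f i x - f i y) \<le> B * norm (x - y)"
      using Ck_family_0D[OF fg(1)] by blast
    obtain C where "C \<ge> 0" and C: "\<And>i x. x \<in> S \<Longrightarrow> norm (g i x) \<le> C"
      "\<And>i x y. x \<in> S \<Longrightarrow> y \<in> S \<Longrightarrow> norm (g i x - g i y) \<le> C * norm (x - y)"
      using Ck_family_0D[OF fg(2)] by blast
    show ?thesis
    proof (rule Ck_family_0I[of _ _ "B + C" "B + C"], goal_cases)
      case (1 i x)
      show ?case using norm_triangle_mono[OF B(1)[OF 1, of i] C(1)[OF 1, of i]] .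
    next
      case (2 i x y)
      show ?case
        using norm_triangle_mono[OF B(2)[OF 2, of i] C(2)[OF 2, of i]] by (simp add: algebra_simps)
    qed
  qed
  show ?thesis
    using assms(2,3)
  proof (induction m arbitrary: f g)
    case 0
    then show ?case by (rule base)
  next
    case (Suc m)
    show ?case
    proof (rule Ck_family_SucI[OF \<open>open S\<close>])
      show "Ck_family 0 S (\<lambda>i x. f i x + g i x)"
        using Suc.prems by (intro base) auto
      show "((\<lambda>x. f i x + g i x) has_derivative
          (\<lambda>v. frechet_derivative (f i) (at x) v + frechet_derivative (g i) (at x) v)) (at x)"
        if "x \<in> S" for i x
        using Ck_family_derivative[OF Suc.prems(1) that] Ck_family_derivative[OF Suc.prems(2) that]
        by (rule has_derivative_add)
    qed (use Suc in auto)
  qed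
qed

lemma Ck_family_bilinear:
  assumes "bounded_bilinear bop" "open S" "Ck_family m S f" "Ck_family m S g"
  shows "Ck_family m S (\<lambda>i x. bop (f i x) (g i x))"
proof -
  interpret bounded_bilinear bop by fact
  have base: "Ck_family 0 S (\<lambda>i x. bop (f i x) (g i x))"
    if fg: "Ck_family 0 S f" "Ck_family 0 S g" for f :: "'i \<Rightarrow> _" and g
  proof -
    obtain B where B: "B \<ge> 0" "\<And>i x. x \<in> S \<Longrightarrow> norm (f i x) \<le> B"
      "\<And>i x y. x \<in> S \<Longrightarrow> y \<in> S \<Longrightarrow> norm (f i x - f i y) \<le> B * norm (x - y)"
      using Ck_family_0D[OF fg(1)] by blast
    obtain C where C: "C \<ge> 0" "\<And>i x. x \<in> S \<Longrightarrow> norm (g i x) \<le> C"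
      "\<And>i x y. x \<in> S \<Longrightarrow> y \<in> S \<Longrightarrow> norm (g i x - g i y) \<le> C * norm (x - y)"
      using Ck_family_0D[OF fg(2)] by blast
    obtain K where K: "K > 0" "\<And>a b. norm (bop a b) \<le> norm a * norm b * K"
      using pos_bounded by blast
    have bd: "norm (bop a b) \<le> p * q * K" if "norm a \<le> p" "norm b \<le> q" for a b p q
    proof -
      have "norm a * norm b * K \<le> p * q * K"
        using that K(1) by (intro mult_right_mono mult_mono) (auto intro: order_trans[OF norm_ge_zero])
      with K(2)[of a b] show ?thesis by linarith
    qed
    show ?thesis
    proof (rule Ck_family_0I[of _ _ "B * C * K" "2 * (B * C * K)"], goal_cases)
      case (1 i x)
      show ?case by (rule bd[OF B(2)[OF 1] C(2)[OF 1]])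
    next
      case (2 i x y)
      have "bop (f i x) (g i x) - bop (f i y) (g i y)
          = bop (f i x) (g i x - g i y) + bop (f i x - f i y) (g i y)"
        by (simp add: diff_left diff_right)
      then have "norm (bop (f i x) (g i x) - bop (f i y) (g i y))
          \<le> B * (C * norm (x - y)) * K + (B * norm (x - y)) * C * K"
        using norm_triangle_mono[OF bd[OF B(2)[OF 2(1), of i] C(3)[OF 2, of i]] bd[OF B(3)[OF 2, of i] C(2)[OF 2(2), of i]]]
        by simp
      then show ?case by (simp add: algebra_simps)
    qed
  qed
  show ?thesis
    using assms(3,4)
  proof (induction m arbitrary: f g)
    case 0
    then show ?case by (rule base)
  next
    case (Suc m)
    show ?case
    proof (rule Ck_family_SucI[OF \<open>open S\<close>])
      show "Ck_family 0 S (\<lambda>i x. bop (f i x) (g i x))"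
        using Suc.prems by (intro base) auto
      show "((\<lambda>x. bop (f i x) (g i x)) has_derivative
          (\<lambda>v. bop (f i x) (frechet_derivative (g i) (at x) v)
             + bop (frechet_derivative (f i) (at x) v) (g i x))) (at x)"
        if "x \<in> S" for i x
        using Ck_family_derivative[OF Suc.prems(1) that] Ck_family_derivative[OF Suc.prems(2) that]
        by (rule FDERIV)
      show "Ck_family m S (\<lambda>i x. bop (f i x) (frechet_derivative (g i) (at x) v)
             + bop (frechet_derivative (f i) (at x) v) (g i x))" for v
        using Suc.prems Suc.prems[THEN Ck_family_SucD]
        by (intro Ck_family_add[OF \<open>open S\<close>] Suc.IH) auto
    qed
  qed
qed

lemma Ck_family_linear:
  assumes "bounded_linear h" "open S" "Ck_family m S f"
  shows "Ck_family m S (\<lambda>i x. h (f i x))"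
  \<comment> \<open>The bilinear rule is applied to \<open>a *\<^sub>R h b\<close> with the constant
    factor \<open>a = 1\<close>.\<close>
  using Ck_family_bilinear[OF bounded_bilinear.comp[OF bounded_bilinear_scaleR bounded_linear_ident assms(1)] assms(2)
      Ck_family_const[of m S 1] assms(3)] by simp

lemmas Ck_family_mult = Ck_family_bilinear[OF bounded_bilinear_mult]
lemmas Ck_family_scaleR = Ck_family_bilinear[OF bounded_bilinear_scaleR]

lemma Ck_family_sum:
  assumes "open S" "finite A" "\<And>a. a \<in> A \<Longrightarrow> Ck_family m S (f a)"
  shows "Ck_family m S (\<lambda>i x. \<Sum>a\<in>A. f a i x)"
  using assms(2,3)
proof (induction A rule: finite_induct)
  case (insert a A)
  have "Ck_family m S (\<lambda>i x. f a i x + (\<Sum>a\<in>A. f a i x))"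
    by (rule Ck_family_add[OF assms(1)]) (use insert in auto)
  with insert.hyps show ?case by simp
qed (simp add: Ck_family_const)

lemma Ck_family_Pair:
  assumes "open S" "Ck_family m S f" "Ck_family m S g"
  shows "Ck_family m S (\<lambda>i x. (f i x, g i x))"
proof -
  have "Ck_family m S (\<lambda>i x. (f i x, 0) + (0, g i x))"
    by (intro Ck_family_add assms Ck_family_linear[where h = "\<lambda>x. (x, 0)"]
        Ck_family_linear[where h = "\<lambda>x. (0, x)"] bounded_linear_Pair
        bounded_linear_ident bounded_linear_zero)
  then show ?thesis by simp
qed

lemma Ck_family_compose:
  fixes f :: "'i \<Rightarrow> 'a::real_normed_vector \<Rightarrow> 'b::euclidean_space"
    and g :: "'i \<Rightarrow> 'b \<Rightarrow> 'c::real_normed_vector"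
  assumes "open S" "Ck_family m S f" "Ck_family m T g" "\<And>i x. x \<in> S \<Longrightarrow> f i x \<in> T"
  shows "Ck_family m S (\<lambda>i x. g i (f i x))"
proof -
  have base: "Ck_family 0 S (\<lambda>i x. g i (f i x))" if fg: "Ck_family 0 S f" "Ck_family 0 T g" for g :: "'i \<Rightarrow> 'b \<Rightarrow> 'c"
  proof -
    obtain B where B: "B \<ge> 0" "\<And>i x. x \<in> S \<Longrightarrow> norm (f i x) \<le> B"
      "\<And>i x y. x \<in> S \<Longrightarrow> y \<in> S \<Longrightarrow> norm (f i x - f i y) \<le> B * norm (x - y)"
      using Ck_family_0D[OF fg(1)] by blast
    obtain C where C: "C \<ge> 0" "\<And>i x. x \<in> T \<Longrightarrow> norm (g i x) \<le> C"
      "\<And>i x y. x \<in> T \<Longrightarrow> y \<in> T \<Longrightarrow> norm (g i x - g i y) \<le> C * norm (x - y)"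
      using Ck_family_0D[OF fg(2)] by blast
    show ?thesis
    proof (rule Ck_family_0I[of _ _ C "C * B"], goal_cases)
      case (1 i x)
      show ?case by (rule C(2)[OF assms(4)[OF 1]])
    next
      case (2 i x y)
      have "norm (g i (f i x) - g i (f i y)) \<le> C * norm (f i x - f i y)"
        using C(3) assms(4) 2 by blast
      also have "\<dots> \<le> C * (B * norm (x - y))"
        by (intro mult_left_mono B(3) 2 C(1))
      finally show ?case by simp
    qed
  qed
  show ?thesis
    using assms(2,3)
  proof (induction m arbitrary: g)
    case 0
    then show ?case by (rule base)
  next
    case (Suc m)
    \<comment> \<open>The chain rule is expanded over a basis of the middle space: the outer
      derivative is then taken only in fixed directions, which is what the induction hypothesis
      controls.\<close>
    define D where "D i x v = (\<Sum>b\<in>Basis. (frechet_derivative (f i) (at x) v \<bullet> b) *\<^sub>R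
        frechet_derivative (g i) (at (f i x)) b)" for i x v
    show ?case
    proof (rule Ck_family_SucI[OF \<open>open S\<close>])
      show "Ck_family 0 S (\<lambda>i x. g i (f i x))"
        using Suc.prems by (intro base) auto
      show "((\<lambda>x. g i (f i x)) has_derivative D i x) (at x)" if "x \<in> S" for i x
      proof -
        have g: "(g i has_derivative frechet_derivative (g i) (at (f i x))) (at (f i x))"
          by (rule Ck_family_derivative[OF Suc.prems(2) assms(4)[OF that]])
        then interpret g: bounded_linear "frechet_derivative (g i) (at (f i x))"
          by (rule has_derivative_bounded_linear)
        have rep: "frechet_derivative (g i) (at (f i x)) w = (\<Sum>b\<in>Basis. (w \<bullet> b) *\<^sub>R
           frechet_derivative (g i) (at (f i x)) b)" for w
        proof -
          have "frechet_derivative (g i) (at (f i x)) w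
              = frechet_derivative (g i) (at (f i x)) (\<Sum>b\<in>Basis. (w \<bullet> b) *\<^sub>R b)"
            by (simp only: euclidean_representation)
          then show ?thesis by (simp only: g.sum g.scaleR)
        qed
        have "D i x v = frechet_derivative (g i) (at (f i x)) (frechet_derivative (f i) (at x) v)" for v
          unfolding D_def by (rule rep[symmetric])
        then have "D i x = (\<lambda>v. frechet_derivative (g i) (at (f i x)) (frechet_derivative (f i) (at x) v))"
          by (rule ext)
        then show ?thesis
          using has_derivative_compose[OF Ck_family_derivative[OF Suc.prems(1) that] g] by simp
      qed
      show "Ck_family m S (\<lambda>i x. D i x v)" for v
        unfolding D_def
      proof (intro Ck_family_sum Ck_family_scaleR \<open>open S\<close> finite_Basis)
        fix b :: 'b assume "b \<in> Basis"
        show "Ck_family m S (\<lambda>i x. frechet_derivative (f i) (at x) v \<bullet> b)"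
          by (rule Ck_family_linear[OF bounded_linear_inner_left \<open>open S\<close>]) (use Suc.prems in simp)
        show "Ck_family m S (\<lambda>i x. frechet_derivative (g i) (at (f i x)) b)"
          by (rule Suc.IH) (use Suc.prems Ck_family_SucD in auto)
      qed
    qed
  qed
qed

section \<open>Smooth functions\<close>

lemma Ck_on_imp_continuous_on: "Ck_on k S f \<Longrightarrow> continuous_on S f"
  by (cases k) (auto intro!: continuous_at_imp_continuous_on differentiable_imp_continuous_within)

lemma Ck_family_imp_Ck_on: "Ck_family m S f \<Longrightarrow> Ck_on m S (f i)"
proof (induction m arbitrary: f)
  case 0
  from Ck_family_0D[OF this] obtain B where "B \<ge> 0"
    "\<forall>i. \<forall>x\<in>S. \<forall>y\<in>S. norm (f i x - f i y) \<le> B * norm (x - y)"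
    by blast
  then have "B-lipschitz_on S (f i)"
    by (auto simp: lipschitz_on_def dist_norm)
  then show ?case
    using lipschitz_on_continuous_on by auto
next
  case (Suc m)
  from Suc.prems have "Ck_on m S (\<lambda>x. frechet_derivative (f i) (at x) v)" for v
    by (auto dest: Suc.IH)
  with Suc.prems show ?case by simp
qed

lemma smooth_onD_derivative:
  assumes "smooth_on S f"
  shows "\<And>x. x \<in> S \<Longrightarrow> (f has_derivative frechet_derivative f (at x)) (at x)"
    and "smooth_on S (\<lambda>x. frechet_derivative f (at x) v)"
proof -
  have *: "Ck_on (Suc k) S f" for k
    using assms unfolding smooth_on_def by blast
  show "(f has_derivative frechet_derivative f (at x)) (at x)" if "x \<in> S" for x
    using *[of 0] that by (simp add: frechet_derivative_works)
  show "smooth_on S (\<lambda>x. frechet_derivative f (at x) v)"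
    using * unfolding smooth_on_def by auto
qed

lemma smooth_on_imp_continuous_on: "smooth_on S f \<Longrightarrow> continuous_on S f"
  unfolding smooth_on_def by (meson Ck_on_imp_continuous_on)

lemma Ck_on_local: "(\<And>x. x \<in> S \<Longrightarrow> \<exists>T. x \<in> T \<and> open T \<and> Ck_on k T f) \<Longrightarrow> Ck_on k S f"
proof (induction k arbitrary: f)
  case 0
  have "continuous (at x) f" if "x \<in> S" for x
    using 0[OF that] continuous_on_eq_continuous_at by auto
  then show ?case by (simp add: continuous_at_imp_continuous_on)
next
  case (Suc k)
  have "Ck_on k S (\<lambda>x. frechet_derivative f (at x) v)" for v
    by (rule Suc.IH) (use Suc.prems in force)
  with Suc.prems show ?case by (auto; force)
qed

text \<open>Compactness bounds the function and its derivatives, and the mean value inequality on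
  the convex set \<open>K\<close> turns derivative bounds into Lipschitz bounds. The index is a
  dummy.\<close>

lemma smooth_on_Ck_family:
  fixes f :: "'a::euclidean_space \<Rightarrow> 'b::real_normed_vector"
  assumes "smooth_on U f" "compact K" "convex K" "K \<subseteq> U" "S \<subseteq> K"
  shows "Ck_family m S (\<lambda>i::'i. f)"
  using assms(1)
proof (induction m arbitrary: f)
  case 0
  have bd: "\<exists>B. \<forall>x\<in>K. norm (g x) \<le> B" if "smooth_on U g" for g :: "'a \<Rightarrow> 'b"
  proof -
    have "continuous_on K g"
      using smooth_on_imp_continuous_on[OF that] \<open>K \<subseteq> U\<close> continuous_on_subset by blast
    then have "bounded (g ` K)"
      using \<open>compact K\<close> compact_continuous_image compact_imp_bounded by blast
    then show ?thesis by (auto simp: bounded_iff)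
  qed
  obtain B where B: "\<And>x. x \<in> K \<Longrightarrow> norm (f x) \<le> B"
    using bd[OF 0] by blast
  have "\<forall>b. \<exists>C. \<forall>x\<in>K. norm (frechet_derivative f (at x) b) \<le> C"
    using bd smooth_onD_derivative[OF 0] by blast
  then obtain C where C: "\<And>b x. x \<in> K \<Longrightarrow> norm (frechet_derivative f (at x) b) \<le> C b"
    by metis
  define L where "L = (\<Sum>b\<in>Basis. C b)"
  have lip: "norm (f x - f y) \<le> L * norm (x - y)" if "x \<in> K" "y \<in> K" for x y
  proof (rule differentiable_bound[OF \<open>convex K\<close> _ _ that])
    fix z assume z: "z \<in> K"
    have d: "(f has_derivative frechet_derivative f (at z)) (at z)"
      using smooth_onD_derivative[OF 0] z \<open>K \<subseteq> U\<close> by blast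
    then show "(f has_derivative frechet_derivative f (at z)) (at z within K)"
      by (rule has_derivative_at_withinI)
    interpret d: bounded_linear "frechet_derivative f (at z)"
      using d by (rule has_derivative_bounded_linear)
    show "onorm (frechet_derivative f (at z)) \<le> L"
    proof (rule onorm_le)
      fix w
      have "norm (frechet_derivative f (at z) w)
          = norm (frechet_derivative f (at z) (\<Sum>b\<in>Basis. (w \<bullet> b) *\<^sub>R b))"
        by (simp only: euclidean_representation)
      also have "\<dots> = norm (\<Sum>b\<in>Basis. (w \<bullet> b) *\<^sub>R frechet_derivative f (at z) b)"
        by (simp only: d.sum d.scaleR)
      also have "\<dots> \<le> (\<Sum>b\<in>Basis. norm w * C b)"
        by (rule sum_norm_le) (auto intro!: mult_mono C z Basis_le_norm)
      finally show "norm (frechet_derivative f (at z) w) \<le> L * norm w"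
        by (simp add: L_def sum_distrib_left mult.commute)
    qed
  qed
  show ?case
    by (rule Ck_family_0I[of _ _ B L]) (use B lip \<open>S \<subseteq> K\<close> in auto)
next
  case (Suc m)
  have "Ck_family 0 S (\<lambda>i::'i. f)"
    using Ck_family_imp_0[OF Suc.IH[OF Suc.prems]] .
  moreover have "f differentiable (at x)" if "x \<in> S" for x
    using smooth_onD_derivative(1)[OF Suc.prems] that \<open>S \<subseteq> K\<close> \<open>K \<subseteq> U\<close> differentiable_def by blast
  ultimately show ?case
    using Suc.IH[OF smooth_onD_derivative(2)[OF Suc.prems]] by simp
qed

text \<open>Transfers the calculus of families to \<open>smooth_on\<close>: near each point of an
  open domain a smooth function is a one-member family, so products and compositions need no second
  induction.\<close>

lemma smooth_on_local:
  assumes "\<And>x. x \<in> S \<Longrightarrow> \<exists>T. x \<in> T \<and> open T \<and> (\<forall>m. Ck_family m T (\<lambda>i::unit. f))"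
  shows "smooth_on S f"
  unfolding smooth_on_def
proof
  fix k
  show "Ck_on k S f"
  proof (rule Ck_on_local)
    fix x assume "x \<in> S"
    then obtain T where T: "x \<in> T" "open T" "\<And>m. Ck_family m T (\<lambda>i::unit. f)"
      using assms by blast
    then show "\<exists>T. x \<in> T \<and> open T \<and> Ck_on k T f"
      using Ck_family_imp_Ck_on[OF T(3)] by blast
  qed
qed

lemma smooth_on_ball:
  fixes f :: "'a::euclidean_space \<Rightarrow> 'b::real_normed_vector"
  assumes "smooth_on S f" "open S" "x \<in> S"
  obtains e where "e > 0" "cball x e \<subseteq> S" "\<And>d m. d \<le> e \<Longrightarrow> Ck_family m (ball x d) (\<lambda>i::unit. f)"
proof -
  obtain e where e: "e > 0" "cball x e \<subseteq> S"
    using assms open_contains_cball by blast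
  show thesis
    by (rule that[OF e], rule smooth_on_Ck_family[OF assms(1) compact_cball convex_cball e(2)]) auto
qed

section \<open>Closure rules for smooth functions\<close>

lemma smooth_on_subset: "smooth_on S f \<Longrightarrow> T \<subseteq> S \<Longrightarrow> smooth_on T f"
proof -
  have "Ck_on k S f \<Longrightarrow> T \<subseteq> S \<Longrightarrow> Ck_on k T f" for k
    by (induction k arbitrary: f) (auto intro: continuous_on_subset)
  then show "smooth_on S f \<Longrightarrow> T \<subseteq> S \<Longrightarrow> smooth_on T f"
    unfolding smooth_on_def by blast
qed

lemma smooth_on_const: "smooth_on S (\<lambda>x. c)"
proof -
  have "Ck_on k S (\<lambda>x. c)" for k
    by (induction k arbitrary: c) auto
  then show ?thesis by (simp add: smooth_on_def)
qed

lemma smooth_on_bounded_linear: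
  assumes "bounded_linear f"
  shows "smooth_on S f"
  unfolding smooth_on_def
proof
  fix k
  have d: "(f has_derivative f) (at x)" for x
    using bounded_linear.has_derivative[OF assms has_derivative_ident] by simp
  then have "frechet_derivative f (at x) = f" for x
    by (metis frechet_derivative_at)
  then show "Ck_on k S f"
    using d smooth_on_const[of S] linear_continuous_on[OF assms]
    by (cases k) (auto simp: smooth_on_def differentiable_def)
qed

lemma smooth_on_bilinear:
  fixes f :: "'a::euclidean_space \<Rightarrow> 'b::real_normed_vector"
  assumes "bounded_bilinear bop" "open S" "smooth_on S f" "smooth_on S g"
  shows "smooth_on S (\<lambda>x. bop (f x) (g x))"
proof (rule smooth_on_local)
  fix x assume x: "x \<in> S"
  obtain d where d: "d > 0" "\<And>c m. c \<le> d \<Longrightarrow> Ck_family m (ball x c) (\<lambda>i::unit. f)"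
    using smooth_on_ball[OF assms(3,2) x] by metis
  obtain e where e: "e > 0" "\<And>c m. c \<le> e \<Longrightarrow> Ck_family m (ball x c) (\<lambda>i::unit. g)"
    using smooth_on_ball[OF assms(4,2) x] by metis
  have "Ck_family m (ball x (min d e)) (\<lambda>i::unit. \<lambda>x. bop (f x) (g x))" for m
    by (intro Ck_family_bilinear[OF assms(1) open_ball] d e) auto
  then show "\<exists>T. x \<in> T \<and> open T \<and> (\<forall>m. Ck_family m T (\<lambda>i::unit. \<lambda>x. bop (f x) (g x)))"
    using d(1) e(1) by (intro exI[of _ "ball x (min d e)"]) auto
qed

lemma smooth_on_compose:
  fixes f :: "'a::euclidean_space \<Rightarrow> 'b::euclidean_space"
  assumes "smooth_on S f" "open S" "smooth_on T g" "open T" "f ` S \<subseteq> T"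
  shows "smooth_on S (\<lambda>x. g (f x))"
proof (rule smooth_on_local)
  fix x assume x: "x \<in> S"
  obtain d where d: "d > 0" "cball x d \<subseteq> S" "\<And>c m. c \<le> d \<Longrightarrow> Ck_family m (ball x c) (\<lambda>i::unit. f)"
    using smooth_on_ball[OF assms(1,2) x] by metis
  have "f x \<in> T" using x assms by blast
  then obtain e where e: "e > 0" "\<And>c m. c \<le> e \<Longrightarrow> Ck_family m (ball (f x) c) (\<lambda>i::unit. g)"
    using smooth_on_ball[OF assms(3,4)] by metis
  have "isCont f x"
    using smooth_on_imp_continuous_on[OF assms(1)] assms(2) x continuous_on_eq_continuous_at by blast
  then obtain c where c: "c > 0" "\<And>y. dist y x < c \<Longrightarrow> dist (f y) (f x) < e"
    using e(1) unfolding continuous_at_eps_delta by metis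
  have "Ck_family m (ball x (min c d)) (\<lambda>i::unit. \<lambda>x. g (f x))" for m
    by (intro Ck_family_compose[OF open_ball d(3) e(2)[of e]])
      (use c in \<open>auto simp: dist_commute\<close>)
  then show "\<exists>T. x \<in> T \<and> open T \<and> (\<forall>m. Ck_family m T (\<lambda>i::unit. \<lambda>x. g (f x)))"
    using d(1) c(1) by (intro exI[of _ "ball x (min c d)"]) auto
qed

lemma smooth_on_Pair:
  fixes f :: "'a::euclidean_space \<Rightarrow> 'b::real_normed_vector"
  assumes "open S" "smooth_on S f" "smooth_on S g"
  shows "smooth_on S (\<lambda>x. (f x, g x))"
proof (rule smooth_on_local)
  fix x assume x: "x \<in> S"
  obtain d where d: "d > 0" "\<And>c m. c \<le> d \<Longrightarrow> Ck_family m (ball x c) (\<lambda>i::unit. f)"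
    using smooth_on_ball[OF assms(2,1) x] by metis
  obtain e where e: "e > 0" "\<And>c m. c \<le> e \<Longrightarrow> Ck_family m (ball x c) (\<lambda>i::unit. g)"
    using smooth_on_ball[OF assms(3,1) x] by metis
  have "Ck_family m (ball x (min d e)) (\<lambda>i::unit. \<lambda>x. (f x, g x))" for m
    by (intro Ck_family_Pair d e) auto
  then show "\<exists>T. x \<in> T \<and> open T \<and> (\<forall>m. Ck_family m T (\<lambda>i::unit. \<lambda>x. (f x, g x)))"
    using d(1) e(1) by (intro exI[of _ "ball x (min d e)"]) auto
qed

lemma smooth_on_linear_compose:
  fixes f :: "'a::euclidean_space \<Rightarrow> 'b::euclidean_space"
  assumes "bounded_linear h" "open S" "smooth_on S f"
  shows "smooth_on S (\<lambda>x. h (f x))"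
  by (rule smooth_on_compose[OF assms(3,2) smooth_on_bounded_linear[OF assms(1)] open_UNIV]) auto

lemma smooth_on_add:
  fixes f g :: "'a::euclidean_space \<Rightarrow> 'b::euclidean_space"
  assumes "open S" "smooth_on S f" "smooth_on S g"
  shows "smooth_on S (\<lambda>x. f x + g x)"
  using smooth_on_linear_compose[OF bounded_linear_add[OF bounded_linear_fst bounded_linear_snd] assms(1)
      smooth_on_Pair[OF assms]] by simp

lemma smooth_on_diff:
  fixes f g :: "'a::euclidean_space \<Rightarrow> 'b::euclidean_space"
  assumes "open S" "smooth_on S f" "smooth_on S g"
  shows "smooth_on S (\<lambda>x. f x - g x)"
  using smooth_on_linear_compose[OF bounded_linear_sub[OF bounded_linear_fst bounded_linear_snd] assms(1)
      smooth_on_Pair[OF assms]] by simp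

lemma Ck_on_cong:
  assumes "open S" "Ck_on k S f" "\<And>x. x \<in> S \<Longrightarrow> f x = g x"
  shows "Ck_on k S g"
  using assms(2,3)
proof (induction k arbitrary: f g)
  case 0
  then show ?case by (simp cong: continuous_on_cong)
next
  case (Suc k)
  have D: "(g has_derivative frechet_derivative f (at x)) (at x)" if "x \<in> S" for x
    by (rule has_derivative_transform_within_open[where f = f and s = S])
      (use Suc.prems \<open>open S\<close> that in \<open>simp_all add: frechet_derivative_works\<close>)
  have "Ck_on k S (\<lambda>x. frechet_derivative g (at x) v)" for v
  proof (rule Suc.IH)
    show "frechet_derivative f (at x) v = frechet_derivative g (at x) v" if "x \<in> S" for x
      using frechet_derivative_at[OF D[OF that]] by metis
    show "Ck_on k S (\<lambda>x. frechet_derivative f (at x) v)"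
      using Suc.prems by simp
  qed
  with D show ?case unfolding Ck_on.simps differentiable_def by blast
qed

lemma smooth_on_cong:
  "open S \<Longrightarrow> smooth_on S f \<Longrightarrow> (\<And>x. x \<in> S \<Longrightarrow> f x = g x) \<Longrightarrow> smooth_on S g"
  unfolding smooth_on_def using Ck_on_cong by blast

text \<open>Square root and reciprocal on the positive reals are both powers, so this covers
  both.\<close>

lemma smooth_on_powr: "smooth_on {0<..} (\<lambda>x::real. x powr a)"
proof -
  \<comment> \<open>The factor \<open>c\<close> makes the induction work: each differentiation
    multiplies by the current exponent.\<close>
  have "Ck_on k {0<..} (\<lambda>x::real. c * x powr a)" for k c
  proof (induction k arbitrary: c a)
    case 0
    show ?case by (auto intro!: continuous_intros)
  next
    case (Suc k)
    have d: "((\<lambda>x::real. c * x powr a) has_derivative (\<lambda>v. ((c * a * v) * x powr (a - 1)))) (at x)"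
      if "x > 0" for x
      using that by (auto intro!: derivative_eq_intros simp: field_simps powr_diff)
    have "Ck_on k {0<..} (\<lambda>x. frechet_derivative (\<lambda>x. c * x powr a) (at x) v)" for v
    proof -
      have "Ck_on k {0<..} (\<lambda>x. (c * a * v) * x powr (a - 1))"
        by (rule Suc.IH)
      then show ?thesis
        by (rule Ck_on_cong[OF open_greaterThan]) (simp add: frechet_derivative_at[OF d, symmetric])
    qed
    with d show ?case by (auto simp: differentiable_def)
  qed
  from this[of _ 1] show ?thesis
    unfolding smooth_on_def by simp
qed

lemma smooth_on_sqrt:
  fixes f :: "'a::euclidean_space \<Rightarrow> real"
  assumes "open S" "smooth_on S f" "\<And>x. x \<in> S \<Longrightarrow> f x > 0"
  shows "smooth_on S (\<lambda>x. sqrt (f x))"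
proof (rule smooth_on_cong[OF assms(1)])
  show "smooth_on S (\<lambda>x. f x powr (1/2))"
    by (rule smooth_on_compose[OF assms(2,1) smooth_on_powr]) (use assms in auto)
qed (use assms(3) in \<open>auto simp: powr_half_sqrt less_imp_le\<close>)

lemma smooth_on_divide:
  fixes f g :: "'a::euclidean_space \<Rightarrow> real"
  assumes "open S" "smooth_on S f" "smooth_on S g" "\<And>x. x \<in> S \<Longrightarrow> g x > 0"
  shows "smooth_on S (\<lambda>x. f x / g x)"
proof (rule smooth_on_cong[OF assms(1)])
  show "smooth_on S (\<lambda>x. f x * g x powr (-1))"
    by (intro smooth_on_bilinear[OF bounded_bilinear_mult assms(1,2)]
        smooth_on_compose[OF assms(3,1) smooth_on_powr]) (use assms in auto)
  show "f x * g x powr - 1 = f x / g x" if "x \<in> S" for x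
    using assms(4)[OF that] by (simp add: powr_minus_divide)
qed

lemmas smooth_on_mult = smooth_on_bilinear[OF bounded_bilinear_mult]
lemmas smooth_on_scaleR = smooth_on_bilinear[OF bounded_bilinear_scaleR]
lemmas smooth_on_inner = smooth_on_bilinear[OF bounded_bilinear_inner]

lemma smooth_on_power2:
  fixes f :: "'a::euclidean_space \<Rightarrow> real"
  assumes "open S" "smooth_on S f"
  shows "smooth_on S (\<lambda>x. (f x)\<^sup>2)"
  unfolding power2_eq_square by (rule smooth_on_mult[OF assms(1,2,2)])

lemma smooth_on_ident: "smooth_on S (\<lambda>x. x)"
  by (rule smooth_on_bounded_linear[OF bounded_linear_ident])

lemma smooth_on_fst:
  fixes f :: "'a::euclidean_space \<Rightarrow> 'b::euclidean_space \<times> 'c::euclidean_space"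
  assumes "open S" "smooth_on S f"
  shows "smooth_on S (\<lambda>x. fst (f x))"
  by (rule smooth_on_linear_compose[OF bounded_linear_fst assms])

lemma smooth_on_snd:
  fixes f :: "'a::euclidean_space \<Rightarrow> 'b::euclidean_space \<times> 'c::euclidean_space"
  assumes "open S" "smooth_on S f"
  shows "smooth_on S (\<lambda>x. snd (f x))"
  by (rule smooth_on_linear_compose[OF bounded_linear_snd assms])

lemmas smooth_on_intros = smooth_on_const smooth_on_ident smooth_on_fst smooth_on_snd smooth_on_add
  smooth_on_diff smooth_on_mult smooth_on_scaleR smooth_on_inner smooth_on_power2 smooth_on_sqrt
  smooth_on_divide smooth_on_Pair

lemma smooth_on_real_deriv:
  fixes f :: "real \<Rightarrow> real"
  assumes "smooth_on S f"
  shows "\<And>x. x \<in> S \<Longrightarrow> (f has_real_derivative deriv f x) (at x)" "open S \<Longrightarrow> smooth_on S (deriv f)"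
proof -
  have D: "frechet_derivative f (at x) 1 = deriv f x \<and> (f has_real_derivative deriv f x) (at x)" if "x \<in> S" for x
  proof -
    have d: "(f has_derivative frechet_derivative f (at x)) (at x)"
      by (rule smooth_onD_derivative(1)[OF assms that])
    then obtain c where c: "(f has_real_derivative c) (at x)"
      using has_derivative_imp_has_field_derivative
      by (metis (no_types, lifting) differentiable_def real_differentiable_def)
    then have "deriv f x = c" by (rule DERIV_imp_deriv)
    moreover have "frechet_derivative f (at x) = (\<lambda>v. c * v)"
      using c unfolding has_field_derivative_def by (metis frechet_derivative_at)
    ultimately show ?thesis using c by simp
  qed
  then show "(f has_real_derivative deriv f x) (at x)" if "x \<in> S" for x
    using that by blast
  show "smooth_on S (deriv f)" if "open S"
    by (rule smooth_on_cong[OF that smooth_onD_derivative(2)[OF assms, of 1]]) (use D in auto)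
qed

section \<open>Contractions coupling neighbouring terms of a sequence\<close>

text \<open>The supremum \<open>S\<close> of all \<open>\<bar>e k\<bar>\<close> satisfies
  \<open>S \<le> q * S + B\<close>; the a priori bound \<open>M\<close> makes \<open>S\<close>
  finite. Subtraction is truncated, so the left neighbour of entry 0 is entry 0 itself and no
  boundary condition has to be stated.\<close>

lemma neighbour_maximum_principle:
  fixes e :: "nat \<Rightarrow> real"
  assumes "\<And>k. \<bar>e k\<bar> \<le> M" "0 \<le> q" "q < 1"
    and "\<And>k d. \<bar>e (k - 1)\<bar> \<le> d \<Longrightarrow> \<bar>e k\<bar> \<le> d \<Longrightarrow> \<bar>e (Suc k)\<bar> \<le> d \<Longrightarrow> \<bar>e k\<bar> \<le> q * d + B"
  shows "\<bar>e k\<bar> \<le> B / (1 - q)"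
proof -
  define S where "S = (SUP k. \<bar>e k\<bar>)"
  have bdd: "bdd_above (range (\<lambda>k. \<bar>e k\<bar>))"
    using assms(1) by (auto simp: bdd_above_def)
  have S: "\<bar>e k\<bar> \<le> S" for k
    unfolding S_def by (rule cSUP_upper[OF UNIV_I bdd])
  have "S \<le> q * S + B"
    unfolding S_def by (rule cSUP_least) (use assms(4) S in \<open>auto simp: S_def\<close>)
  then have "S * (1 - q) \<le> B"
    by (simp add: algebra_simps)
  then have "S \<le> B / (1 - q)"
    using \<open>q < 1\<close> by (simp add: pos_le_divide_eq)
  with S[of k] show ?thesis by linarith
qed

text \<open>Banach's fixed point theorem in the supremum norm, done by hand: the iterates starting
  from 0 converge in each entry at a geometric rate that does not depend on the entry.\<close>

lemma neighbour_contraction_fixed_point: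
  fixes \<Phi> :: "nat \<Rightarrow> real \<times> real \<times> real \<Rightarrow> real"
  assumes "0 \<le> R" "0 \<le> q" "q < 1"
    and into: "\<And>k a b c. \<bar>a\<bar> \<le> R \<Longrightarrow> \<bar>b\<bar> \<le> R \<Longrightarrow> \<bar>c\<bar> \<le> R \<Longrightarrow> \<bar>\<Phi> k (a, b, c)\<bar> \<le> R"
    and lip: "\<And>k a b c a' b' c' d. \<lbrakk>\<bar>a\<bar> \<le> R; \<bar>b\<bar> \<le> R; \<bar>c\<bar> \<le> R; \<bar>a'\<bar> \<le> R; \<bar>b'\<bar> \<le> R; \<bar>c'\<bar> \<le> R;
        \<bar>a - a'\<bar> \<le> d; \<bar>b - b'\<bar> \<le> d; \<bar>c - c'\<bar> \<le> d\<rbrakk> \<Longrightarrow> \<bar>\<Phi> k (a, b, c) - \<Phi> k (a', b', c')\<bar> \<le> q * d"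
  shows "\<exists>X. \<forall>k. \<bar>X k\<bar> \<le> R \<and> X k = \<Phi> k (X (k - 1), X k, X (Suc k))"
proof -
  define T where "T X = (\<lambda>k. \<Phi> k (X (k - 1), X k, X (Suc k)))" for X :: "nat \<Rightarrow> real"
  define X where "X n = (T ^^ n) (\<lambda>_. 0)" for n
  have X_Suc: "X (Suc n) k = \<Phi> k (X n (k - 1), X n k, X n (Suc k))" for n k
    by (simp add: X_def T_def)
  have bd: "\<bar>X n k\<bar> \<le> R" for n k
  proof (induction n arbitrary: k)
    case 0
    then show ?case using assms(1) by (simp add: X_def)
  next
    case (Suc n)
    then show ?case unfolding X_Suc by (intro into)
  qed
  have step: "\<bar>X (Suc n) k - X n k\<bar> \<le> q ^ n * R" for n k
  proof (induction n arbitrary: k)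
    case 0
    have "X 0 k = 0" by (simp add: X_def)
    with bd[of "Suc 0" k] show ?case by simp
  next
    case (Suc n)
    have "\<bar>\<Phi> k (X (Suc n) (k - 1), X (Suc n) k, X (Suc n) (Suc k)) - \<Phi> k (X n (k - 1), X n k, X n (Suc k))\<bar>
        \<le> q * (q ^ n * R)"
      by (intro lip bd Suc.IH)
    then show ?case by (simp only: X_Suc[symmetric] power_Suc mult.assoc)
  qed
  \<comment> \<open>The partial geometric sum is kept exactly, because the cruder bound
    \<open>R * q ^ n / (1 - q)\<close> would not pass through the induction on
    \<open>i\<close>.\<close>
  have tail: "\<bar>X (n + i) k - X n k\<bar> \<le> R * (q ^ n - q ^ (n + i)) / (1 - q)" for n i k
  proof (induction i)
    case (Suc i)
    have "\<bar>X (n + Suc i) k - X n k\<bar> \<le> q ^ (n + i) * R + R * (q ^ n - q ^ (n + i)) / (1 - q)"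
      using step[of "n + i" k] Suc.IH by simp
    also have "\<dots> = R * (q ^ n - q ^ (n + Suc i)) / (1 - q)"
      using \<open>q < 1\<close> by (simp add: field_simps)
    finally show ?case .
  qed simp
  have tail': "\<bar>X m k - X n k\<bar> \<le> R * q ^ n / (1 - q)" if "n \<le> m" for n m k
  proof -
    have "R * (q ^ n - q ^ m) / (1 - q) \<le> R * q ^ n / (1 - q)"
      using assms(1-3) by (intro divide_right_mono mult_left_mono) auto
    with tail[of n "m - n" k] that show ?thesis by simp
  qed
  have lim0: "(\<lambda>n. R * q ^ n / (1 - q)) \<longlonglongrightarrow> 0"
    using tendsto_divide[OF tendsto_mult[OF tendsto_const LIMSEQ_realpow_zero[OF assms(2,3)]] tendsto_const, of "1 - q" R]
      \<open>q < 1\<close> by simp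
  have "Cauchy (\<lambda>n. X n k)" for k
  proof (rule CauchyI')
    fix e :: real assume "e > 0"
    then have "\<forall>\<^sub>F n in sequentially. R * q ^ n / (1 - q) < e"
      using lim0 order_tendstoD(2) by blast
    then obtain N where N: "\<And>n. n \<ge> N \<Longrightarrow> R * q ^ n / (1 - q) < e"
      unfolding eventually_sequentially by blast
    have "dist (X m k) (X n k) < e" if "m \<ge> N" "n > m" for m n
      using tail'[of m n k] N[OF that(1)] that(2) by (simp add: dist_real_def abs_minus_commute)
    then show "\<exists>M. \<forall>m\<ge>M. \<forall>n>m. dist (X m k) (X n k) < e"
      by blast
  qed
  then have "\<exists>L. (\<lambda>n. X n k) \<longlonglongrightarrow> L" for k
    by (metis Cauchy_convergent convergent_def)
  then obtain Y where Y: "\<And>k. (\<lambda>n. X n k) \<longlonglongrightarrow> Y k"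
    by metis
  have Ybd: "\<bar>Y k\<bar> \<le> R" for k
    using bd by (intro LIMSEQ_le_const2[OF tendsto_rabs[OF Y]]) auto
  have Ytail: "\<bar>Y k - X n k\<bar> \<le> R * q ^ n / (1 - q)" for n k
    by (rule LIMSEQ_le_const2[OF tendsto_rabs[OF tendsto_diff[OF Y tendsto_const]]])
      (use tail' in auto)
  have "Y k = \<Phi> k (Y (k - 1), Y k, Y (Suc k))" for k
  proof -
    \<comment> \<open>The contraction estimate stands in for continuity of \<open>\<Phi> k\<close>:
      the iterates are close to \<open>Y\<close> at all three neighbours at once.\<close>
    have "(\<lambda>n. X (Suc n) k - \<Phi> k (Y (k - 1), Y k, Y (Suc k))) \<longlonglongrightarrow> 0"
    proof (rule Lim_null_comparison[OF _ lim0])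
      have "\<bar>X (Suc n) k - \<Phi> k (Y (k - 1), Y k, Y (Suc k))\<bar> \<le> R * q ^ n / (1 - q)" for n
      proof -
        have "\<bar>X (Suc n) k - \<Phi> k (Y (k - 1), Y k, Y (Suc k))\<bar> \<le> q * (R * q ^ n / (1 - q))"
          unfolding X_Suc using Ytail by (intro lip bd Ybd) (auto simp: abs_minus_commute)
        also have "\<dots> \<le> 1 * (R * q ^ n / (1 - q))"
          using assms(1-3) by (intro mult_right_mono) auto
        finally show ?thesis by simp
      qed
      then show "\<forall>\<^sub>F n in sequentially. norm (X (Suc n) k - \<Phi> k (Y (k - 1), Y k, Y (Suc k))) \<le> R * q ^ n / (1 - q)"
        by simp
    qed
    then have "(\<lambda>n. X (Suc n) k) \<longlonglongrightarrow> \<Phi> k (Y (k - 1), Y k, Y (Suc k))"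
      by (simp add: LIM_zero_iff)
    moreover have "(\<lambda>n. X (Suc n) k) \<longlonglongrightarrow> Y k"
      using Y by (rule LIMSEQ_Suc)
    ultimately show ?thesis
      using LIMSEQ_unique by blast
  qed
  with Ybd show ?thesis by blast
qed

section \<open>Derivative estimates uniform over a family\<close>

lemma Ck_family_derivative_lipschitz:
  fixes f :: "'i \<Rightarrow> 'a::euclidean_space \<Rightarrow> 'b::real_normed_vector"
  assumes "Ck_family (Suc 0) S f"
  shows "\<exists>L\<ge>0. \<forall>i. \<forall>x\<in>S. \<forall>z\<in>S. \<forall>w.
    norm (frechet_derivative (f i) (at z) w - frechet_derivative (f i) (at x) w) \<le> L * norm (z - x) * norm w"
proof -
  have d: "(f i has_derivative frechet_derivative (f i) (at x)) (at x)" if "x \<in> S" for i x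
    by (rule Ck_family_derivative[OF assms that])
  have "\<forall>b. Ck_family 0 S (\<lambda>i x. frechet_derivative (f i) (at x) b)"
    using assms by simp
  then have "\<forall>b. \<exists>C\<ge>0. \<forall>i. \<forall>x\<in>S. \<forall>y\<in>S.
      norm (frechet_derivative (f i) (at x) b - frechet_derivative (f i) (at y) b) \<le> C * norm (x - y)"
    using Ck_family_0D by blast
  then obtain C where C0: "\<And>b. C b \<ge> 0" and C: "\<And>b i x y. x \<in> S \<Longrightarrow> y \<in> S \<Longrightarrow>
      norm (frechet_derivative (f i) (at x) b - frechet_derivative (f i) (at y) b) \<le> C b * norm (x - y)"
    by metis
  define L where "L = (\<Sum>b\<in>Basis. C b)"
  have L0: "L \<ge> 0"
    unfolding L_def by (intro sum_nonneg C0)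
  have lip: "norm (frechet_derivative (f i) (at z) w - frechet_derivative (f i) (at x) w) \<le> L * norm (z - x) * norm w"
    if "z \<in> S" "x \<in> S" for i x z and w :: 'a
  proof -
    interpret z: bounded_linear "frechet_derivative (f i) (at z)"
      using d[OF that(1)] by (rule has_derivative_bounded_linear)
    interpret x: bounded_linear "frechet_derivative (f i) (at x)"
      using d[OF that(2)] by (rule has_derivative_bounded_linear)
    have "frechet_derivative (f i) (at z) w - frechet_derivative (f i) (at x) w
       = frechet_derivative (f i) (at z) (\<Sum>b\<in>Basis. (w \<bullet> b) *\<^sub>R b)
         - frechet_derivative (f i) (at x) (\<Sum>b\<in>Basis. (w \<bullet> b) *\<^sub>R b)"
      by (simp only: euclidean_representation)
    also have "\<dots> = (\<Sum>b\<in>Basis. (w \<bullet> b) *\<^sub>R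
        (frechet_derivative (f i) (at z) b - frechet_derivative (f i) (at x) b))"
      by (simp only: z.sum z.scaleR x.sum x.scaleR scaleR_diff_right sum_subtractf)
    finally have eq: "frechet_derivative (f i) (at z) w - frechet_derivative (f i) (at x) w = \<dots>" .
    show ?thesis
      unfolding eq
    proof (rule order_trans[OF sum_norm_le])
      show "norm ((w \<bullet> b) *\<^sub>R (frechet_derivative (f i) (at z) b - frechet_derivative (f i) (at x) b))
          \<le> norm w * (C b * norm (z - x))" if "b \<in> Basis" for b
        unfolding norm_scaleR using Basis_le_norm[OF that, of w] C[OF \<open>z \<in> S\<close> \<open>x \<in> S\<close>, of i b]
        by (intro mult_mono) auto
    qed (simp add: L_def sum_distrib_left sum_distrib_right mult_ac)
  qed
  with L0 show ?thesis by blast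
qed

text \<open>The mean value inequality on the segment from \<open>x\<close> to \<open>y\<close>,
  applied to \<open>f i\<close> minus its derivative frozen at \<open>x\<close>; the Lipschitz bound
  on derivatives makes the constant independent of \<open>i\<close>.\<close>

lemma Ck_family_taylor:
  fixes f :: "'i \<Rightarrow> 'a::euclidean_space \<Rightarrow> 'b::real_normed_vector"
  assumes "Ck_family (Suc 0) S f" "convex S"
  shows "\<exists>C\<ge>0. \<forall>i. \<forall>x\<in>S. \<forall>y\<in>S.
    norm (f i y - f i x - frechet_derivative (f i) (at x) (y - x)) \<le> C * (norm (y - x))\<^sup>2"
proof -
  have d: "(f i has_derivative frechet_derivative (f i) (at x)) (at x)" if "x \<in> S" for i x
    by (rule Ck_family_derivative[OF assms(1) that])
  obtain L where L0: "L \<ge> 0" and lip: "\<And>i x z w. z \<in> S \<Longrightarrow> x \<in> S \<Longrightarrow>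
    norm (frechet_derivative (f i) (at z) w - frechet_derivative (f i) (at x) w) \<le> L * norm (z - x) * norm w"
    using Ck_family_derivative_lipschitz[OF assms(1)] by blast
  have "norm (f i y - f i x - frechet_derivative (f i) (at x) (y - x)) \<le> L * (norm (y - x))\<^sup>2"
    if xy: "x \<in> S" "y \<in> S" for i x y
  proof -
    interpret x: bounded_linear "frechet_derivative (f i) (at x)"
      using d[OF that(1)] by (rule has_derivative_bounded_linear)
    have seg: "closed_segment x y \<subseteq> S"
      by (rule closed_segment_subset[OF xy assms(2)])
    define g where "g z = f i z - frechet_derivative (f i) (at x) z" for z
    have "norm (g y - g x) \<le> (L * norm (y - x)) * norm (y - x)"
    proof (rule differentiable_bound[of "closed_segment x y"])
      fix z assume z: "z \<in> closed_segment x y"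
      then have "z \<in> S" using seg by blast
      show "(g has_derivative (\<lambda>w. frechet_derivative (f i) (at z) w - frechet_derivative (f i) (at x) w))
          (at z within closed_segment x y)"
        unfolding g_def
        by (rule has_derivative_at_withinI[OF has_derivative_diff[OF d[OF \<open>z \<in> S\<close>]
              x.has_derivative[OF has_derivative_ident]]])
      show "onorm (\<lambda>w. frechet_derivative (f i) (at z) w - frechet_derivative (f i) (at x) w) \<le> L * norm (y - x)"
      proof (rule onorm_le)
        fix w :: 'a
        have "L * norm (z - x) * norm w \<le> L * norm (y - x) * norm w"
          using segment_bound1[OF z] L0 by (intro mult_right_mono mult_left_mono) auto
        with lip[OF \<open>z \<in> S\<close> xy(1), of i w]
        show "norm (frechet_derivative (f i) (at z) w - frechet_derivative (f i) (at x) w) \<le> L * norm (y - x) * norm w"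
          by linarith
      qed
    qed auto
    moreover have "g y - g x = f i y - f i x - frechet_derivative (f i) (at x) (y - x)"
      by (simp add: g_def x.diff)
    ultimately show ?thesis by (simp add: power2_eq_square mult.assoc)
  qed
  with L0 show ?thesis by blast
qed

text \<open>Stated for one direction, so that it serves both the contraction constant, which refers
  to the maximum norm of three coordinates, and a Euclidean Lipschitz constant.\<close>

lemma derivative_le_directional_bound:
  fixes f :: "'a::real_normed_vector \<Rightarrow> real"
  assumes "(f has_derivative f') (at x)" "open S" "x \<in> S"
    and "\<And>t. t > 0 \<Longrightarrow> x + t *\<^sub>R h \<in> S \<Longrightarrow> \<bar>f (x + t *\<^sub>R h) - f x\<bar> \<le> t * C"
  shows "\<bar>f' h\<bar> \<le> C"
proof -
  interpret f': bounded_linear f'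
    using assms(1) by (rule has_derivative_bounded_linear)
  have aff: "((\<lambda>t::real. x + t *\<^sub>R h) has_derivative (\<lambda>t. t *\<^sub>R h)) (at 0)"
    by (auto intro!: derivative_eq_intros)
  have "((\<lambda>t::real. f (x + t *\<^sub>R h)) has_derivative (\<lambda>t. f' (t *\<^sub>R h))) (at 0)"
    by (rule has_derivative_compose[OF aff]) (use assms(1) in simp)
  then have "((\<lambda>t::real. f (x + t *\<^sub>R h)) has_real_derivative f' h) (at 0)"
    unfolding has_field_derivative_def by (simp add: f'.scaleR mult_commute_abs)
  then have "((\<lambda>t::real. f (x + t *\<^sub>R h)) has_real_derivative f' h) (at_right 0)"
    by (rule has_field_derivative_at_within)
  then have lim: "((\<lambda>t. \<bar>(f (x + t *\<^sub>R h) - f x) / t\<bar>) \<longlongrightarrow> \<bar>f' h\<bar>) (at_right 0)"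
    unfolding has_field_derivative_iff by (intro tendsto_rabs) simp
  have "((\<lambda>t::real. x + t *\<^sub>R h) \<longlongrightarrow> x + 0 *\<^sub>R h) (at_right 0)"
    by (intro tendsto_intros)
  then have "\<forall>\<^sub>F t in at_right (0::real). x + t *\<^sub>R h \<in> S"
    using assms(2,3) by (auto elim: topological_tendstoD)
  then have "\<forall>\<^sub>F t in at_right 0. \<bar>(f (x + t *\<^sub>R h) - f x) / t\<bar> \<le> C"
    using eventually_at_right_less[of 0]
    by eventually_elim (use assms(4) in \<open>auto simp: abs_divide divide_le_eq mult.commute\<close>)
  then show ?thesis
    by (rule tendsto_upperbound[OF lim]) simp
qed

lemma Ck_family_ident:
  assumes "bounded S" "open S"
  shows "Ck_family m S (\<lambda>i x. x)"
proof -
  obtain B where B: "\<And>x. x \<in> S \<Longrightarrow> norm x \<le> B"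
    using assms(1) bounded_iff by blast
  have 0: "Ck_family 0 S (\<lambda>i x. x)"
    by (rule Ck_family_0I[of _ _ B 1]) (use B in auto)
  show ?thesis
    by (cases m) (auto simp: 0 intro: Ck_family_const)
qed

lemma Ck_family_coordinates:
  assumes "bounded S" "open S"
  shows "Ck_family m S (\<lambda>i z. fst (fst z))"
    "Ck_family m S (\<lambda>i z. fst (snd (fst z)))"
    "Ck_family m S (\<lambda>i z. snd (snd (fst z)))"
    "Ck_family m S (\<lambda>i z. snd z)"
  using Ck_family_ident[OF assms] assms(2)
  by (auto intro!: Ck_family_linear[OF bounded_linear_fst] Ck_family_linear[OF bounded_linear_snd])

text \<open>Differentiating the system in direction \<open>v\<close> gives a system of the same
  kind, with the same \<open>q\<close> and with derivatives of \<open>\<Psi>\<close> as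
  coefficients. The induction on \<open>m\<close> therefore ranges over all \<open>\<Psi>\<close>,
  \<open>X\<close> and \<open>\<eta>\<close>: its hypothesis is used for \<open>X\<close> and again
  for the candidate derivative.\<close>

theorem Ck_family_neighbour_fixed_point:
  fixes \<Psi> :: "nat \<Rightarrow> (real \<times> real \<times> real) \<times> 'p::euclidean_space \<Rightarrow> real"
  assumes \<Theta>: "open \<Theta>" "convex \<Theta>" "bounded \<Theta>" and q: "0 \<le> q" "q < 1"
    and "Ck_family m (({-\<eta><..<\<eta>} \<times> {-\<eta><..<\<eta>} \<times> {-\<eta><..<\<eta>}) \<times> \<Theta>) \<Psi>"
    and "\<And>k a b c a' b' c' \<theta> d. \<lbrakk>\<bar>a\<bar> < \<eta>; \<bar>b\<bar> < \<eta>; \<bar>c\<bar> < \<eta>; \<bar>a'\<bar> < \<eta>; \<bar>b'\<bar> < \<eta>; \<bar>c'\<bar> < \<eta>;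
        \<theta> \<in> \<Theta>; \<bar>a - a'\<bar> \<le> d; \<bar>b - b'\<bar> \<le> d; \<bar>c - c'\<bar> \<le> d\<rbrakk>
        \<Longrightarrow> \<bar>\<Psi> k ((a, b, c), \<theta>) - \<Psi> k ((a', b', c'), \<theta>)\<bar> \<le> q * d"
    and "\<And>k \<theta>. \<theta> \<in> \<Theta> \<Longrightarrow> \<bar>X k \<theta>\<bar> < \<eta>"
    and "\<And>k \<theta>. \<theta> \<in> \<Theta> \<Longrightarrow> X k \<theta> = \<Psi> k ((X (k - 1) \<theta>, X k \<theta>, X (Suc k) \<theta>), \<theta>)"
  shows "Ck_family m \<Theta> X"
  using assms(6-)
proof (induction m arbitrary: \<Psi> X \<eta>)
  case 0
  note smooth = 0(1) and lip = 0(2) and bd = 0(3) and eq = 0(4)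
  from Ck_family_0D[OF smooth] obtain L where L: "L \<ge> 0"
    "\<And>k z z'. z \<in> ({-\<eta><..<\<eta>} \<times> {-\<eta><..<\<eta>} \<times> {-\<eta><..<\<eta>}) \<times> \<Theta> \<Longrightarrow>
       z' \<in> ({-\<eta><..<\<eta>} \<times> {-\<eta><..<\<eta>} \<times> {-\<eta><..<\<eta>}) \<times> \<Theta> \<Longrightarrow>
       \<bar>\<Psi> k z - \<Psi> k z'\<bar> \<le> L * norm (z - z')"
    unfolding real_norm_def by blast
  have bds: "-\<eta> < X k \<theta>" "X k \<theta> < \<eta>" if "\<theta> \<in> \<Theta>" for k \<theta>
    using bd[OF that, of k] by auto
  show ?case
  proof (rule Ck_family_0I[of _ _ \<eta> "L / (1 - q)"])
    show "norm (X k \<theta>) \<le> \<eta>" if "\<theta> \<in> \<Theta>" for k \<theta>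
      using bd[OF that, of k] by simp
    fix k \<theta> \<theta>' assume \<theta>: "\<theta> \<in> \<Theta>" "\<theta>' \<in> \<Theta>"
    \<comment> \<open>The comparison changes the sequence at a fixed parameter, which costs
      \<open>q * d\<close>, and then the parameter at a fixed sequence, which costs the error
      term.\<close>
    have "\<bar>X k \<theta> - X k \<theta>'\<bar> \<le> (L * norm (\<theta> - \<theta>')) / (1 - q)"
    proof (rule neighbour_maximum_principle[where M = "2 * \<eta>"])
      show "\<bar>X k \<theta> - X k \<theta>'\<bar> \<le> 2 * \<eta>" for k
        using bd[OF \<theta>(1), of k] bd[OF \<theta>(2), of k] by linarith
      fix k d
      assume d: "\<bar>X (k - 1) \<theta> - X (k - 1) \<theta>'\<bar> \<le> d" "\<bar>X k \<theta> - X k \<theta>'\<bar> \<le> d"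
        "\<bar>X (Suc k) \<theta> - X (Suc k) \<theta>'\<bar> \<le> d"
      let ?v = "(X (k - 1) \<theta>, X k \<theta>, X (Suc k) \<theta>)" and ?v' = "(X (k - 1) \<theta>', X k \<theta>', X (Suc k) \<theta>')"
      have "\<bar>\<Psi> k (?v, \<theta>) - \<Psi> k (?v', \<theta>)\<bar> \<le> q * d"
        by (intro lip bd \<theta> d)
      moreover have "\<bar>\<Psi> k (?v', \<theta>) - \<Psi> k (?v', \<theta>')\<bar> \<le> L * norm ((?v', \<theta>) - (?v', \<theta>'))"
        by (rule L(2)) (use \<theta> bds in auto)
      ultimately show "\<bar>X k \<theta> - X k \<theta>'\<bar> \<le> q * d + L * norm (\<theta> - \<theta>')"
        using eq[OF \<theta>(1), of k] eq[OF \<theta>(2), of k] by (simp add: norm_Pair)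
    qed (use q in auto)
    then show "norm (X k \<theta> - X k \<theta>') \<le> L / (1 - q) * norm (\<theta> - \<theta>')"
      by simp
  qed
next
  case (Suc m)
  note smooth = Suc(2) and lip = Suc(3) and bd = Suc(4) and eq = Suc(5)
  define \<Omega> where "\<Omega> = (({-\<eta><..<\<eta>} \<times> {-\<eta><..<\<eta>} \<times> {-\<eta><..<\<eta>}) \<times> \<Theta>)"
  have \<Omega>: "open \<Omega>" "convex \<Omega>"
    unfolding \<Omega>_def using \<Theta> by (auto intro!: open_Times convex_Times)
  have smooth': "Ck_family (Suc m) \<Omega> \<Psi>"
    using smooth by (simp only: \<Omega>_def)
  have Xm: "Ck_family m \<Theta> X"
    by (rule Suc.IH[OF Ck_family_SucD[OF smooth] lip bd eq])
  define V where "V k \<theta> = ((X (k - 1) \<theta>, X k \<theta>, X (Suc k) \<theta>), \<theta>)" for k \<theta>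
  have V\<Omega>: "V k \<theta> \<in> \<Omega>" if "\<theta> \<in> \<Theta>" for k \<theta>
    using bd[OF that, of "k - 1"] bd[OF that, of k] bd[OF that, of "Suc k"] that
    by (auto simp: V_def \<Omega>_def)
  have Vm: "Ck_family n \<Theta> V" if "Ck_family n \<Theta> X" for n
    unfolding V_def
    by (intro Ck_family_Pair \<Theta> Ck_family_ident that
        Ck_family_reindex[OF that, of "\<lambda>k. k - 1"] Ck_family_reindex[OF that, of Suc])
  define D where "D k \<theta> = frechet_derivative (\<Psi> k) (at (V k \<theta>))" for k \<theta>
  have D: "(\<Psi> k has_derivative D k \<theta>) (at (V k \<theta>))" if "\<theta> \<in> \<Theta>" for k \<theta>
    unfolding D_def by (rule Ck_family_derivative[OF smooth' V\<Omega>[OF that]])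
  have D_lin: "bounded_linear (D k \<theta>)" if "\<theta> \<in> \<Theta>" for k \<theta>
    using D[OF that] by (rule has_derivative_bounded_linear)
  from Ck_family_0D[OF Ck_family_imp_0[OF smooth']] obtain L where L: "L \<ge> 0"
    "\<And>k z z'. z \<in> \<Omega> \<Longrightarrow> z' \<in> \<Omega> \<Longrightarrow> \<bar>\<Psi> k z - \<Psi> k z'\<bar> \<le> L * norm (z - z')"
    unfolding real_norm_def by blast
  \<comment> \<open>The contraction bound passes to the derivative in the sequence variables, so the
    linearized system contracts with the same \<open>q\<close>.\<close>
  have D_q: "\<bar>D k \<theta> ((a, b, c), 0)\<bar> \<le> q * d" if "\<theta> \<in> \<Theta>" "\<bar>a\<bar> \<le> d" "\<bar>b\<bar> \<le> d" "\<bar>c\<bar> \<le> d" for k \<theta> a b c d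
  proof (rule derivative_le_directional_bound[OF D \<Omega>(1) V\<Omega>])
    fix t :: real assume t: "t > 0" and in\<Omega>: "V k \<theta> + t *\<^sub>R ((a, b, c), 0) \<in> \<Omega>"
    have td: "\<bar>t * x\<bar> \<le> t * d" if "\<bar>x\<bar> \<le> d" for x
      using that t by (simp add: abs_mult)
    have "\<bar>\<Psi> k ((X (k - 1) \<theta> + t * a, X k \<theta> + t * b, X (Suc k) \<theta> + t * c), \<theta>)
        - \<Psi> k ((X (k - 1) \<theta>, X k \<theta>, X (Suc k) \<theta>), \<theta>)\<bar> \<le> q * (t * d)"
      by (rule lip) (use in\<Omega> bd td that in \<open>auto simp: V_def \<Omega>_def abs_less_iff\<close>)
    then show "\<bar>\<Psi> k (V k \<theta> + t *\<^sub>R ((a, b, c), 0)) - \<Psi> k (V k \<theta>)\<bar> \<le> t * (q * d)"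
      by (simp add: V_def mult_ac)
  qed (use that in auto)
  have D_L: "\<bar>D k \<theta> z\<bar> \<le> L * norm z" if "\<theta> \<in> \<Theta>" for k \<theta> z
  proof (rule derivative_le_directional_bound[OF D[OF that] \<Omega>(1) V\<Omega>[OF that]])
    fix t :: real assume "t > 0" and "V k \<theta> + t *\<^sub>R z \<in> \<Omega>"
    then show "\<bar>\<Psi> k (V k \<theta> + t *\<^sub>R z) - \<Psi> k (V k \<theta>)\<bar> \<le> t * (L * norm z)"
      using L(2)[OF _ V\<Omega>[OF that], of "V k \<theta> + t *\<^sub>R z" k k] by (simp add: mult_ac)
  qed
  have D_split: "D k \<theta> ((a, b, c), v) = D k \<theta> ((a, b, c), 0) + D k \<theta> (0, v)" if "\<theta> \<in> \<Theta>" for k \<theta> a b c v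
    using bounded_linear.linear[OF D_lin[OF that], of k] linear_add[of "D k \<theta>" "((a, b, c), 0)" "(0, v)"]
    by (simp add: zero_prod_def)
  \<comment> \<open>The radius solves \<open>q * R v + L * norm v = R v\<close>, which makes the
    ball of this radius invariant under the linearized system with forcing \<open>v\<close>.\<close>
  define R where "R v = L * norm v / (1 - q)" for v :: 'p
  have R0: "R v \<ge> 0" for v
    using L(1) q by (simp add: R_def)
  have "\<exists>Y. \<forall>k. \<bar>Y k\<bar> \<le> R v \<and> Y k = D k \<theta> ((Y (k - 1), Y k, Y (Suc k)), v)" if "\<theta> \<in> \<Theta>" for \<theta> v
  proof (rule neighbour_contraction_fixed_point[OF R0 q])
    fix k a b c assume abc: "\<bar>a\<bar> \<le> R v" "\<bar>b\<bar> \<le> R v" "\<bar>c\<bar> \<le> R v"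
    have "\<bar>D k \<theta> ((a, b, c), v)\<bar> \<le> q * R v + L * norm v"
      unfolding D_split[OF that, of k a b c v]
      using D_q[OF that abc, of k] D_L[OF that, of k "(0, v)"] by (simp add: norm_Pair)
    also have "\<dots> = R v"
      using q by (simp add: R_def field_simps)
    finally show "\<bar>D k \<theta> ((a, b, c), v)\<bar> \<le> R v" .
  next
    fix k and a b c a' b' c' d :: real
    assume "\<bar>a - a'\<bar> \<le> d" "\<bar>b - b'\<bar> \<le> d" "\<bar>c - c'\<bar> \<le> d"
    then have "\<bar>D k \<theta> ((a - a', b - b', c - c'), 0)\<bar> \<le> q * d"
      using D_q[OF that] by blast
    moreover have "D k \<theta> ((a, b, c), v) - D k \<theta> ((a', b', c'), v) = D k \<theta> ((a - a', b - b', c - c'), 0)"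
      using linear_diff[OF bounded_linear.linear[OF D_lin[OF that, of k]], of "((a, b, c), v)" "((a', b', c'), v)"]
      by simp
    ultimately show "\<bar>D k \<theta> ((a, b, c), v) - D k \<theta> ((a', b', c'), v)\<bar> \<le> q * d" by simp
  qed
  then have "\<forall>v \<theta>. \<exists>Y. \<theta> \<in> \<Theta> \<longrightarrow> (\<forall>k. \<bar>Y k\<bar> \<le> R v \<and> Y k = D k \<theta> ((Y (k - 1), Y k, Y (Suc k)), v))"
    by blast
  then obtain Y0 where "\<forall>v \<theta>. \<theta> \<in> \<Theta> \<longrightarrow> (\<forall>k. \<bar>Y0 v \<theta> k\<bar> \<le> R v \<and>
      Y0 v \<theta> k = D k \<theta> ((Y0 v \<theta> (k - 1), Y0 v \<theta> k, Y0 v \<theta> (Suc k)), v))"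
    by metis
  then obtain Y where Ybd: "\<And>v k \<theta>. \<theta> \<in> \<Theta> \<Longrightarrow> \<bar>Y v k \<theta>\<bar> \<le> R v"
    and Yeq: "\<And>v k \<theta>. \<theta> \<in> \<Theta> \<Longrightarrow> Y v k \<theta> = D k \<theta> ((Y v (k - 1) \<theta>, Y v k \<theta>, Y v (Suc k) \<theta>), v)"
    using that[of "\<lambda>v k \<theta>. Y0 v \<theta> k"] by blast
  have Ym: "Ck_family m \<Theta> (Y v)" for v
  proof -
    \<comment> \<open>Enlarging the radius by 1 supplies the strict bounds that the induction
      hypothesis demands.\<close>
    let ?B = "{-(R v + 1)<..<R v + 1}"
    let ?S = "(?B \<times> ?B \<times> ?B) \<times> \<Theta>"
    have S: "open ?S" "bounded ?S"
      using \<Theta> by (auto intro!: open_Times bounded_Times bounded_Ioo)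
    show ?thesis
    proof (rule Suc.IH[where \<Psi> = "\<lambda>k z. D k (snd z) (fst z, v)" and \<eta> = "R v + 1"])
      have Dm: "Ck_family m ?S (\<lambda>k z. D k (snd z) w)" for w
      proof -
        have "Ck_family m \<Theta> (\<lambda>k \<theta>. frechet_derivative (\<Psi> k) (at (V k \<theta>)) w)"
        proof (rule Ck_family_compose[OF \<Theta>(1) Vm[OF Xm], of \<Omega> "\<lambda>k x. frechet_derivative (\<Psi> k) (at x) w"])
          show "Ck_family m \<Omega> (\<lambda>k x. frechet_derivative (\<Psi> k) (at x) w)"
            using smooth' unfolding Ck_family_Suc by blast
        qed (rule V\<Omega>)
        then show ?thesis
          unfolding D_def[symmetric]
          by (rule Ck_family_compose[OF S(1) Ck_family_coordinates(4)[OF S(2,1)]]) auto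
      qed
      \<comment> \<open>Linearity separates the sequence variables from the coefficients, which
        depend on the parameter alone; the product rule then gives the regularity.\<close>
      have "Ck_family m ?S (\<lambda>k z. fst (fst z) * D k (snd z) ((1, 0, 0), 0) + fst (snd (fst z)) * D k (snd z) ((0, 1, 0), 0)
           + snd (snd (fst z)) * D k (snd z) ((0, 0, 1), 0) + D k (snd z) (0, v))"
        by (intro Ck_family_add Ck_family_mult S(1) Dm Ck_family_coordinates[OF S(2,1)])
      then show "Ck_family m ?S (\<lambda>k z. D k (snd z) (fst z, v))"
      proof (rule Ck_family_cong[OF S(1), rotated])
        fix k and z :: "(real \<times> real \<times> real) \<times> 'p" assume "z \<in> ?S"
        then obtain a b c \<theta> where z: "z = ((a, b, c), \<theta>)" and "\<theta> \<in> \<Theta>" by auto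
        interpret D: bounded_linear "D k \<theta>" by (rule D_lin[OF \<open>\<theta> \<in> \<Theta>\<close>])
        have "((a, b, c), v) = a *\<^sub>R ((1, 0, 0), 0) + b *\<^sub>R ((0, 1, 0), 0) + c *\<^sub>R ((0, 0, 1), 0) + (0, v)"
          by (simp add: zero_prod_def)
        then show "fst (fst z) * D k (snd z) ((1, 0, 0), 0) + fst (snd (fst z)) * D k (snd z) ((0, 1, 0), 0)
            + snd (snd (fst z)) * D k (snd z) ((0, 0, 1), 0) + D k (snd z) (0, v) = D k (snd z) (fst z, v)"
          by (simp only: z fst_conv snd_conv D.add D.scaleR real_scaleR_def)
      qed
      show "\<bar>D k (snd ((a, b, c), \<theta>)) (fst ((a, b, c), \<theta>), v) - D k (snd ((a', b', c'), \<theta>)) (fst ((a', b', c'), \<theta>), v)\<bar> \<le> q * d"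
        if "\<theta> \<in> \<Theta>" and d: "\<bar>a - a'\<bar> \<le> d" "\<bar>b - b'\<bar> \<le> d" "\<bar>c - c'\<bar> \<le> d" for k a b c a' b' c' \<theta> d
        using D_q[OF that, of k]
          linear_diff[OF bounded_linear.linear[OF D_lin[OF that(1), of k]], of "((a, b, c), v)" "((a', b', c'), v)"]
        by simp
      show "\<bar>Y v k \<theta>\<bar> < R v + 1" if "\<theta> \<in> \<Theta>" for k \<theta>
        using Ybd[OF that, of v k] by linarith
    qed (use Yeq in auto)
  qed
  \<comment> \<open>For the homogeneous equation the maximum principle holds with zero error.
    Linearity of \<open>Y\<close> in \<open>v\<close> follows, since its defects solve this
    equation.\<close>
  have uniq: "e k = 0" if "\<theta> \<in> \<Theta>" "\<And>k. \<bar>e k\<bar> \<le> M" "\<And>k. e k = D k \<theta> ((e (k - 1), e k, e (Suc k)), 0)" for e :: "nat \<Rightarrow> real" and M \<theta> k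
  proof -
    have "\<bar>e k\<bar> \<le> 0 / (1 - q)"
      by (rule neighbour_maximum_principle[OF that(2) q]) (use that D_q in \<open>metis add.right_neutral\<close>)
    then show ?thesis by simp
  qed
  have Ylin: "linear (\<lambda>v. Y v k \<theta>)" if "\<theta> \<in> \<Theta>" for k \<theta>
  proof (rule linearI)
    have lin: "linear (D k \<theta>)" for k
      by (rule bounded_linear.linear[OF D_lin[OF that]])
    show "Y (v + w) k \<theta> = Y v k \<theta> + Y w k \<theta>" for v w
    proof -
      have "Y (v + w) k \<theta> - Y v k \<theta> - Y w k \<theta> = 0"
      proof (rule uniq[OF that, where M = "R (v + w) + R v + R w"])
        show "\<bar>Y (v + w) k \<theta> - Y v k \<theta> - Y w k \<theta>\<bar> \<le> R (v + w) + R v + R w" for k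
          using Ybd[OF that, of "v + w" k] Ybd[OF that, of v k] Ybd[OF that, of w k] by linarith
        show "Y (v + w) k \<theta> - Y v k \<theta> - Y w k \<theta> = D k \<theta> ((Y (v + w) (k - 1) \<theta> - Y v (k - 1) \<theta> - Y w (k - 1) \<theta>,
            Y (v + w) k \<theta> - Y v k \<theta> - Y w k \<theta>, Y (v + w) (Suc k) \<theta> - Y v (Suc k) \<theta> - Y w (Suc k) \<theta>), 0)" for k
          using Yeq[OF that, of "v + w" k] Yeq[OF that, of v k] Yeq[OF that, of w k]
            linear_diff[OF lin, of k "((Y (v + w) (k - 1) \<theta>, Y (v + w) k \<theta>, Y (v + w) (Suc k) \<theta>), v + w)"
              "((Y v (k - 1) \<theta>, Y v k \<theta>, Y v (Suc k) \<theta>), v)"]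
            linear_diff[OF lin, of k "((Y (v + w) (k - 1) \<theta> - Y v (k - 1) \<theta>, Y (v + w) k \<theta> - Y v k \<theta>,
                Y (v + w) (Suc k) \<theta> - Y v (Suc k) \<theta>), w)" "((Y w (k - 1) \<theta>, Y w k \<theta>, Y w (Suc k) \<theta>), w)"]
          by simp
      qed
      then show ?thesis by simp
    qed
    show "Y (r *\<^sub>R v) k \<theta> = r *\<^sub>R Y v k \<theta>" for r v
    proof -
      have "Y (r *\<^sub>R v) k \<theta> - r * Y v k \<theta> = 0"
      proof (rule uniq[OF that, where M = "R (r *\<^sub>R v) + \<bar>r\<bar> * R v"])
        show "\<bar>Y (r *\<^sub>R v) k \<theta> - r * Y v k \<theta>\<bar> \<le> R (r *\<^sub>R v) + \<bar>r\<bar> * R v" for k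
        proof -
          have "\<bar>r * Y v k \<theta>\<bar> \<le> \<bar>r\<bar> * R v"
            unfolding abs_mult by (intro mult_left_mono Ybd that) auto
          with Ybd[OF that, of "r *\<^sub>R v" k] show ?thesis by linarith
        qed
        show "Y (r *\<^sub>R v) k \<theta> - r * Y v k \<theta> = D k \<theta> ((Y (r *\<^sub>R v) (k - 1) \<theta> - r * Y v (k - 1) \<theta>,
            Y (r *\<^sub>R v) k \<theta> - r * Y v k \<theta>, Y (r *\<^sub>R v) (Suc k) \<theta> - r * Y v (Suc k) \<theta>), 0)" for k
          using Yeq[OF that, of "r *\<^sub>R v" k] Yeq[OF that, of v k]
            linear_scale[OF lin, of k r "((Y v (k - 1) \<theta>, Y v k \<theta>, Y v (Suc k) \<theta>), v)"]
            linear_diff[OF lin, of k "((Y (r *\<^sub>R v) (k - 1) \<theta>, Y (r *\<^sub>R v) k \<theta>, Y (r *\<^sub>R v) (Suc k) \<theta>), r *\<^sub>R v)"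
              "r *\<^sub>R ((Y v (k - 1) \<theta>, Y v k \<theta>, Y v (Suc k) \<theta>), v)"]
          by simp
      qed
      then show ?thesis by simp
    qed
  qed
  obtain C where C: "C \<ge> 0" "\<And>k x y. x \<in> \<Omega> \<Longrightarrow> y \<in> \<Omega> \<Longrightarrow>
      norm (\<Psi> k y - \<Psi> k x - frechet_derivative (\<Psi> k) (at x) (y - x)) \<le> C * (norm (y - x))\<^sup>2"
  proof -
    have "Ck_family (Suc 0) \<Omega> \<Psi>"
      using smooth' Ck_family_imp_0 unfolding Ck_family_Suc by blast
    from Ck_family_taylor[OF this \<Omega>(2)] show thesis
      using that by blast
  qed
  from Ck_family_0D[OF Ck_family_imp_0[OF Vm[OF Xm]]] obtain K where K: "K \<ge> 0"
    "\<And>k \<theta> \<theta>'. \<theta> \<in> \<Theta> \<Longrightarrow> \<theta>' \<in> \<Theta> \<Longrightarrow> norm (V k \<theta> - V k \<theta>') \<le> K * norm (\<theta> - \<theta>')"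
    by blast
  \<comment> \<open>The remainder solves the linearized equation up to a defect that is quadratic in
    the parameter change; the maximum principle turns this into a quadratic bound uniform in
    \<open>k\<close>, which proves differentiability.\<close>
  have rem: "\<bar>X k \<theta>' - X k \<theta> - Y (\<theta>' - \<theta>) k \<theta>\<bar> \<le> (C * K\<^sup>2 / (1 - q)) * (norm (\<theta>' - \<theta>))\<^sup>2"
    if \<theta>: "\<theta> \<in> \<Theta>" "\<theta>' \<in> \<Theta>" for k \<theta> \<theta>'
  proof -
    let ?e = "\<lambda>k. X k \<theta>' - X k \<theta> - Y (\<theta>' - \<theta>) k \<theta>"
    have "\<bar>?e k\<bar> \<le> (C * (K * norm (\<theta>' - \<theta>))\<^sup>2) / (1 - q)"
    proof (rule neighbour_maximum_principle[OF _ q])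
      show "\<bar>?e k\<bar> \<le> 2 * \<eta> + R (\<theta>' - \<theta>)" for k
        using bd[OF \<theta>(1), of k] bd[OF \<theta>(2), of k] Ybd[OF \<theta>(1), of "\<theta>' - \<theta>" k] by linarith
      fix k d assume d: "\<bar>?e (k - 1)\<bar> \<le> d" "\<bar>?e k\<bar> \<le> d" "\<bar>?e (Suc k)\<bar> \<le> d"
      have "\<bar>D k \<theta> ((?e (k - 1), ?e k, ?e (Suc k)), 0)\<bar> \<le> q * d"
        by (rule D_q[OF \<theta>(1) d])
      moreover have "\<bar>\<Psi> k (V k \<theta>') - \<Psi> k (V k \<theta>) - D k \<theta> (V k \<theta>' - V k \<theta>)\<bar> \<le> C * (K * norm (\<theta>' - \<theta>))\<^sup>2"
      proof -
        have "\<bar>\<Psi> k (V k \<theta>') - \<Psi> k (V k \<theta>) - D k \<theta> (V k \<theta>' - V k \<theta>)\<bar> \<le> C * (norm (V k \<theta>' - V k \<theta>))\<^sup>2"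
          using C(2)[OF V\<Omega>[OF \<theta>(1)] V\<Omega>[OF \<theta>(2)], of k k k] by (simp add: D_def)
        also have "\<dots> \<le> C * (K * norm (\<theta>' - \<theta>))\<^sup>2"
          by (intro mult_left_mono power_mono K(2) \<theta> C(1)) auto
        finally show ?thesis .
      qed
      moreover have "D k \<theta> ((?e (k - 1), ?e k, ?e (Suc k)), 0) = D k \<theta> (V k \<theta>' - V k \<theta>) - Y (\<theta>' - \<theta>) k \<theta>"
        using linear_diff[OF bounded_linear.linear[OF D_lin[OF \<theta>(1), of k]], of "V k \<theta>' - V k \<theta>"
            "((Y (\<theta>' - \<theta>) (k - 1) \<theta>, Y (\<theta>' - \<theta>) k \<theta>, Y (\<theta>' - \<theta>) (Suc k) \<theta>), \<theta>' - \<theta>)"]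
          Yeq[OF \<theta>(1), of "\<theta>' - \<theta>" k]
        by (simp add: V_def)
      moreover have "X k \<theta>' - X k \<theta> = \<Psi> k (V k \<theta>') - \<Psi> k (V k \<theta>)"
        using eq[OF \<theta>(1), of k] eq[OF \<theta>(2), of k] by (simp add: V_def)
      ultimately show "\<bar>?e k\<bar> \<le> q * d + C * (K * norm (\<theta>' - \<theta>))\<^sup>2"
        by linarith
    qed
    then show ?thesis by (simp add: power_mult_distrib mult.assoc)
  qed
  show ?case
  proof (rule Ck_family_SucI[OF \<Theta>(1) Ck_family_imp_0[OF Xm] _ Ym])
    fix k \<theta> assume \<theta>: "\<theta> \<in> \<Theta>"
    obtain r where r: "r > 0" "ball \<theta> r \<subseteq> \<Theta>"
      using \<Theta>(1) \<theta> open_contains_ball by blast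
    let ?A = "C * K\<^sup>2 / (1 - q)"
    show "(X k has_derivative (\<lambda>v. Y v k \<theta>)) (at \<theta>)"
    proof (rule has_derivativeI_sandwich[OF r(1)])
      show "bounded_linear (\<lambda>v. Y v k \<theta>)"
        using Ylin[OF \<theta>] linear_conv_bounded_linear by blast
      fix \<theta>' assume "\<theta>' \<noteq> \<theta>" "dist \<theta>' \<theta> < r"
      then have "\<theta>' \<in> \<Theta>"
        using r(2) by (auto simp: dist_commute)
      from rem[OF \<theta> this, of k] \<open>\<theta>' \<noteq> \<theta>\<close>
      show "norm (X k \<theta>' - X k \<theta> - Y (\<theta>' - \<theta>) k \<theta>) / norm (\<theta>' - \<theta>) \<le> ?A * norm (\<theta>' - \<theta>)"
        by (simp add: divide_le_eq power2_eq_square mult.assoc)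
    next
      have "((\<lambda>\<theta>'. ?A * norm (\<theta>' - \<theta>)) \<longlongrightarrow> ?A * norm (\<theta> - \<theta>)) (at \<theta>)"
        by (intro tendsto_intros)
      then show "((\<lambda>\<theta>'. ?A * norm (\<theta>' - \<theta>)) \<longlongrightarrow> 0) (at \<theta>)" by simp
    qed
  qed
qed

section \<open>The bounce equations near the neck\<close>

text \<open>On a small ball the derivative of \<open>g\<close> differs so little from its value at
  the centre that the slack \<open>q - q0\<close> absorbs the difference.\<close>

lemma strict_contraction_near_point:
  fixes g :: "(real \<times> real \<times> real) \<times> 'p::euclidean_space \<Rightarrow> real"
  assumes "smooth_on G g" "open G" "(0, \<theta>0) \<in> G"
    and g': "(g has_derivative g') (at (0, \<theta>0))"
    and q0: "\<And>a b c d. \<bar>a\<bar> \<le> d \<Longrightarrow> \<bar>b\<bar> \<le> d \<Longrightarrow> \<bar>c\<bar> \<le> d \<Longrightarrow> \<bar>g' ((a, b, c), 0)\<bar> \<le> q0 * d"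
    and "q0 < q"
  shows "\<exists>e>0. cball (0, \<theta>0) e \<subseteq> G \<and>
    (\<forall>a b c a' b' c' \<theta> d. ((a, b, c), \<theta>) \<in> ball (0, \<theta>0) e \<longrightarrow> ((a', b', c'), \<theta>) \<in> ball (0, \<theta>0) e \<longrightarrow>
        \<bar>a - a'\<bar> \<le> d \<longrightarrow> \<bar>b - b'\<bar> \<le> d \<longrightarrow> \<bar>c - c'\<bar> \<le> d \<longrightarrow>
        \<bar>g ((a, b, c), \<theta>) - g ((a', b', c'), \<theta>)\<bar> \<le> q * d)"
proof -
  define P where "P = ((0, \<theta>0) :: (real \<times> real \<times> real) \<times> 'p)"
  obtain e0 where e0: "e0 > 0" "cball P e0 \<subseteq> G" "\<And>d m. d \<le> e0 \<Longrightarrow> Ck_family m (ball P d) (\<lambda>i::unit. g)"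
    using smooth_on_ball[OF assms(1-3)] unfolding P_def by metis
  obtain L where L: "L \<ge> 0" "\<And>x z w. z \<in> ball P e0 \<Longrightarrow> x \<in> ball P e0 \<Longrightarrow>
    norm (frechet_derivative g (at z) w - frechet_derivative g (at x) w) \<le> L * norm (z - x) * norm w"
    using Ck_family_derivative_lipschitz[OF e0(3)[OF order_refl, of "Suc 0"]] by blast
  have gP: "g' = frechet_derivative g (at P)"
    using frechet_derivative_at[OF g'] by (simp add: P_def)
  \<comment> \<open>The factor 3 bounds the Euclidean norm of three coordinate differences, each at
    most \<open>d\<close>; the added 3 keeps the denominator positive when
    \<open>L = 0\<close>.\<close>
  define e where "e = min e0 ((q - q0) / (3 * L + 3))"
  have e: "e > 0" "e \<le> e0" "3 * (L * e) \<le> q - q0"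
  proof -
    show "e > 0" "e \<le> e0"
      using e0(1) L(1) \<open>q0 < q\<close> by (auto simp: e_def)
    have "e * (3 * L + 3) \<le> q - q0"
      using L(1) by (subst pos_le_divide_eq[symmetric]) (auto simp: e_def)
    with \<open>e > 0\<close> show "3 * (L * e) \<le> q - q0"
      by (simp add: algebra_simps)
  qed
  interpret g': bounded_linear g'
    using g' by (rule has_derivative_bounded_linear)
  have main: "\<bar>g x - g y - g' (x - y)\<bar> \<le> L * e * norm (x - y)" if "x \<in> ball P e" "y \<in> ball P e" for x y
  proof -
    have "norm ((g x - g' x) - (g y - g' y)) \<le> L * e * norm (x - y)"
    proof (rule differentiable_bound[OF convex_ball[of P e] _ _ that])
      fix z assume z: "z \<in> ball P e"
      then have zG: "z \<in> G" and z0: "z \<in> ball P e0"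
        using e e0(2) by (auto intro!: subsetD[OF e0(2)])
      show "((\<lambda>z. g z - g' z) has_derivative (\<lambda>w. frechet_derivative g (at z) w - g' w)) (at z within ball P e)"
        by (rule has_derivative_at_withinI[OF has_derivative_diff[OF smooth_onD_derivative(1)[OF assms(1) zG]
              g'.has_derivative[OF has_derivative_ident]]])
      show "onorm (\<lambda>w. frechet_derivative g (at z) w - g' w) \<le> L * e"
      proof (rule onorm_le)
        fix w
        have "norm (frechet_derivative g (at z) w - g' w) \<le> L * norm (z - P) * norm w"
          unfolding gP using L(2)[OF z0, of P w] e0(1) by simp
        also have "\<dots> \<le> L * e * norm w"
          using z L(1) by (intro mult_right_mono mult_left_mono) (auto simp: dist_norm norm_minus_commute)
        finally show "norm (frechet_derivative g (at z) w - g' w) \<le> L * e * norm w" .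
      qed
    qed
    then show ?thesis by (simp add: g'.diff algebra_simps)
  qed
  have "\<bar>g ((a, b, c), \<theta>) - g ((a', b', c'), \<theta>)\<bar> \<le> q * d"
    if "((a, b, c), \<theta>) \<in> ball P e" "((a', b', c'), \<theta>) \<in> ball P e"
      and d: "\<bar>a - a'\<bar> \<le> d" "\<bar>b - b'\<bar> \<le> d" "\<bar>c - c'\<bar> \<le> d" for a b c a' b' c' \<theta> d
  proof -
    have "norm ((a - a', b - b', c - c'), 0 :: 'p) \<le> \<bar>a - a'\<bar> + (\<bar>b - b'\<bar> + \<bar>c - c'\<bar>)"
      using norm_Pair_le[of "(a - a', b - b', c - c')" "0 :: 'p"] norm_Pair_le[of "a - a'" "(b - b', c - c')"]
        norm_Pair_le[of "b - b'" "c - c'"] by simp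
    also have "\<dots> \<le> 3 * d" using d by simp
    finally have "L * e * norm ((a - a', b - b', c - c'), 0 :: 'p) \<le> L * e * (3 * d)"
      using L(1) e(1) by (intro mult_left_mono) auto
    moreover have "\<bar>g ((a, b, c), \<theta>) - g ((a', b', c'), \<theta>) - g' ((a - a', b - b', c - c'), 0)\<bar>
        \<le> L * e * norm ((a - a', b - b', c - c'), 0 :: 'p)"
      using main[OF that(1,2)] by simp
    moreover have "\<bar>g' ((a - a', b - b', c - c'), 0)\<bar> \<le> q0 * d"
      by (rule q0[OF d])
    moreover have "3 * (L * e) * d \<le> (q - q0) * d"
      using e(3) d(1) by (intro mult_right_mono) auto
    ultimately show ?thesis by (simp add: algebra_simps)
  qed
  moreover have "cball P e \<subseteq> G"
    using e(2) e0(2) by (meson order_trans subset_cball)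
  ultimately show ?thesis
    using e(1) unfolding P_def by blast
qed

text \<open>At a zero of \<open>f\<close> the derivative of \<open>g\<close> drops out. The
  complicated factors of the bounce equations thus enter the linearization at the neck only through
  their values.\<close>

lemma has_derivative_mult_vanishing:
  fixes f g :: "'a::real_normed_vector \<Rightarrow> real"
  assumes "(f has_derivative f') (at z)" "(g has_derivative g') (at z)" "f z = 0"
  shows "((\<lambda>x. f x * g x) has_derivative (\<lambda>v. f' v * g z)) (at z)"
  using has_derivative_mult[OF assms(1,2)] assms(3) by simp

section \<open>Chords and bounces in axial coordinates\<close>

locale neck =
  fixes \<rho> :: "real \<Rightarrow> real"
  assumes smooth: "smooth_on UNIV \<rho>"
    and pos: "\<And>x. \<rho> x > 0"
    and critical: "deriv \<rho> 0 = 0"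
    and convex: "deriv (deriv \<rho>) 0 > 0"
begin

text \<open>
  A chord joins mirror points with axial coordinates \<open>x\<close>, \<open>x'\<close> and radial vectors \<open>y\<close>, \<open>y'\<close>, and \<open>j\<close> is the
  square of its angular momentum about the axis, which reflections preserve. Then \<open>y \<bullet> y' = chord_dot x x' j\<close>
  by solving \<open>\<rho>(x)\<^sup>2 \<rho>(x')\<^sup>2 - (y \<bullet> y')\<^sup>2 = j \<bar>chord\<bar>\<^sup>2\<close>, and the other root is that of the short chords
  degenerating to a point.
\<close>

definition chord_dot :: "real \<Rightarrow> real \<Rightarrow> real \<Rightarrow> real" where
  "chord_dot x x' j = j - sqrt (((\<rho> x)\<^sup>2 - j) * ((\<rho> x')\<^sup>2 - j) - j * (x - x')\<^sup>2)"

definition chord_length :: "real \<Rightarrow> real \<Rightarrow> real \<Rightarrow> real" where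
  "chord_length x x' j = sqrt ((x - x')\<^sup>2 + (\<rho> x)\<^sup>2 + (\<rho> x')\<^sup>2 - 2 * chord_dot x x' j)"

text \<open>
  Up to a factor, the component along the meridian through \<open>x\<close> of the velocity on the chord to \<open>x'\<close>, and of
  an incoming velocity with axial component \<open>w\<close>; specular reflection preserves this component.
\<close>

definition chord_tangential :: "real \<Rightarrow> real \<Rightarrow> real \<Rightarrow> real" where
  "chord_tangential x x' j =
     ((x' - x) - deriv \<rho> x * (((\<rho> x)\<^sup>2 - chord_dot x x' j) / \<rho> x)) / chord_length x x' j"

definition incoming_tangential :: "real \<Rightarrow> real \<Rightarrow> real \<Rightarrow> real" where
  "incoming_tangential x w j = w + deriv \<rho> x * (sqrt ((\<rho> x)\<^sup>2 * (1 - w\<^sup>2) - j) / \<rho> x)"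

text \<open>The radicand can also be positive when \<open>j\<close> exceeds both squared radii; the
  first two conditions exclude this and force the chord to have positive length.\<close>

definition admissible :: "real \<Rightarrow> real \<Rightarrow> real \<Rightarrow> bool" where
  "admissible x x' j \<longleftrightarrow> j < (\<rho> x)\<^sup>2 \<and> j < (\<rho> x')\<^sup>2 \<and> ((\<rho> x)\<^sup>2 - j) * ((\<rho> x')\<^sup>2 - j) - j * (x - x')\<^sup>2 > 0"

lemma chord_length_radicand_pos:
  assumes "admissible x x' j"
  shows "(x - x')\<^sup>2 + (\<rho> x)\<^sup>2 + (\<rho> x')\<^sup>2 - 2 * chord_dot x x' j > 0"
proof -
  define s where "s = sqrt (((\<rho> x)\<^sup>2 - j) * ((\<rho> x')\<^sup>2 - j) - j * (x - x')\<^sup>2)"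
  have "s \<ge> 0" "j < (\<rho> x)\<^sup>2" "j < (\<rho> x')\<^sup>2"
    using assms by (simp_all add: s_def admissible_def)
  then have "0 < (x - x')\<^sup>2 + (((\<rho> x)\<^sup>2 - j) + ((\<rho> x')\<^sup>2 - j) + 2 * s)"
    by (intro add_nonneg_pos add_pos_nonneg add_pos_pos) auto
  then show ?thesis
    unfolding chord_dot_def s_def[symmetric] by (simp add: algebra_simps)
qed

lemma chord_length_pos: "admissible x x' j \<Longrightarrow> chord_length x x' j > 0"
  unfolding chord_length_def using chord_length_radicand_pos by simp

lemma smooth_on_profile:
  fixes f :: "'a::euclidean_space \<Rightarrow> real"
  assumes "open S" "smooth_on S f"
  shows "smooth_on S (\<lambda>z. \<rho> (f z))" "smooth_on S (\<lambda>z. deriv \<rho> (f z))"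
  by (rule smooth_on_compose[OF assms(2,1) _ open_UNIV subset_UNIV];
      simp add: smooth smooth_on_real_deriv)+

lemma smooth_on_chord_dot:
  fixes f g h :: "'a::euclidean_space \<Rightarrow> real"
  assumes "open S" "smooth_on S f" "smooth_on S g" "smooth_on S h"
    "\<And>z. z \<in> S \<Longrightarrow> admissible (f z) (g z) (h z)"
  shows "smooth_on S (\<lambda>z. chord_dot (f z) (g z) (h z))"
  unfolding chord_dot_def
  by (intro smooth_on_intros smooth_on_profile assms(1-4)) (use assms(5) in \<open>auto simp: admissible_def\<close>)

lemma smooth_on_chord_length:
  fixes f g h :: "'a::euclidean_space \<Rightarrow> real"
  assumes "open S" "smooth_on S f" "smooth_on S g" "smooth_on S h"
    "\<And>z. z \<in> S \<Longrightarrow> admissible (f z) (g z) (h z)"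
  shows "smooth_on S (\<lambda>z. chord_length (f z) (g z) (h z))"
  unfolding chord_length_def
  by (intro smooth_on_intros smooth_on_profile smooth_on_chord_dot assms(1-4))
    (use assms(5) chord_length_radicand_pos in auto)

lemma smooth_on_chord_tangential:
  fixes f g h :: "'a::euclidean_space \<Rightarrow> real"
  assumes "open S" "smooth_on S f" "smooth_on S g" "smooth_on S h"
    "\<And>z. z \<in> S \<Longrightarrow> admissible (f z) (g z) (h z)"
  shows "smooth_on S (\<lambda>z. chord_tangential (f z) (g z) (h z))"
  unfolding chord_tangential_def
  by (intro smooth_on_intros smooth_on_profile smooth_on_chord_dot smooth_on_chord_length assms(1-4))
    (use assms(5) chord_length_pos pos in auto)

lemma smooth_on_incoming_tangential:
  fixes f g h :: "'a::euclidean_space \<Rightarrow> real"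
  assumes "open S" "smooth_on S f" "smooth_on S g" "smooth_on S h"
    "\<And>z. z \<in> S \<Longrightarrow> (\<rho> (f z))\<^sup>2 * (1 - (g z)\<^sup>2) - h z > 0"
  shows "smooth_on S (\<lambda>z. incoming_tangential (f z) (g z) (h z))"
  unfolding incoming_tangential_def
  by (intro smooth_on_intros smooth_on_profile assms(1-4)) (use assms(5) pos in auto)

lemma has_derivative_profile_slope:
  assumes "(f has_derivative f') (at z)" "f z = 0"
  shows "((\<lambda>z. deriv \<rho> (f z)) has_derivative (\<lambda>v. deriv (deriv \<rho>) 0 * f' v)) (at z)"
proof -
  have "(deriv \<rho> has_real_derivative deriv (deriv \<rho>) 0) (at (f z))"
    using smooth_on_real_deriv(1)[OF smooth_on_real_deriv(2)[OF smooth open_UNIV]] assms(2) by simp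
  from has_derivative_compose[OF assms(1) this[unfolded has_field_derivative_def]]
  show ?thesis by simp
qed

text \<open>At the neck the axial difference and the slope of the profile both vanish, so the dot
  product and the length are evaluated and never differentiated; for the same reason the variation
  of \<open>h\<close> does not appear. The chosen value of \<open>h z\<close> makes the dot product
  0 and the length \<open>sqrt 2 * \<rho> 0\<close>.\<close>

lemma has_derivative_chord_tangential:
  fixes f g h :: "'a::euclidean_space \<Rightarrow> real"
  assumes S: "open S" "z \<in> S" and sm: "smooth_on S f" "smooth_on S g" "smooth_on S h"
    and adm: "\<And>z. z \<in> S \<Longrightarrow> admissible (f z) (g z) (h z)"
    and z: "f z = 0" "g z = 0" "h z = (\<rho> 0)\<^sup>2 / 2"
    and d: "(f has_derivative f') (at z)" "(g has_derivative g') (at z)"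
  shows "((\<lambda>z. chord_tangential (f z) (g z) (h z)) has_derivative
     (\<lambda>v. (g' v - f' v - deriv (deriv \<rho>) 0 * f' v * \<rho> 0) * (1 / (sqrt 2 * \<rho> 0)))) (at z)"
proof -
  have h: "(\<rho> 0)\<^sup>2 - h z = h z" "h z > 0"
    unfolding z(3) using pos[of 0] by auto
  have dot: "chord_dot (f z) (g z) (h z) = 0"
    unfolding chord_dot_def z(1,2) h(1) using h(2) by simp
  have len: "chord_length (f z) (g z) (h z) = sqrt 2 * \<rho> 0"
    using pos[of 0] unfolding chord_length_def dot using z by (simp add: real_sqrt_mult)
  have sm1: "smooth_on S (\<lambda>z. ((\<rho> (f z))\<^sup>2 - chord_dot (f z) (g z) (h z)) / \<rho> (f z))"
    by (intro smooth_on_intros smooth_on_profile smooth_on_chord_dot S sm adm) (use pos in auto)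
  have sm2: "smooth_on S (\<lambda>z. 1 / chord_length (f z) (g z) (h z))"
    by (intro smooth_on_intros smooth_on_chord_length S sm adm) (use adm chord_length_pos in auto)
  have "((\<lambda>z. deriv \<rho> (f z) * (((\<rho> (f z))\<^sup>2 - chord_dot (f z) (g z) (h z)) / \<rho> (f z))) has_derivative
     (\<lambda>v. deriv (deriv \<rho>) 0 * f' v * (((\<rho> (f z))\<^sup>2 - chord_dot (f z) (g z) (h z)) / \<rho> (f z)))) (at z)"
    by (rule has_derivative_mult_vanishing[OF has_derivative_profile_slope[OF d(1) z(1)]
          smooth_onD_derivative(1)[OF sm1 S(2)]]) (simp add: z critical)
  then have slope: "((\<lambda>z. deriv \<rho> (f z) * (((\<rho> (f z))\<^sup>2 - chord_dot (f z) (g z) (h z)) / \<rho> (f z))) has_derivative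
     (\<lambda>v. deriv (deriv \<rho>) 0 * f' v * \<rho> 0)) (at z)"
    unfolding dot using z pos[of 0] by (simp add: power2_eq_square)
  have "((\<lambda>z. (g z - f z - deriv \<rho> (f z) * (((\<rho> (f z))\<^sup>2 - chord_dot (f z) (g z) (h z)) / \<rho> (f z)))
       * (1 / chord_length (f z) (g z) (h z))) has_derivative
     (\<lambda>v. (g' v - f' v - deriv (deriv \<rho>) 0 * f' v * \<rho> 0) * (1 / chord_length (f z) (g z) (h z)))) (at z)"
    by (intro has_derivative_mult_vanishing[OF _ smooth_onD_derivative(1)[OF sm2 S(2)]]
        has_derivative_diff d slope) (simp add: z critical)
  then show ?thesis
    unfolding len by (simp add: chord_tangential_def)
qed

lemma has_derivative_incoming_tangential:
  fixes f g h :: "'a::euclidean_space \<Rightarrow> real"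
  assumes S: "open S" "z \<in> S" and sm: "smooth_on S f" "smooth_on S g" "smooth_on S h"
    and adm: "\<And>z. z \<in> S \<Longrightarrow> (\<rho> (f z))\<^sup>2 * (1 - (g z)\<^sup>2) - h z > 0"
    and z: "f z = 0" "g z = 0" "h z = (\<rho> 0)\<^sup>2 / 2"
    and d: "(f has_derivative f') (at z)" "(g has_derivative g') (at z)"
  shows "((\<lambda>z. incoming_tangential (f z) (g z) (h z)) has_derivative
     (\<lambda>v. g' v + deriv (deriv \<rho>) 0 * f' v * (1 / sqrt 2))) (at z)"
proof -
  have sm1: "smooth_on S (\<lambda>z. sqrt ((\<rho> (f z))\<^sup>2 * (1 - (g z)\<^sup>2) - h z) / \<rho> (f z))"
    by (intro smooth_on_intros smooth_on_profile S sm adm) (use pos in auto)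
  have val: "sqrt ((\<rho> (f z))\<^sup>2 * (1 - (g z)\<^sup>2) - h z) / \<rho> (f z) = 1 / sqrt 2"
    using pos[of 0] by (simp add: z real_sqrt_divide)
  have "((\<lambda>z. deriv \<rho> (f z) * (sqrt ((\<rho> (f z))\<^sup>2 * (1 - (g z)\<^sup>2) - h z) / \<rho> (f z))) has_derivative
     (\<lambda>v. deriv (deriv \<rho>) 0 * f' v * (sqrt ((\<rho> (f z))\<^sup>2 * (1 - (g z)\<^sup>2) - h z) / \<rho> (f z)))) (at z)"
    by (rule has_derivative_mult_vanishing[OF has_derivative_profile_slope[OF d(1) z(1)]
          smooth_onD_derivative(1)[OF sm1 S(2)]]) (simp add: z critical)
  then show ?thesis
    unfolding val incoming_tangential_def by (intro has_derivative_add d)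
qed


text \<open>A Newton-like form of the bounce equation: a multiple of the residual is added to the
  middle unknown. For \<open>k > 0\<close> the multiple is minus the reciprocal of the coefficient
  of that unknown in the residual linearized at the neck, so the unknown cancels there. For
  \<open>k = 0\<close> the incoming slope takes the place of the left neighbour.\<close>

definition bounce_map :: "nat \<Rightarrow> (real \<times> real \<times> real) \<times> real \<times> real \<Rightarrow> real" where
  "bounce_map k = (\<lambda>z. fst (snd (fst z)) + sqrt 2 * \<rho> 0 / (2 * (1 + deriv (deriv \<rho>) 0 * \<rho> 0)) *
     (chord_tangential (fst (snd (fst z))) (snd (snd (fst z))) (snd (snd z)) +
       (if k = 0 then - incoming_tangential (fst (snd (fst z))) (fst (snd z)) (snd (snd z))
        else chord_tangential (fst (snd (fst z))) (fst (fst z)) (snd (snd z)))))"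

text \<open>Contains the conditions of both cases, so that one domain serves every
  \<open>k\<close>.\<close>

definition bounce_domain :: "((real \<times> real \<times> real) \<times> real \<times> real) set" where
  "bounce_domain = {z. admissible (fst (snd (fst z))) (snd (snd (fst z))) (snd (snd z)) \<and>
     admissible (fst (snd (fst z))) (fst (fst z)) (snd (snd z)) \<and>
     (\<rho> (fst (snd (fst z))))\<^sup>2 * (1 - (fst (snd z))\<^sup>2) - snd (snd z) > 0}"

lemma continuous_on_profile: "continuous_on S f \<Longrightarrow> continuous_on S (\<lambda>z. \<rho> (f z))"
  by (rule continuous_on_compose2[OF smooth_on_imp_continuous_on[OF smooth]]) auto

lemma open_bounce_domain: "open bounce_domain"
  unfolding bounce_domain_def admissible_def
  by (intro open_Collect_conj open_Collect_less continuous_intros continuous_on_profile)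

lemma neck_in_bounce_domain: "(0, 0, (\<rho> 0)\<^sup>2 / 2) \<in> bounce_domain"
  using pos[of 0] by (simp add: bounce_domain_def admissible_def zero_prod_def)

lemma smooth_on_bounce_map: "smooth_on bounce_domain (bounce_map k)"
proof -
  note ids = smooth_on_fst[OF open_bounce_domain] smooth_on_snd[OF open_bounce_domain] smooth_on_ident
  show ?thesis
  proof (cases "k = 0")
    case True
    have "smooth_on bounce_domain (\<lambda>z. fst (snd (fst z)) + sqrt 2 * \<rho> 0 / (2 * (1 + deriv (deriv \<rho>) 0 * \<rho> 0)) *
     (chord_tangential (fst (snd (fst z))) (snd (snd (fst z))) (snd (snd z))
       - incoming_tangential (fst (snd (fst z))) (fst (snd z)) (snd (snd z))))"
      by (intro smooth_on_add smooth_on_diff smooth_on_mult smooth_on_const smooth_on_chord_tangential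
          smooth_on_incoming_tangential open_bounce_domain ids)
        (auto simp: bounce_domain_def)
    with True show ?thesis by (simp add: bounce_map_def)
  next
    case False
    have "smooth_on bounce_domain (\<lambda>z. fst (snd (fst z)) + sqrt 2 * \<rho> 0 / (2 * (1 + deriv (deriv \<rho>) 0 * \<rho> 0)) *
     (chord_tangential (fst (snd (fst z))) (snd (snd (fst z))) (snd (snd z))
       + chord_tangential (fst (snd (fst z))) (fst (fst z)) (snd (snd z))))"
      by (intro smooth_on_add smooth_on_mult smooth_on_const smooth_on_chord_tangential open_bounce_domain ids)
        (auto simp: bounce_domain_def)
    with False show ?thesis by (simp add: bounce_map_def)
  qed
qed

text \<open>With \<open>\<kappa> = deriv (deriv \<rho>) 0 * \<rho> 0\<close>, the linearization in
  the sequence variables is \<open>(a + c) / (2 * (1 + \<kappa>))\<close> for \<open>k > 0\<close>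
  and \<open>(b + c) / (2 * (1 + \<kappa>))\<close> for \<open>k = 0\<close>. Since
  \<open>\<kappa> > 0\<close>, the resulting constant is below 1.\<close>

lemma bounce_map_derivative:
  shows "\<exists>g'. (bounce_map k has_derivative g') (at (0, 0, (\<rho> 0)\<^sup>2 / 2)) \<and>
    (\<forall>a b c d. \<bar>a\<bar> \<le> d \<longrightarrow> \<bar>b\<bar> \<le> d \<longrightarrow> \<bar>c\<bar> \<le> d \<longrightarrow>
       \<bar>g' ((a, b, c), 0)\<bar> \<le> 1 / (1 + deriv (deriv \<rho>) 0 * \<rho> 0) * d)"
proof -
  define P :: "(real \<times> real \<times> real) \<times> real \<times> real" where "P = (0, 0, (\<rho> 0)\<^sup>2 / 2)"
  define \<kappa> where "\<kappa> = deriv (deriv \<rho>) 0 * \<rho> 0"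
  have \<kappa>: "\<kappa> > 0"
    unfolding \<kappa>_def using convex pos by simp
  define \<mu> where "\<mu> = sqrt 2 * \<rho> 0 / (2 * (1 + \<kappa>))"
  have P: "P \<in> bounce_domain"
    using neck_in_bounce_domain by (simp add: P_def)
  note ids = smooth_on_fst[OF open_bounce_domain] smooth_on_snd[OF open_bounce_domain] smooth_on_ident
  have lin: "((\<lambda>z. fst (fst z)) has_derivative (\<lambda>z. fst (fst z))) (at P)"
    "((\<lambda>z. fst (snd (fst z))) has_derivative (\<lambda>z. fst (snd (fst z)))) (at P)"
    "((\<lambda>z. snd (snd (fst z))) has_derivative (\<lambda>z. snd (snd (fst z)))) (at P)"
    "((\<lambda>z. fst (snd z)) has_derivative (\<lambda>z. fst (snd z))) (at P)"
    by (intro has_derivative_fst has_derivative_snd has_derivative_ident)+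
  have out: "((\<lambda>z. chord_tangential (fst (snd (fst z))) (snd (snd (fst z))) (snd (snd z))) has_derivative
     (\<lambda>v. (snd (snd (fst v)) - fst (snd (fst v)) - deriv (deriv \<rho>) 0 * fst (snd (fst v)) * \<rho> 0) * (1 / (sqrt 2 * \<rho> 0)))) (at P)"
    by (rule has_derivative_chord_tangential[OF open_bounce_domain P]; (intro ids lin)?; auto simp: bounce_domain_def P_def)
  have in1: "((\<lambda>z. chord_tangential (fst (snd (fst z))) (fst (fst z)) (snd (snd z))) has_derivative
     (\<lambda>v. (fst (fst v) - fst (snd (fst v)) - deriv (deriv \<rho>) 0 * fst (snd (fst v)) * \<rho> 0) * (1 / (sqrt 2 * \<rho> 0)))) (at P)"
    by (rule has_derivative_chord_tangential[OF open_bounce_domain P]; (intro ids lin)?; auto simp: bounce_domain_def P_def)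
  have in0: "((\<lambda>z. incoming_tangential (fst (snd (fst z))) (fst (snd z)) (snd (snd z))) has_derivative
     (\<lambda>v. fst (snd v) + deriv (deriv \<rho>) 0 * fst (snd (fst v)) * (1 / sqrt 2))) (at P)"
    by (rule has_derivative_incoming_tangential[OF open_bounce_domain P]; (intro ids lin)?; auto simp: bounce_domain_def P_def)
  have bound: "\<bar>(a + c) / (2 * (1 + \<kappa>))\<bar> \<le> 1 / (1 + \<kappa>) * d" if "\<bar>a\<bar> \<le> d" "\<bar>c\<bar> \<le> d" for a c d :: real
  proof -
    have "\<bar>a + c\<bar> \<le> 2 * d" using that by linarith
    then have "\<bar>a + c\<bar> / (2 * (1 + \<kappa>)) \<le> 2 * d / (2 * (1 + \<kappa>))"
      using \<kappa> by (intro divide_right_mono) auto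
    moreover have "\<bar>(a + c) / (2 * (1 + \<kappa>))\<bar> = \<bar>a + c\<bar> / (2 * (1 + \<kappa>))"
      using \<kappa> by (simp add: abs_divide)
    moreover have "2 * d / (2 * (1 + \<kappa>)) = 1 / (1 + \<kappa>) * d"
      by (simp only: mult_divide_mult_cancel_left_if) simp
    ultimately show ?thesis by linarith
  qed
  have cancel: "\<mu> * (x / (sqrt 2 * \<rho> 0)) = x / (2 * (1 + \<kappa>))" for x
    unfolding \<mu>_def using pos[of 0] by simp
  show ?thesis
  proof (cases "k = 0")
    case True
    define g' where "g' v = fst (snd (fst v)) + \<mu> * ((snd (snd (fst v)) - fst (snd (fst v))
        - deriv (deriv \<rho>) 0 * fst (snd (fst v)) * \<rho> 0) * (1 / (sqrt 2 * \<rho> 0))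
      + - (fst (snd v) + deriv (deriv \<rho>) 0 * fst (snd (fst v)) * (1 / sqrt 2)))" for v :: "(real \<times> real \<times> real) \<times> real \<times> real"
    have "(bounce_map k has_derivative g') (at P)"
      unfolding bounce_map_def g'_def \<mu>_def \<kappa>_def if_P[OF True]
      by (intro has_derivative_add has_derivative_mult_right has_derivative_minus lin out in0)
    moreover have "g' ((a, b, c), 0) = (b + c) / (2 * (1 + \<kappa>))" for a b c
    proof -
      have "g' ((a, b, c), 0) = b + \<mu> * ((c - b - b * \<kappa>) / (sqrt 2 * \<rho> 0) - b * \<kappa> / (sqrt 2 * \<rho> 0))"
        using pos[of 0] by (simp add: g'_def \<kappa>_def mult_ac)
      also have "\<dots> = b + (c - b - 2 * b * \<kappa>) / (2 * (1 + \<kappa>))"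
        unfolding diff_divide_distrib[symmetric] cancel by (simp add: algebra_simps)
      also have "\<dots> = (b + c) / (2 * (1 + \<kappa>))"
        using \<kappa> by (simp add: field_simps)
      finally show ?thesis .
    qed
    ultimately show ?thesis
      using bound unfolding P_def \<kappa>_def by metis
  next
    case False
    define g' where "g' v = fst (snd (fst v)) + \<mu> * ((snd (snd (fst v)) - fst (snd (fst v))
        - deriv (deriv \<rho>) 0 * fst (snd (fst v)) * \<rho> 0) * (1 / (sqrt 2 * \<rho> 0))
      + (fst (fst v) - fst (snd (fst v)) - deriv (deriv \<rho>) 0 * fst (snd (fst v)) * \<rho> 0) * (1 / (sqrt 2 * \<rho> 0)))"
      for v :: "(real \<times> real \<times> real) \<times> real \<times> real"
    have "(bounce_map k has_derivative g') (at P)"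
      unfolding bounce_map_def g'_def \<mu>_def \<kappa>_def if_not_P[OF False]
      by (intro has_derivative_add has_derivative_mult_right lin out in1)
    moreover have "g' ((a, b, c), 0) = (a + c) / (2 * (1 + \<kappa>))" for a b c
    proof -
      have "g' ((a, b, c), 0) = b + \<mu> * ((c - b - b * \<kappa>) / (sqrt 2 * \<rho> 0) + (a - b - b * \<kappa>) / (sqrt 2 * \<rho> 0))"
        by (simp add: g'_def \<kappa>_def mult_ac)
      also have "\<dots> = b + (a + c - 2 * b - 2 * b * \<kappa>) / (2 * (1 + \<kappa>))"
        unfolding add_divide_distrib[symmetric] cancel by (simp add: algebra_simps)
      also have "\<dots> = (a + c) / (2 * (1 + \<kappa>))"
        using \<kappa> by (simp add: field_simps)
      finally show ?thesis .
    qed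
    ultimately show ?thesis
      using bound unfolding P_def \<kappa>_def by metis
  qed
qed

text \<open>
  The choice \<open>j = \<rho>(0)\<^sup>2/2\<close>, for which consecutive bounces at the neck subtend a right angle, only simplifies constants;
  any value strictly between \<open>0\<close> and \<open>\<rho>(0)\<^sup>2\<close> would do.
\<close>

theorem stable_bounce_sequences:
  assumes "\<epsilon> > 0"
  obtains \<delta> X where "0 < \<delta>" "\<delta> \<le> \<epsilon>"
    and "\<And>k w j. \<lbrakk>\<bar>w\<bar> < \<delta>; \<bar>j - (\<rho> 0)\<^sup>2 / 2\<bar> < \<delta>\<rbrakk> \<Longrightarrow> \<bar>X k (w, j)\<bar> < \<epsilon>"
    and "\<And>w j. \<lbrakk>\<bar>w\<bar> < \<delta>; \<bar>j - (\<rho> 0)\<^sup>2 / 2\<bar> < \<delta>\<rbrakk> \<Longrightarrow>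
      chord_tangential (X 0 (w, j)) (X (Suc 0) (w, j)) j = incoming_tangential (X 0 (w, j)) w j"
    and "\<And>k w j. \<lbrakk>\<bar>w\<bar> < \<delta>; \<bar>j - (\<rho> 0)\<^sup>2 / 2\<bar> < \<delta>\<rbrakk> \<Longrightarrow>
      chord_tangential (X (Suc k) (w, j)) (X (Suc (Suc k)) (w, j)) j
        = - chord_tangential (X (Suc k) (w, j)) (X k (w, j)) j"
    and "\<And>k w j. \<lbrakk>\<bar>w\<bar> < \<delta>; \<bar>j - (\<rho> 0)\<^sup>2 / 2\<bar> < \<delta>\<rbrakk> \<Longrightarrow> \<bar>X k (w, j)\<bar> \<le> \<bar>X 0 (w, j)\<bar>"
    and "\<And>w j. \<lbrakk>\<bar>w\<bar> < \<delta>; \<bar>j - (\<rho> 0)\<^sup>2 / 2\<bar> < \<delta>; w < 0\<rbrakk> \<Longrightarrow> X 0 (w, j) > 0"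
    and "\<And>j. \<bar>j - (\<rho> 0)\<^sup>2 / 2\<bar> < \<delta> \<Longrightarrow> X 0 (0, j) = 0"
    and "smooth_on {(w, j). \<bar>w\<bar> < \<delta> \<and> \<bar>j - (\<rho> 0)\<^sup>2 / 2\<bar> < \<delta>} (X 0)"
proof -
  define j0 where "j0 = (\<rho> 0)\<^sup>2 / 2"
  define \<kappa> where "\<kappa> = deriv (deriv \<rho>) 0 * \<rho> 0"
  have \<kappa>: "\<kappa> > 0"
    unfolding \<kappa>_def using convex pos by simp
  define c where "c = sqrt 2 * \<rho> 0 / (2 * (1 + \<kappa>))"
  have c: "c > 0"
    unfolding c_def using pos[of 0] \<kappa> by simp
  \<comment> \<open>The midpoint between the linearized constant and 1 leaves room for the
    nonlinearity.\<close>
  define q where "q = (1 / (1 + \<kappa>) + 1) / 2"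
  have q: "0 \<le> q" "q < 1" "1 / (1 + \<kappa>) < q"
  proof -
    have *: "0 < t \<Longrightarrow> t < 1 \<Longrightarrow> 0 \<le> (t + 1) / 2 \<and> (t + 1) / 2 < 1 \<and> t < (t + 1) / 2" for t :: real
      by auto
    have "0 < 1 / (1 + \<kappa>)" "1 / (1 + \<kappa>) < 1" using \<kappa> by auto
    from *[OF this] show "0 \<le> q" "q < 1" "1 / (1 + \<kappa>) < q"
      unfolding q_def by blast+
  qed
  define P where "P = (0 :: real \<times> real \<times> real, 0 :: real, j0)"
  have "\<exists>e>0. cball P e \<subseteq> bounce_domain \<and>
    (\<forall>a b c a' b' c' \<theta> d. ((a, b, c), \<theta>) \<in> ball P e \<longrightarrow> ((a', b', c'), \<theta>) \<in> ball P e \<longrightarrow>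
        \<bar>a - a'\<bar> \<le> d \<longrightarrow> \<bar>b - b'\<bar> \<le> d \<longrightarrow> \<bar>c - c'\<bar> \<le> d \<longrightarrow>
        \<bar>bounce_map k ((a, b, c), \<theta>) - bounce_map k ((a', b', c'), \<theta>)\<bar> \<le> q * d)" for k
  proof -
    obtain g' where g': "(bounce_map k has_derivative g') (at (0, 0, (\<rho> 0)\<^sup>2 / 2))"
      "\<And>a b c d. \<bar>a\<bar> \<le> d \<Longrightarrow> \<bar>b\<bar> \<le> d \<Longrightarrow> \<bar>c\<bar> \<le> d \<Longrightarrow> \<bar>g' ((a, b, c), 0)\<bar> \<le> 1 / (1 + \<kappa>) * d"
      using bounce_map_derivative[of k] unfolding \<kappa>_def by blast
    show ?thesis
      unfolding P_def j0_def
      by (rule strict_contraction_near_point[OF smooth_on_bounce_map open_bounce_domain neck_in_bounce_domain g' q(3)])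
  qed
  then obtain e0 where e0: "\<And>k. e0 k > 0" "\<And>k. cball P (e0 k) \<subseteq> bounce_domain"
    "\<And>k a b c a' b' c' \<theta> d. ((a, b, c), \<theta>) \<in> ball P (e0 k) \<Longrightarrow> ((a', b', c'), \<theta>) \<in> ball P (e0 k) \<Longrightarrow>
        \<bar>a - a'\<bar> \<le> d \<Longrightarrow> \<bar>b - b'\<bar> \<le> d \<Longrightarrow> \<bar>c - c'\<bar> \<le> d \<Longrightarrow>
        \<bar>bounce_map k ((a, b, c), \<theta>) - bounce_map k ((a', b', c'), \<theta>)\<bar> \<le> q * d"
    by metis
  \<comment> \<open>All maps with \<open>k > 0\<close> coincide, so two radii cover the infinite
    family.\<close>
  define e where "e = min (e0 0) (e0 1)"
  have e: "e > 0" "cball P e \<subseteq> bounce_domain"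
    using e0(1) e0(2)[of 0] unfolding e_def by (auto simp: subset_iff)
  have Suc_map: "bounce_map k = bounce_map 1" if "k \<noteq> 0" for k
    using that by (simp add: bounce_map_def)
  have lip: "\<bar>bounce_map k ((a, b, c), \<theta>) - bounce_map k ((a', b', c'), \<theta>)\<bar> \<le> q * d"
    if "((a, b, c), \<theta>) \<in> ball P e" "((a', b', c'), \<theta>) \<in> ball P e"
      "\<bar>a - a'\<bar> \<le> d" "\<bar>b - b'\<bar> \<le> d" "\<bar>c - c'\<bar> \<le> d" for k a b c a' b' c' \<theta> d
  proof (cases "k = 0")
    case True
    show ?thesis
      unfolding True by (rule e0(3)) (use that in \<open>auto simp: e_def\<close>)
  next
    case False
    show ?thesis
      unfolding Suc_map[OF False] by (rule e0(3)) (use that in \<open>auto simp: e_def\<close>)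
  qed
  \<comment> \<open>The divisor 5 counts coordinates: three positions, \<open>w\<close> and
    \<open>j - j0\<close>, each below \<open>\<eta>\<close> in absolute value.\<close>
  define \<eta> where "\<eta> = min \<epsilon> (e / 5)"
  have \<eta>: "\<eta> > 0" "\<eta> \<le> \<epsilon>" "5 * \<eta> \<le> e"
    using e(1) assms by (auto simp: \<eta>_def)
  \<comment> \<open>The second bound keeps the forcing \<open>c * w\<close> within
    \<open>(1 - q) * (\<eta> / 2)\<close>, which makes the ball of radius \<open>\<eta> / 2\<close>
    invariant; the halving turns weak bounds into strict bounds by \<open>\<eta>\<close>.\<close>
  define \<delta> where "\<delta> = min \<eta> ((1 - q) * (\<eta> / 2) / c)"
  have \<delta>: "\<delta> > 0" "\<delta> \<le> \<eta>" "c * \<delta> \<le> (1 - q) * (\<eta> / 2)"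
  proof -
    show "\<delta> > 0" "\<delta> \<le> \<eta>"
      using \<eta>(1) q c by (auto simp: \<delta>_def)
    have "\<delta> \<le> (1 - q) * (\<eta> / 2) / c" by (simp add: \<delta>_def)
    then show "c * \<delta> \<le> (1 - q) * (\<eta> / 2)"
      using c by (simp add: pos_le_divide_eq mult.commute)
  qed
  define \<Theta> where "\<Theta> = {-\<delta><..<\<delta>} \<times> {j0 - \<delta><..<j0 + \<delta>}"
  have \<Theta>: "open \<Theta>" "convex \<Theta>" "bounded \<Theta>"
    unfolding \<Theta>_def by (auto intro!: open_Times convex_Times bounded_Times)
  have \<Theta>_iff: "(w, j) \<in> \<Theta> \<longleftrightarrow> \<bar>w\<bar> < \<delta> \<and> \<bar>j - j0\<bar> < \<delta>" for w j
    by (auto simp: \<Theta>_def)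
  have box: "((x, y, z), \<theta>) \<in> ball P e" if bx: "\<bar>x\<bar> < \<eta>" "\<bar>y\<bar> < \<eta>" "\<bar>z\<bar> < \<eta>" "\<theta> \<in> \<Theta>" for x y z \<theta>
  proof -
    obtain w j where \<theta>: "\<theta> = (w, j)" "\<bar>w\<bar> < \<delta>" "\<bar>j - j0\<bar> < \<delta>"
      using bx(4) by (cases \<theta>) (auto simp: \<Theta>_iff)
    have "dist P ((x, y, z), \<theta>) = norm ((x, y, z), w, j - j0)"
      unfolding dist_commute[of P] by (simp add: P_def \<theta>(1) dist_norm zero_prod_def)
    also have "\<dots> \<le> \<bar>x\<bar> + (\<bar>y\<bar> + \<bar>z\<bar>) + (\<bar>w\<bar> + \<bar>j - j0\<bar>)"
      using norm_Pair_le[of "(x, y, z)" "(w, j - j0)"] norm_Pair_le[of x "(y, z)"] norm_Pair_le[of y z]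
        norm_Pair_le[of w "j - j0"] by simp
    also have "\<dots> < e"
      using bx \<theta> \<delta>(2) \<eta>(3) by linarith
    finally show ?thesis by simp
  qed
  \<comment> \<open>The zero sequence satisfies every bounce equation except the first, whose
    residual is the incoming slope up to sign.\<close>
  have at0: "bounce_map k ((0, 0, 0), w, j) = (if k = 0 then - c * w else 0)" for k w j
    by (simp add: bounce_map_def c_def \<kappa>_def chord_tangential_def incoming_tangential_def critical)
  have lip': "\<bar>bounce_map k ((x, y, z), \<theta>) - bounce_map k ((x', y', z'), \<theta>)\<bar> \<le> q * d"
    if "\<bar>x\<bar> < \<eta>" "\<bar>y\<bar> < \<eta>" "\<bar>z\<bar> < \<eta>" "\<bar>x'\<bar> < \<eta>" "\<bar>y'\<bar> < \<eta>" "\<bar>z'\<bar> < \<eta>" "\<theta> \<in> \<Theta>"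
      "\<bar>x - x'\<bar> \<le> d" "\<bar>y - y'\<bar> \<le> d" "\<bar>z - z'\<bar> \<le> d" for k x y z x' y' z' \<theta> d
    by (intro lip box that)
  have near0: "\<bar>bounce_map k ((x, y, z), w, j) - (if k = 0 then - c * w else 0)\<bar> \<le> q * d"
    if "\<bar>x\<bar> < \<eta>" "\<bar>y\<bar> < \<eta>" "\<bar>z\<bar> < \<eta>" "(w, j) \<in> \<Theta>" "\<bar>x\<bar> \<le> d" "\<bar>y\<bar> \<le> d" "\<bar>z\<bar> \<le> d" for k x y z w j d
    using lip'[of x y z 0 0 0 "(w, j)" d k] that \<eta>(1) unfolding at0 by simp
  have "\<exists>X. \<forall>k. \<bar>X k\<bar> \<le> \<eta> / 2 \<and> X k = bounce_map k ((X (k - 1), X k, X (Suc k)), \<theta>)" if th: "\<theta> \<in> \<Theta>" for \<theta>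
  proof (rule neighbour_contraction_fixed_point[OF _ q(1,2)])
    obtain w j where \<theta>: "\<theta> = (w, j)" "\<bar>w\<bar> < \<delta>"
      using th by (cases \<theta>) (auto simp: \<Theta>_iff)
    fix k x y z assume xyz: "\<bar>x\<bar> \<le> \<eta> / 2" "\<bar>y\<bar> \<le> \<eta> / 2" "\<bar>z\<bar> \<le> \<eta> / 2"
    have "\<bar>bounce_map k ((x, y, z), w, j) - (if k = 0 then - c * w else 0)\<bar> \<le> q * (\<eta> / 2)"
      by (rule near0) (use xyz \<eta>(1) th \<theta> in auto)
    moreover have "\<bar>if k = 0 then - c * w else 0\<bar> \<le> (1 - q) * (\<eta> / 2)"
    proof -
      have "\<bar>c * w\<bar> \<le> c * \<delta>"
        unfolding abs_mult using c \<theta>(2) by (simp add: mult_left_mono)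
      then show ?thesis
        using \<delta>(3) q(2) \<eta>(1) by (auto simp: abs_mult)
    qed
    ultimately have "\<bar>bounce_map k ((x, y, z), w, j)\<bar> \<le> q * (\<eta> / 2) + (1 - q) * (\<eta> / 2)"
      by linarith
    also have "q * (\<eta> / 2) + (1 - q) * (\<eta> / 2) = \<eta> / 2"
      unfolding distrib_right[symmetric] by simp
    finally show "\<bar>bounce_map k ((x, y, z), \<theta>)\<bar> \<le> \<eta> / 2"
      unfolding \<theta>(1) .
  next
    show "\<bar>bounce_map k ((x, y, z), \<theta>) - bounce_map k ((x', y', z'), \<theta>)\<bar> \<le> q * d"
      if "\<bar>x\<bar> \<le> \<eta> / 2" "\<bar>y\<bar> \<le> \<eta> / 2" "\<bar>z\<bar> \<le> \<eta> / 2" "\<bar>x'\<bar> \<le> \<eta> / 2" "\<bar>y'\<bar> \<le> \<eta> / 2" "\<bar>z'\<bar> \<le> \<eta> / 2"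
      "\<bar>x - x'\<bar> \<le> d" "\<bar>y - y'\<bar> \<le> d" "\<bar>z - z'\<bar> \<le> d" for k x y z x' y' z' d
      by (rule lip'[OF _ _ _ _ _ _ th that(7-9)]) (use that(1-6) \<eta>(1) in linarith)+
  qed (use \<eta>(1) in simp)
  then have "\<forall>\<theta>. \<exists>X. \<theta> \<in> \<Theta> \<longrightarrow> (\<forall>k. \<bar>X k\<bar> \<le> \<eta> / 2 \<and> X k = bounce_map k ((X (k - 1), X k, X (Suc k)), \<theta>))"
    by blast
  then obtain X0 where "\<forall>\<theta>. \<theta> \<in> \<Theta> \<longrightarrow> (\<forall>k. \<bar>X0 \<theta> k\<bar> \<le> \<eta> / 2 \<and>
      X0 \<theta> k = bounce_map k ((X0 \<theta> (k - 1), X0 \<theta> k, X0 \<theta> (Suc k)), \<theta>))"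
    by metis
  then obtain X where Xbd0: "\<And>k \<theta>. \<theta> \<in> \<Theta> \<Longrightarrow> \<bar>X k \<theta>\<bar> \<le> \<eta> / 2"
    and Xeq: "\<And>k \<theta>. \<theta> \<in> \<Theta> \<Longrightarrow> X k \<theta> = bounce_map k ((X (k - 1) \<theta>, X k \<theta>, X (Suc k) \<theta>), \<theta>)"
    using that[of "\<lambda>k \<theta>. X0 \<theta> k"] by blast
  have Xbd: "\<bar>X k \<theta>\<bar> < \<eta>" if "\<theta> \<in> \<Theta>" for k \<theta>
    using Xbd0[OF that, of k] \<eta>(1) by linarith
  have "Ck_family m \<Theta> X" for m
  proof (rule Ck_family_neighbour_fixed_point[OF \<Theta> q(1,2), where \<Psi> = bounce_map and \<eta> = \<eta>,
        OF _ lip' Xbd Xeq])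
    let ?S = "({-\<eta><..<\<eta>} \<times> {-\<eta><..<\<eta>} \<times> {-\<eta><..<\<eta>}) \<times> \<Theta>"
    have "?S \<subseteq> cball P e"
      using box by (force simp: less_imp_le abs_less_iff)
    then have fam: "Ck_family m ?S (\<lambda>i::nat. bounce_map k)" for k
      by (rule smooth_on_Ck_family[OF smooth_on_bounce_map compact_cball convex_cball e(2)])
    have "Ck_family m ?S (\<lambda>i::nat. if i = 0 then bounce_map 0 else bounce_map 1)"
      by (rule Ck_family_If[OF fam fam])
    moreover have "(\<lambda>i::nat. if i = 0 then bounce_map 0 else bounce_map 1) = bounce_map"
      by (rule ext) (simp add: bounce_map_def)
    ultimately show "Ck_family m ?S bounce_map" by simp
  qed
  from this[THEN Ck_family_imp_Ck_on] have smooth_X: "smooth_on \<Theta> (X 0)"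
    unfolding smooth_on_def by blast
  \<comment> \<open>Only the first equation is forced, so each later entry is at most
    \<open>q\<close> times the supremum. Hence the supremum is
    \<open>\<bar>X 0 \<theta>\<bar>\<close>, or the whole sequence vanishes.\<close>
  have decay: "\<bar>X k \<theta>\<bar> \<le> \<bar>X 0 \<theta>\<bar>" if "\<theta> \<in> \<Theta>" for k \<theta>
  proof -
    obtain w j where \<theta>: "\<theta> = (w, j)" by (cases \<theta>)
    define s where "s = (SUP k. \<bar>X k \<theta>\<bar>)"
    have bdd: "bdd_above (range (\<lambda>k. \<bar>X k \<theta>\<bar>))"
      using Xbd[OF that] by (auto simp: bdd_above_def intro!: exI[of _ \<eta>] less_imp_le)
    have s: "\<bar>X k \<theta>\<bar> \<le> s" for k
      unfolding s_def by (rule cSUP_upper[OF UNIV_I bdd])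
    have "\<bar>X k \<theta>\<bar> \<le> max \<bar>X 0 \<theta>\<bar> (q * s)" for k
    proof (cases "k = 0")
      case False
      have "\<bar>bounce_map k ((X (k - 1) \<theta>, X k \<theta>, X (Suc k) \<theta>), w, j) - (if k = 0 then - c * w else 0)\<bar> \<le> q * s"
        by (rule near0) (use Xbd[OF that] s that \<theta> in auto)
      with False Xeq[OF that, of k] \<theta> show ?thesis by simp
    qed simp
    then have "s \<le> max \<bar>X 0 \<theta>\<bar> (q * s)"
      unfolding s_def by (intro cSUP_least) (auto simp: s_def)
    moreover have "q * s \<le> s" "s \<ge> 0"
      using q s[of 0] mult_right_mono[of q 1 s] by auto
    moreover have "s = 0" if "s \<le> q * s"
      using that q(2) \<open>s \<ge> 0\<close> by (metis mult_less_cancel_right2 order_le_less not_less)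
    ultimately have "s \<le> \<bar>X 0 \<theta>\<bar>"
      by (metis abs_ge_zero max_def)
    with s[of k] show ?thesis by linarith
  qed
  show thesis
  proof (rule that)
    show "0 < \<delta>" "\<delta> \<le> \<epsilon>" using \<delta> \<eta> by auto
    show "\<bar>X k (w, j)\<bar> < \<epsilon>" if "\<bar>w\<bar> < \<delta>" "\<bar>j - (\<rho> 0)\<^sup>2 / 2\<bar> < \<delta>" for k w j
      using Xbd[of "(w, j)" k] that \<eta>(2) by (simp add: \<Theta>_iff j0_def)
    show "\<bar>X k (w, j)\<bar> \<le> \<bar>X 0 (w, j)\<bar>" if "\<bar>w\<bar> < \<delta>" "\<bar>j - (\<rho> 0)\<^sup>2 / 2\<bar> < \<delta>" for k w j
      using decay[of "(w, j)" k] that by (simp add: \<Theta>_iff j0_def)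
    have "\<Theta> = {(w, j). \<bar>w\<bar> < \<delta> \<and> \<bar>j - (\<rho> 0)\<^sup>2 / 2\<bar> < \<delta>}"
      by (auto simp: \<Theta>_iff j0_def)
    with smooth_X show "smooth_on {(w, j). \<bar>w\<bar> < \<delta> \<and> \<bar>j - (\<rho> 0)\<^sup>2 / 2\<bar> < \<delta>} (X 0)"
      by simp
    show "chord_tangential (X 0 (w, j)) (X (Suc 0) (w, j)) j = incoming_tangential (X 0 (w, j)) w j"
      if "\<bar>w\<bar> < \<delta>" "\<bar>j - (\<rho> 0)\<^sup>2 / 2\<bar> < \<delta>" for w j
    proof -
      have "(w, j) \<in> \<Theta>" using that by (simp add: \<Theta>_iff j0_def)
      from Xeq[OF this, of 0] c show ?thesis
        unfolding bounce_map_def \<kappa>_def[symmetric] c_def[symmetric] by simp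
    qed
    show "chord_tangential (X (Suc k) (w, j)) (X (Suc (Suc k)) (w, j)) j
        = - chord_tangential (X (Suc k) (w, j)) (X k (w, j)) j"
      if "\<bar>w\<bar> < \<delta>" "\<bar>j - (\<rho> 0)\<^sup>2 / 2\<bar> < \<delta>" for k w j
    proof -
      have "(w, j) \<in> \<Theta>" using that by (simp add: \<Theta>_iff j0_def)
      from Xeq[OF this, of "Suc k"] c show ?thesis
        unfolding bounce_map_def \<kappa>_def[symmetric] c_def[symmetric] by (simp add: eq_neg_iff_add_eq_0)
    qed
    \<comment> \<open>Without forcing, the first entry too is at most \<open>q\<close> times the
      supremum, which by \<open>decay\<close> is its own absolute value.\<close>
    show "X 0 (0, j) = 0" if "\<bar>j - (\<rho> 0)\<^sup>2 / 2\<bar> < \<delta>" for j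
    proof -
      have \<theta>: "(0, j) \<in> \<Theta>" using that \<delta>(1) by (simp add: \<Theta>_iff j0_def)
      have "\<bar>bounce_map 0 ((X (0 - 1) (0, j), X 0 (0, j), X (Suc 0) (0, j)), 0, j) - (if (0::nat) = 0 then - c * 0 else 0)\<bar>
          \<le> q * \<bar>X 0 (0, j)\<bar>"
        by (rule near0) (use Xbd[OF \<theta>] decay[OF \<theta>] \<theta> in auto)
      then have "\<bar>X 0 (0, j)\<bar> \<le> q * \<bar>X 0 (0, j)\<bar>"
        using Xeq[OF \<theta>, of 0] by simp
      then have "(1 - q) * \<bar>X 0 (0, j)\<bar> \<le> 0"
        by (simp add: algebra_simps)
      then show ?thesis
        using q(2) by (simp add: mult_le_0_iff)
    qed
    \<comment> \<open>By \<open>decay\<close>, \<open>X 0 (w, j)\<close> differs from the positive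
      number \<open>- c * w\<close> by at most \<open>q\<close> times its own size, which rules out
      a nonpositive value.\<close>
    show "X 0 (w, j) > 0" if "\<bar>w\<bar> < \<delta>" "\<bar>j - (\<rho> 0)\<^sup>2 / 2\<bar> < \<delta>" "w < 0" for w j
    proof (rule ccontr)
      assume neg: "\<not> X 0 (w, j) > 0"
      have \<theta>: "(w, j) \<in> \<Theta>" using that by (simp add: \<Theta>_iff j0_def)
      have "\<bar>bounce_map 0 ((X (0 - 1) (w, j), X 0 (w, j), X (Suc 0) (w, j)), w, j) - (if (0::nat) = 0 then - c * w else 0)\<bar>
          \<le> q * \<bar>X 0 (w, j)\<bar>"
        by (rule near0) (use Xbd[OF \<theta>] decay[OF \<theta>] \<theta> in auto)
      then have "\<bar>X 0 (w, j) + c * w\<bar> \<le> q * (- X 0 (w, j))"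
        using Xeq[OF \<theta>, of 0] neg by simp
      moreover have "q * (- X 0 (w, j)) \<le> 1 * (- X 0 (w, j))"
        using q(2) neg by (intro mult_right_mono) auto
      moreover have "c * w < 0" using c that(3) by (simp add: mult_pos_neg)
      ultimately show False by linarith
    qed
  qed
qed

end

section \<open>The mirror\<close>

lemma image_Int_eqI: "\<phi> ` U = V \<Longrightarrow> (\<And>p. p \<in> U \<Longrightarrow> p \<in> M \<longleftrightarrow> \<phi> p \<in> H) \<Longrightarrow> \<phi> ` (U \<inter> M) = V \<inter> H"
  by blast

lemma mirror_interiorI:
  fixes \<phi> :: "'a::euclidean_space \<Rightarrow> 'a"
  shows "x \<in> M \<Longrightarrow> x \<in> U \<Longrightarrow> diffeo_between U V \<phi> \<Longrightarrow> subspace H \<Longrightarrow> dim H = DIM('a) - 1 \<Longrightarrow>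
    \<phi> ` (U \<inter> M) = V \<inter> H \<Longrightarrow> x \<in> mirror_interior M"
  unfolding mirror_interior_def by blast

context neck
begin

text \<open>The component of \<open>y\<close> along \<open>e\<close> is replaced by
  \<open>y \<bullet> y - (\<rho> x)\<^sup>2\<close>, so the mirror falls into the hyperplane
  orthogonal to \<open>(0, e)\<close>; inverting takes only a square root. With
  \<open>\<sigma>\<close> the sign of an end, \<open>a - \<sigma> * x\<close> is the axial distance
  from that end.\<close>

definition mirror_chart :: "real \<Rightarrow> real \<Rightarrow> real ^ 'm \<Rightarrow> real \<times> (real ^ 'm) \<Rightarrow> real \<times> (real ^ 'm)" where
  "mirror_chart a \<sigma> e p =
     (a - \<sigma> * fst p, snd p + (snd p \<bullet> snd p - (\<rho> (fst p))\<^sup>2 - snd p \<bullet> e) *\<^sub>R e)"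

text \<open>The quantity required to be positive is \<open>(y \<bullet> e)\<^sup>2\<close> at the
  preimage \<open>(x, y)\<close>.\<close>

definition mirror_chart_range :: "real \<Rightarrow> real \<Rightarrow> real ^ 'm \<Rightarrow> real set \<Rightarrow> (real \<times> (real ^ 'm)) set" where
  "mirror_chart_range a \<sigma> e Q = {p. \<sigma> * (a - fst p) \<in> Q \<and>
     snd p \<bullet> e + (\<rho> (\<sigma> * (a - fst p)))\<^sup>2 - (snd p \<bullet> snd p - (snd p \<bullet> e)\<^sup>2) > 0}"

lemma mirror_chart_diffeo:
  fixes e :: "real ^ 'm"
  assumes e: "e \<bullet> e = 1" and \<sigma>: "\<sigma> * \<sigma> = 1" and Q: "open Q"
  shows "diffeo_between {p. snd p \<bullet> e > 0 \<and> fst p \<in> Q} (mirror_chart_range a \<sigma> e Q) (mirror_chart a \<sigma> e)"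
    (is "diffeo_between ?U ?V ?\<phi>")
proof -
  define \<psi> where "\<psi> p = (\<sigma> * (a - fst p), snd p - (snd p \<bullet> e) *\<^sub>R e +
    sqrt (snd p \<bullet> e + (\<rho> (\<sigma> * (a - fst p)))\<^sup>2 - (snd p \<bullet> snd p - (snd p \<bullet> e)\<^sup>2)) *\<^sub>R e)" for p :: "real \<times> (real ^ 'm)"
  have Qv: "open ((f :: (real \<times> (real ^ 'm)) \<Rightarrow> real) -` Q)" if "continuous_on UNIV f" for f
    using Q that by (simp add: open_vimage)
  have U: "open ?U"
  proof -
    have "?U = {p. 0 < snd p \<bullet> e} \<inter> fst -` Q" by auto
    then show ?thesis
      by (auto intro!: open_Int open_Collect_less Qv continuous_intros)
  qed
  have V: "open ?V"
  proof -
    have "?V = (\<lambda>p. \<sigma> * (a - fst p)) -` Q \<inter>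
      {p. 0 < snd p \<bullet> e + (\<rho> (\<sigma> * (a - fst p)))\<^sup>2 - (snd p \<bullet> snd p - (snd p \<bullet> e)\<^sup>2)}"
      by (auto simp: mirror_chart_range_def)
    then show ?thesis
      by (auto intro!: open_Int open_Collect_less Qv continuous_intros continuous_on_profile)
  qed
  have \<sigma>': "\<sigma> * (\<sigma> * x) = x" for x
    using \<sigma> by (simp add: mult.assoc[symmetric])
  have "smooth_on ?U ?\<phi>"
    unfolding mirror_chart_def
    by (intro smooth_on_intros smooth_on_profile U)
  moreover have "smooth_on ?V \<psi>"
    unfolding \<psi>_def
    by (intro smooth_on_intros smooth_on_profile V) (auto simp: mirror_chart_range_def)
  moreover have inv1: "\<psi> (?\<phi> p) = p \<and> ?\<phi> p \<in> ?V" if pU: "p \<in> ?U" for p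
  proof -
    obtain x y where p: "p = (x, y)" "y \<bullet> e > 0" "x \<in> Q"
      using pU by (cases p) auto
    define c where "c = y \<bullet> y - (\<rho> x)\<^sup>2 - y \<bullet> e"
    have ze: "(y + c *\<^sub>R e) \<bullet> e = y \<bullet> y - (\<rho> x)\<^sup>2"
      using e by (simp add: inner_add_left c_def)
    have zz: "(y + c *\<^sub>R e) \<bullet> (y + c *\<^sub>R e) = y \<bullet> y + 2 * c * (y \<bullet> e) + c\<^sup>2"
      using e by (simp add: inner_add_left inner_add_right inner_commute power2_eq_square)
    have rad: "(y + c *\<^sub>R e) \<bullet> e + (\<rho> x)\<^sup>2 - ((y + c *\<^sub>R e) \<bullet> (y + c *\<^sub>R e) - ((y + c *\<^sub>R e) \<bullet> e)\<^sup>2) = (y \<bullet> e)\<^sup>2"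
      unfolding zz ze by (simp add: c_def power2_eq_square algebra_simps)
    have perp: "y + c *\<^sub>R e - ((y + c *\<^sub>R e) \<bullet> e) *\<^sub>R e = y - (y \<bullet> e) *\<^sub>R e"
      unfolding ze by (simp add: c_def algebra_simps)
    have \<phi>: "?\<phi> p = (a - \<sigma> * x, y + c *\<^sub>R e)"
      by (simp add: mirror_chart_def p c_def)
    have xs: "\<sigma> * (a - (a - \<sigma> * x)) = x"
      by (simp add: \<sigma>')
    show ?thesis
      using p(2,3) unfolding \<phi> mirror_chart_range_def \<psi>_def
      by (simp only: fst_conv snd_conv xs rad perp mem_Collect_eq)
        (use p in auto)
  qed
  moreover have inv2: "?\<phi> (\<psi> q) = q \<and> \<psi> q \<in> ?U" if "q \<in> ?V" for q
  proof -
    obtain s z where q: "q = (s, z)" by (cases q)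
    define x where "x = \<sigma> * (a - s)"
    define c where "c = sqrt (z \<bullet> e + (\<rho> x)\<^sup>2 - (z \<bullet> z - (z \<bullet> e)\<^sup>2))"
    have rad: "z \<bullet> e + (\<rho> x)\<^sup>2 - (z \<bullet> z - (z \<bullet> e)\<^sup>2) > 0" and "x \<in> Q"
      using that by (auto simp: q x_def mirror_chart_range_def)
    then have c: "c > 0" "c\<^sup>2 = z \<bullet> e + (\<rho> x)\<^sup>2 - (z \<bullet> z - (z \<bullet> e)\<^sup>2)"
      by (simp_all add: c_def)
    define y where "y = z - (z \<bullet> e) *\<^sub>R e + c *\<^sub>R e"
    have ye: "y \<bullet> e = c"
      using e by (simp add: y_def inner_add_left inner_diff_left)
    have yy: "y \<bullet> y = z \<bullet> z - (z \<bullet> e)\<^sup>2 + c\<^sup>2"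
      using e by (simp add: y_def inner_add_left inner_diff_left inner_add_right inner_diff_right inner_commute
          power2_eq_square algebra_simps)
    have \<psi>: "\<psi> q = (x, y)"
      by (simp add: \<psi>_def q x_def y_def c_def)
    have "a - \<sigma> * x = s"
      unfolding x_def \<sigma>' by simp
    moreover have "y + (y \<bullet> y - (\<rho> x)\<^sup>2 - y \<bullet> e) *\<^sub>R e = z"
      unfolding yy ye c(2) by (simp add: y_def algebra_simps)
    ultimately show ?thesis
      unfolding \<psi> using ye c(1) \<open>x \<in> Q\<close> by (simp add: mirror_chart_def q)
  qed
  moreover have "?\<phi> ` ?U = ?V"
  proof (intro equalityI image_subsetI)
    show "?\<phi> p \<in> ?V" if "p \<in> ?U" for p using inv1[OF that] by blast
    show "?V \<subseteq> ?\<phi> ` ?U" using inv2 by (metis (no_types, lifting) image_eqI subsetI)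
  qed
  ultimately show ?thesis
    using U V unfolding diffeo_between_def by blast
qed

text \<open>\<open>I\<close> is everything for an interior chart and \<open>{0..}\<close> at an
  edge, so both kinds of charts share one computation.\<close>

lemma mirror_chart_image:
  fixes e :: "real ^ 'm"
  assumes e: "e \<bullet> e = 1" and \<sigma>: "\<sigma> * \<sigma> = 1" and Q: "open Q" and a: "\<And>x. x \<in> Q \<Longrightarrow> \<bar>x\<bar> \<le> a \<longleftrightarrow> a - \<sigma> * x \<in> I"
  shows "mirror_chart a \<sigma> e ` ({p. snd p \<bullet> e > 0 \<and> fst p \<in> Q} \<inter> rotational_mirror \<rho> a)
     = mirror_chart_range a \<sigma> e Q \<inter> {h. (0, e) \<bullet> h = 0 \<and> fst h \<in> I}" (is "?\<phi> ` (?U \<inter> ?M) = ?V \<inter> ?H")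
proof -
  have img: "?\<phi> ` ?U = ?V"
    using mirror_chart_diffeo[OF e \<sigma> Q] unfolding diffeo_between_def by blast
  have "p \<in> ?M \<longleftrightarrow> ?\<phi> p \<in> ?H" if pU: "p \<in> ?U" for p
  proof -
    obtain x y where p: "p = (x, y)" "x \<in> Q" using pU by (cases p) auto
    have "norm y = \<rho> x \<longleftrightarrow> y \<bullet> y = (\<rho> x)\<^sup>2"
      using pos[of x] by (simp add: norm_eq less_imp_le norm_eq_square)
    moreover have "(0, e) \<bullet> ?\<phi> p = y \<bullet> y - (\<rho> x)\<^sup>2"
      using e by (simp add: mirror_chart_def p inner_add_right inner_commute)
    ultimately show ?thesis
      using a[OF p(2)] by (auto simp: rotational_mirror_def p mirror_chart_def)
  qed
  then show ?thesis by (rule image_Int_eqI[OF img])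
qed

lemma rotational_mirror_interior:
  fixes y :: "real ^ 'm"
  assumes "norm y = \<rho> x" "\<bar>x\<bar> < a"
  shows "(x, y) \<in> mirror_interior (rotational_mirror \<rho> a)"
proof -
  define e where "e = y /\<^sub>R norm y"
  have "y \<noteq> 0" using assms(1) pos[of x] by auto
  then have e: "e \<bullet> e = 1" "y \<bullet> e > 0"
    by (simp_all add: e_def dot_square_norm power2_eq_square)
  let ?Q = "{-a<..<a}" and ?U = "{p. snd p \<bullet> e > 0 \<and> fst p \<in> {-a<..<a}}"
  let ?H = "{h. (0, e) \<bullet> h = 0} :: (real \<times> (real ^ 'm)) set"
  have "mirror_chart a 1 e ` (?U \<inter> rotational_mirror \<rho> a) = mirror_chart_range a 1 e ?Q \<inter> {h. (0, e) \<bullet> h = 0 \<and> fst h \<in> UNIV}"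
    by (rule mirror_chart_image[OF e(1)]) auto
  then have "mirror_chart a 1 e ` (?U \<inter> rotational_mirror \<rho> a) = mirror_chart_range a 1 e ?Q \<inter> ?H"
    by simp
  moreover have "diffeo_between ?U (mirror_chart_range a 1 e ?Q) (mirror_chart a 1 e)"
    by (rule mirror_chart_diffeo[OF e(1)]) auto
  moreover have "subspace ?H" by (rule subspace_hyperplane)
  moreover have "(0, e) \<noteq> (0 :: real \<times> (real ^ 'm))" using e by (auto simp: zero_prod_def)
  then have "dim ?H = DIM(real \<times> (real ^ 'm)) - 1" by (rule dim_hyperplane)
  moreover have "(x, y) \<in> ?U" using e assms by auto
  moreover have "(x, y) \<in> rotational_mirror \<rho> a" using assms by (simp add: rotational_mirror_def)
  ultimately show ?thesis
    by (intro mirror_interiorI)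
qed

lemma profile_bounded: "\<exists>B>0. \<forall>x. \<bar>x\<bar> \<le> a \<longrightarrow> \<rho> x \<le> B"
proof -
  have "compact (\<rho> ` {-a..a})"
    by (intro compact_continuous_image continuous_on_subset[OF smooth_on_imp_continuous_on[OF smooth]]) auto
  then obtain B where "B > 0" "\<And>x. x \<in> {-a..a} \<Longrightarrow> norm (\<rho> x) \<le> B"
    using compact_imp_bounded bounded_pos by (metis image_eqI)
  then show ?thesis by (intro exI[of _ B]) (auto simp: abs_le_iff)
qed

lemma mirror_rotational:
  assumes "a > 0"
  shows "mirror (rotational_mirror \<rho> a :: (real \<times> (real ^ 'm)) set)" (is "mirror ?M")
  unfolding mirror_def
proof (intro conjI ballI)
  obtain B where B: "\<And>x. \<bar>x\<bar> \<le> a \<Longrightarrow> \<rho> x \<le> B"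
    using profile_bounded by blast
  have "?M = {p. norm (snd p) = \<rho> (fst p)} \<inter> {p. \<bar>fst p\<bar> \<le> a}"
    by (auto simp: rotational_mirror_def)
  moreover have "closed {p :: real \<times> (real ^ 'm). norm (snd p) = \<rho> (fst p)}" "closed {p :: real \<times> (real ^ 'm). \<bar>fst p\<bar> \<le> a}"
    by (intro closed_Collect_eq closed_Collect_le continuous_intros continuous_on_profile)+
  ultimately have "closed ?M" by auto
  moreover have "bounded ?M"
    unfolding bounded_iff
  proof (intro exI ballI)
    fix p assume "p \<in> ?M"
    then show "norm p \<le> a + B"
      using B[of "fst p"] norm_Pair_le[of "fst p" "snd p"] by (auto simp: rotational_mirror_def)
  qed
  ultimately show "compact ?M" by (simp add: compact_eq_bounded_closed)
next
  fix p assume "p \<in> mirror_boundary ?M"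
  then have "p \<in> ?M" "p \<notin> mirror_interior ?M" by (auto simp: mirror_boundary_def)
  moreover define x y where "x = fst p" and "y = snd p"
  ultimately have p: "p = (x, y)" "norm y = \<rho> x" "\<bar>x\<bar> \<le> a" "(x, y) \<notin> mirror_interior ?M"
    by (simp_all add: rotational_mirror_def case_prod_beta)
  then have xa: "\<bar>x\<bar> = a"
    using rotational_mirror_interior[OF p(2), of a] by linarith
  define e where "e = y /\<^sub>R norm y"
  have "y \<noteq> 0" using p(2) pos[of x] by auto
  then have e: "e \<bullet> e = 1" "y \<bullet> e > 0"
    by (simp_all add: e_def dot_square_norm power2_eq_square)
  \<comment> \<open>Selects the end on which the point lies; \<open>?Q\<close> then leaves out the
    opposite edge.\<close>
  define \<sigma> where "\<sigma> = (if x \<ge> 0 then 1 else - 1 :: real)"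
  have \<sigma>: "\<sigma> * \<sigma> = 1" "\<sigma> * x = a"
    using xa by (auto simp: \<sigma>_def)
  let ?Q = "{t. - a < \<sigma> * t}"
  let ?U = "{p. snd p \<bullet> e > 0 \<and> fst p \<in> ?Q}" and ?b = "(1, 0) :: real \<times> (real ^ 'm)"
  let ?H = "{h. (0, e) \<bullet> h = 0} :: (real \<times> (real ^ 'm)) set"
  have Q: "open ?Q" by (intro open_Collect_less continuous_intros)
  have "mirror_chart a \<sigma> e ` (?U \<inter> ?M) = mirror_chart_range a \<sigma> e ?Q \<inter> {h. (0, e) \<bullet> h = 0 \<and> fst h \<in> {0..}}"
    by (rule mirror_chart_image[OF e(1) \<sigma>(1) Q]) (use \<open>a > 0\<close> in \<open>auto simp: \<sigma>_def split: if_splits\<close>)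
  then have "mirror_chart a \<sigma> e ` (?U \<inter> ?M) = mirror_chart_range a \<sigma> e ?Q \<inter> {h \<in> ?H. 0 \<le> h \<bullet> ?b}"
    by (simp add: inner_prod_def)
  moreover have "diffeo_between ?U (mirror_chart_range a \<sigma> e ?Q) (mirror_chart a \<sigma> e)"
    by (rule mirror_chart_diffeo[OF e(1) \<sigma>(1) Q])
  moreover have "subspace ?H" by (rule subspace_hyperplane)
  moreover have "(0, e) \<noteq> (0 :: real \<times> (real ^ 'm))" using e by (auto simp: zero_prod_def)
  then have "dim ?H = DIM(real \<times> (real ^ 'm)) - 1" by (rule dim_hyperplane)
  moreover have "p \<in> ?U" using e p \<sigma> \<open>a > 0\<close> by auto
  moreover have "?b \<in> ?H" "?b \<noteq> 0" by (auto simp: zero_prod_def)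
  moreover have "mirror_chart a \<sigma> e p \<bullet> ?b = 0"
    using \<sigma> by (simp add: mirror_chart_def p)
  ultimately have "p \<in> ?U \<and> diffeo_between ?U (mirror_chart_range a \<sigma> e ?Q) (mirror_chart a \<sigma> e) \<and>
      subspace ?H \<and> dim ?H = DIM(real \<times> (real ^ 'm)) - 1 \<and> ?b \<in> ?H \<and> ?b \<noteq> 0 \<and> mirror_chart a \<sigma> e p \<bullet> ?b = 0 \<and>
      mirror_chart a \<sigma> e ` (?U \<inter> ?M) = mirror_chart_range a \<sigma> e ?Q \<inter> {h \<in> ?H. 0 \<le> h \<bullet> ?b}"
    by (intro conjI)
  then show "\<exists>U V H b. \<exists>\<phi> :: real \<times> (real ^ 'm) \<Rightarrow> real \<times> (real ^ 'm). p \<in> U \<and> diffeo_between U V \<phi> \<and> subspace H \<and>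
     dim H = DIM(real \<times> (real ^ 'm)) - 1 \<and> b \<in> H \<and> b \<noteq> 0 \<and> \<phi> p \<bullet> b = 0 \<and> \<phi> ` (U \<inter> ?M) = V \<inter> {h \<in> H. 0 \<le> h \<bullet> b}"
    by (rule exI[where x = "mirror_chart a \<sigma> e", THEN exI[where x = ?b], THEN exI[where x = ?H],
          THEN exI[where x = "mirror_chart_range a \<sigma> e ?Q"], THEN exI[where x = ?U]])
qed

text \<open>Obtained by differentiating \<open>y \<bullet> y = (\<rho> x)\<^sup>2\<close> along a
  curve in the mirror.\<close>

lemma tangent_space_rotational_mirror:
  fixes y :: "real ^ 'm"
  assumes "v \<in> tangent_space (rotational_mirror \<rho> a) (x, y)"
  shows "snd v \<bullet> y = \<rho> x * deriv \<rho> x * fst v"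
proof -
  obtain e c where e: "e > 0" "c ` {-e<..<e} \<subseteq> rotational_mirror \<rho> a" "c 0 = (x, y)"
    and c: "(c has_vector_derivative v) (at 0)"
    using assms unfolding tangent_space_def by blast
  have c': "(c has_derivative (\<lambda>h. h *\<^sub>R v)) (at 0)"
    using c by (simp add: has_vector_derivative_def)
  have \<rho>': "(\<rho> has_derivative (\<lambda>h. deriv \<rho> x * h)) (at (fst (c 0)))"
    using smooth_on_real_deriv(1)[OF smooth, of x] e(3) by (simp add: has_field_derivative_def)
  have "((\<lambda>t. snd (c t) \<bullet> snd (c t) - \<rho> (fst (c t)) * \<rho> (fst (c t))) has_derivative
     (\<lambda>h. (snd (c 0) \<bullet> snd (h *\<^sub>R v) + snd (h *\<^sub>R v) \<bullet> snd (c 0)) -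
       (\<rho> (fst (c 0)) * (deriv \<rho> x * fst (h *\<^sub>R v)) + (deriv \<rho> x * fst (h *\<^sub>R v)) * \<rho> (fst (c 0))))) (at 0)"
    by (intro has_derivative_diff has_derivative_inner has_derivative_mult
        has_derivative_compose[OF has_derivative_fst[OF c'] \<rho>'] has_derivative_snd[OF c'])
  moreover have "((\<lambda>t. snd (c t) \<bullet> snd (c t) - \<rho> (fst (c t)) * \<rho> (fst (c t))) has_derivative (\<lambda>h. 0)) (at 0)"
  proof (rule has_derivative_transform_within_open[where f = "\<lambda>_. 0" and s = "{-e<..<e}"])
    fix t assume "t \<in> {-e<..<e}"
    then have "c t \<in> rotational_mirror \<rho> a" using e(2) by blast
    then show "0 = snd (c t) \<bullet> snd (c t) - \<rho> (fst (c t)) * \<rho> (fst (c t))"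
      by (auto simp: rotational_mirror_def dot_square_norm power2_eq_square)
  qed (use e(1) in auto)
  ultimately have "(\<lambda>h. (snd (c 0) \<bullet> snd (h *\<^sub>R v) + snd (h *\<^sub>R v) \<bullet> snd (c 0)) -
       (\<rho> (fst (c 0)) * (deriv \<rho> x * fst (h *\<^sub>R v)) + (deriv \<rho> x * fst (h *\<^sub>R v)) * \<rho> (fst (c 0)))) = (\<lambda>h. 0)"
    by (rule has_derivative_unique)
  from fun_cong[OF this, of 1] show ?thesis
    by (simp add: e(3) inner_commute algebra_simps)
qed

end

section \<open>Trajectories with prescribed bounces\<close>

lemma has_vector_derivative_affine:
  assumes "\<And>r. r \<in> S \<Longrightarrow> \<gamma> r = \<gamma> t + (r - t) *\<^sub>R v" "t \<in> S"
  shows "(\<gamma> has_vector_derivative v) (at t within S)"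
proof (rule has_vector_derivative_transform[OF assms(2,1)])
  show "((\<lambda>r. \<gamma> t + (r - t) *\<^sub>R v) has_vector_derivative v) (at t within S)"
    by (auto intro!: derivative_eq_intros)
qed

text \<open>\<open>U k\<close> is the velocity arriving at the bounce point \<open>P k\<close>, and
  \<open>U (Suc k)\<close> the one leaving it. At unit speed the lengths \<open>l k\<close> are
  flight times; their lower bound \<open>l_min\<close> excludes accumulation and lets the flights
  cover all times after \<open>t0\<close>.\<close>

lemma billiard_trajectory_through_bounces:
  fixes P U :: "nat \<Rightarrow> 'a::euclidean_space" and l :: "nat \<Rightarrow> real"
  assumes unit: "\<And>k. norm (U k) = 1"
    and l: "l_min > 0" "\<And>k. l k \<ge> l_min"
    and flight: "\<And>k. P (Suc k) = P k + l k *\<^sub>R U (Suc k)"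
    and interior: "\<And>k. P k \<in> mirror_interior M"
    and reflection: "\<And>k. \<exists>\<nu>. unit_normal M (P k) \<nu> \<and> U (Suc k) = specular_reflection \<nu> (U k)"
    and transversal: "\<And>k. U k \<notin> tangent_space M (P k)"
    and free: "\<And>k \<tau>. 0 < \<tau> \<Longrightarrow> \<tau> < l k \<Longrightarrow> P k + \<tau> *\<^sub>R U (Suc k) \<notin> M"
    and incoming: "\<And>\<tau>. \<tau> > 0 \<Longrightarrow> P 0 - \<tau> *\<^sub>R U 0 \<notin> M"
  obtains \<gamma> where "billiard_trajectory {M} \<gamma>" "nonsingular {M} \<gamma>"
    "\<And>t. t \<le> t0 \<Longrightarrow> \<gamma> t = P 0 + (t - t0) *\<^sub>R U 0"
    "\<And>t. t \<ge> t0 \<Longrightarrow> \<exists>k. \<gamma> t \<in> closed_segment (P k) (P (Suc k))"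
proof -
  define T where "T k = t0 + (\<Sum>i<k. l i)" for k
  have T0: "T 0 = t0" and TSuc: "T (Suc k) = T k + l k" for k
    by (simp_all add: T_def)
  have lpos: "l k > 0" for k using l(1) l(2)[of k] by linarith
  have T_less: "T k < T (Suc k)" for k using lpos[of k] by (simp add: TSuc)
  have T_mono: "T i \<le> T k" if "i \<le> k" for i k
    using that T_less by (metis lift_Suc_mono_le less_imp_le)
  have T_strict: "T i < T k" if "i < k" for i k
    using that T_less by (metis lift_Suc_mono_less)
  have T_ge: "T k \<ge> t0 + real k * l_min" for k
  proof (induction k)
    case (Suc k)
    then show ?case using l(2)[of k] by (simp add: TSuc algebra_simps)
  qed (simp add: T0)
  have unbounded: "\<exists>k. t < T k" for t
  proof -
    obtain k where "(t - t0) / l_min < real k"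
      using reals_Archimedean2 by blast
    then have "t < t0 + real k * l_min"
      using l(1) by (simp add: divide_less_eq algebra_simps)
    with T_ge[of k] show ?thesis by (intro exI[of _ k]) linarith
  qed
  have right_ex: "\<exists>k. T k \<le> t \<and> t < T (Suc k)" if "t \<ge> t0" for t
  proof -
    define n where "n = (LEAST n. t < T n)"
    have n: "t < T n" unfolding n_def using unbounded by (rule LeastI_ex)
    have "n \<noteq> 0" using n that T0 by (metis not_le)
    then obtain k where k: "n = Suc k" by (cases n) auto
    have "\<not> t < T k" using not_less_Least[of k "\<lambda>n. t < T n"] k by (simp add: n_def)
    with n k show ?thesis by (intro exI[of _ k]) auto
  qed
  have left_ex: "\<exists>k. T k < t \<and> t \<le> T (Suc k)" if "t > t0" for t
  proof -
    define n where "n = (LEAST n. t \<le> T n)"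
    have n: "t \<le> T n" unfolding n_def using unbounded[of t] by (metis LeastI less_imp_le)
    have "n \<noteq> 0" using n that T0 by (metis not_le)
    then obtain k where k: "n = Suc k" by (cases n) auto
    have "\<not> t \<le> T k" using not_less_Least[of k "\<lambda>n. t \<le> T n"] k by (simp add: n_def)
    with n k show ?thesis by (intro exI[of _ k]) auto
  qed
  have uniq: "i = k" if "T i < t" "t \<le> T (Suc i)" "T k < t" "t \<le> T (Suc k)" for i k t
  proof (rule ccontr)
    assume "i \<noteq> k"
    then have "Suc i \<le> k \<or> Suc k \<le> i" by auto
    then show False using T_mono[of "Suc i" k] T_mono[of "Suc k" i] that by auto
  qed
  \<comment> \<open>Flight intervals open on the left make the index unique; by
    \<open>flight\<close>, the formulas of two adjacent intervals agree at their common bounce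
    time.\<close>
  define idx where "idx t = (THE k. T k < t \<and> t \<le> T (Suc k))" for t
  define \<gamma> where "\<gamma> t = (if t \<le> t0 then P 0 + (t - t0) *\<^sub>R U 0
     else P (idx t) + (t - T (idx t)) *\<^sub>R U (Suc (idx t)))" for t
  have early: "\<gamma> t = P 0 + (t - t0) *\<^sub>R U 0" if "t \<le> t0" for t
    using that by (simp add: \<gamma>_def)
  have late: "\<gamma> t = P k + (t - T k) *\<^sub>R U (Suc k)" if "T k \<le> t" "t \<le> T (Suc k)" for k t
  proof (cases "T k < t")
    case True
    have "idx t = k"
      unfolding idx_def using True that uniq by (intro the_equality) auto
    moreover have "t > t0" using True T_mono[of 0 k] by (simp add: T0)
    ultimately show ?thesis by (simp add: \<gamma>_def)
  next
    case False
    with that have t: "t = T k" by simp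
    show ?thesis
    proof (cases k)
      case 0
      then show ?thesis using t by (simp add: early T0)
    next
      case (Suc i)
      have "idx t = i"
        unfolding idx_def using t Suc T_less[of i] uniq by (intro the_equality) auto
      moreover have "t > t0" using t Suc T_strict[of 0 k] by (simp add: T0)
      ultimately show ?thesis
        using t Suc by (simp add: \<gamma>_def TSuc flight)
    qed
  qed
  have at_T: "\<gamma> (T k) = P k" for k
    using late[of k "T k"] T_less[of k] by simp
  have left_affine: "\<exists>v s. s < t \<and> (\<forall>r\<in>{s..t}. \<gamma> r = \<gamma> t + (r - t) *\<^sub>R v)" for t
  proof (cases "t \<le> t0")
    case True
    then show ?thesis
      by (intro exI[of _ "U 0"] exI[of _ "t - 1"]) (auto simp: early algebra_simps)
  next
    case False
    then obtain k where "T k < t" "t \<le> T (Suc k)" using left_ex[of t] by auto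
    then show ?thesis
      by (intro exI[of _ "U (Suc k)"] exI[of _ "T k"]) (auto simp: late[of k] algebra_simps)
  qed
  have right_affine: "\<exists>v s. t < s \<and> (\<forall>r\<in>{t..s}. \<gamma> r = \<gamma> t + (r - t) *\<^sub>R v)" for t
  proof (cases "t < t0")
    case True
    then show ?thesis
      by (intro exI[of _ "U 0"] exI[of _ t0]) (auto simp: early algebra_simps)
  next
    case False
    then obtain k where "T k \<le> t" "t < T (Suc k)" using right_ex[of t] by auto
    then show ?thesis
      by (intro exI[of _ "U (Suc k)"] exI[of _ "T (Suc k)"]) (auto simp: late[of k] algebra_simps)
  qed
  have left_deriv: "(\<gamma> has_vector_derivative v) (at_left t)"
    if "s < t" "\<And>r. r \<in> {s..t} \<Longrightarrow> \<gamma> r = \<gamma> t + (r - t) *\<^sub>R v" for s t v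
    using has_vector_derivative_affine[of "{s..t}" \<gamma> t v, OF that(2)] that(1)
    by (simp add: at_within_Icc_at_left)
  have right_deriv: "(\<gamma> has_vector_derivative v) (at_right t)"
    if "t < s" "\<And>r. r \<in> {t..s} \<Longrightarrow> \<gamma> r = \<gamma> t + (r - t) *\<^sub>R v" for s t v
    using has_vector_derivative_affine[of "{t..s}" \<gamma> t v, OF that(2)] that(1)
    by (simp add: at_within_Icc_at_right)
  have T_left: "(\<gamma> has_vector_derivative U k) (at_left (T k))" for k
  proof (cases k)
    case 0
    then show ?thesis
      by (intro left_deriv[of "T k - 1"]) (auto simp: T0 early algebra_simps)
  next
    case (Suc i)
    then show ?thesis
      using T_less[of i] by (intro left_deriv[of "T i"]) (auto simp: late[of i] algebra_simps)
  qed
  have T_right: "(\<gamma> has_vector_derivative U (Suc k)) (at_right (T k))" for k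
    using T_less[of k] by (intro right_deriv[of _ "T (Suc k)"]) (auto simp: late[of k] algebra_simps)
  have collision: "\<gamma> t \<in> M \<longleftrightarrow> (\<exists>k. t = T k)" for t
  proof
    assume hit: "\<gamma> t \<in> M"
    show "\<exists>k. t = T k"
    proof (cases "t \<le> t0")
      case True
      have "\<not> 0 < t0 - t"
        using incoming[of "t0 - t"] hit early[OF True] by (auto simp: algebra_simps)
      with True show ?thesis by (intro exI[of _ 0]) (simp add: T0)
    next
      case False
      then obtain k where k: "T k < t" "t \<le> T (Suc k)" using left_ex[of t] by auto
      have "\<not> t - T k < l k"
        using free[of "t - T k" k] hit late[of k t] k by auto
      with k show ?thesis by (intro exI[of _ "Suc k"]) (simp add: TSuc)
    qed
  next
    assume "\<exists>k. t = T k"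
    then show "\<gamma> t \<in> M" using interior by (auto simp: at_T mirror_interior_def)
  qed
  have coll: "collision_times {M} \<gamma> = range T"
    by (auto simp: collision_times_def collision)
  have straight: "\<exists>v. norm v = 1 \<and> (\<forall>r\<in>{s..t}. \<gamma> r = \<gamma> s + (r - s) *\<^sub>R v)"
    if st: "s < t" "{s<..<t} \<inter> range T = {}" for s t
  proof (cases "t \<le> t0")
    case True
    with st(1) show ?thesis
      by (intro exI[of _ "U 0"]) (auto simp: unit early algebra_simps)
  next
    case False
    \<comment> \<open>A bounce-free open interval ending after \<open>t0\<close> cannot begin before
      \<open>t0\<close>, the time of the first bounce; it therefore fits between two consecutive
      bounces.\<close>
    have "T 0 \<notin> {s<..<t}" "T (Suc k) \<notin> {s<..<t}" for k
      using st(2) by blast+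
    note gap = this
    have "s \<ge> t0" using gap(1) False by (auto simp: T0)
    then obtain k where k: "T k \<le> s" "s < T (Suc k)" using right_ex[of s] by auto
    then have "t \<le> T (Suc k)" using gap(2)[of k] by auto
    with k st(1) show ?thesis
      by (intro exI[of _ "U (Suc k)"]) (auto simp: unit late[of k] algebra_simps)
  qed
  have cont: "continuous_on UNIV \<gamma>"
  proof -
    have "continuous (at t) \<gamma>" for t
    proof -
      obtain v s where "s < t" "\<And>r. r \<in> {s..t} \<Longrightarrow> \<gamma> r = \<gamma> t + (r - t) *\<^sub>R v"
        using left_affine[of t] by blast
      from left_deriv[OF this] have "continuous (at_left t) \<gamma>"
        by (rule has_vector_derivative_continuous)
      moreover obtain v s where "t < s" "\<And>r. r \<in> {t..s} \<Longrightarrow> \<gamma> r = \<gamma> t + (r - t) *\<^sub>R v"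
        using right_affine[of t] by blast
      from right_deriv[OF this] have "continuous (at_right t) \<gamma>"
        by (rule has_vector_derivative_continuous)
      ultimately show ?thesis by (simp add: continuous_at_split)
    qed
    then show ?thesis by (simp add: continuous_at_imp_continuous_on)
  qed
  show thesis
  proof (rule that)
    show "billiard_trajectory {M} \<gamma>"
      unfolding billiard_trajectory_def coll
    proof (intro conjI cont allI impI ballI)
      show "\<exists>v. norm v = 1 \<and> (\<forall>r\<in>{s..t}. \<gamma> r = \<gamma> s + (r - s) *\<^sub>R v)"
        if "s < t \<and> {s<..<t} \<inter> range T = {}" for s t
        using straight that by blast
      fix t M' assume "M' \<in> {M}" and hit: "\<gamma> t \<in> mirror_interior M' \<and> (\<forall>M''\<in>{M}. \<gamma> t \<in> M'' \<longrightarrow> M'' = M')"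
      then have M': "M' = M" by simp
      with hit have "\<gamma> t \<in> M" by (auto simp: mirror_interior_def)
      then obtain k where k: "t = T k" using collision by blast
      obtain \<nu> where \<nu>: "unit_normal M (P k) \<nu>" "U (Suc k) = specular_reflection \<nu> (U k)"
        using reflection by blast
      show "\<exists>v \<nu>. (\<gamma> has_vector_derivative v) (at_left t) \<and> unit_normal M' (\<gamma> t) \<nu> \<and>
          (\<gamma> has_vector_derivative specular_reflection \<nu> v) (at_right t)"
        unfolding M' k at_T using T_left[of k] T_right[of k] \<nu> by metis
    qed
    show "nonsingular {M} \<gamma>"
      unfolding nonsingular_def coll
    proof (intro conjI allI ballI impI)
      fix t M' v assume "M' \<in> {M}" and hit: "\<gamma> t \<in> M'" and v: "(\<gamma> has_vector_derivative v) (at_left t)"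
      then obtain k where k: "t = T k" and M': "M' = M" using collision by auto
      have "v = U k"
        using v T_left[of k] unfolding k by (rule vector_derivative_unique_within[rotated]) simp
      then show "v \<notin> tangent_space M' (\<gamma> t)"
        using transversal by (simp add: M' k at_T)
    next
      fix t M' assume "M' \<in> {M}" and "\<gamma> t \<in> M'"
      then obtain k where k: "t = T k" and M': "M' = M" using collision by auto
      show "\<gamma> t \<notin> mirror_boundary M'"
        using interior by (simp add: mirror_boundary_def M' k at_T)
    next
      fix s t
      have "range T \<inter> {s..t} \<subseteq> T ` {k. k \<le> nat \<lceil>(t - t0) / l_min\<rceil>}"
      proof
        fix r assume "r \<in> range T \<inter> {s..t}"
        then obtain k where k: "r = T k" "T k \<le> t" by auto
        then have "real k * l_min \<le> t - t0" using T_ge[of k] by linarith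
        then have "real k \<le> (t - t0) / l_min" using l(1) by (simp add: pos_le_divide_eq)
        then have "k \<le> nat \<lceil>(t - t0) / l_min\<rceil>" by linarith
        with k show "r \<in> T ` {k. k \<le> nat \<lceil>(t - t0) / l_min\<rceil>}" by blast
      qed
      then show "finite (range T \<inter> {s..t})"
        by (rule finite_subset) simp
    qed simp
    show "\<gamma> t = P 0 + (t - t0) *\<^sub>R U 0" if "t \<le> t0" for t
      by (rule early[OF that])
    show "\<exists>k. \<gamma> t \<in> closed_segment (P k) (P (Suc k))" if t: "t \<ge> t0" for t
    proof -
      obtain k where k: "T k \<le> t" "t < T (Suc k)" using right_ex[OF t] by blast
      have "\<gamma> t = P k + (t - T k) *\<^sub>R U (Suc k)"
        using late[of k t] k by simp
      also have "\<dots> = P k + ((t - T k) / l k) *\<^sub>R (P (Suc k) - P k)"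
        using lpos[of k] by (simp add: flight)
      finally have "\<gamma> t = \<dots>" .
      moreover have "0 \<le> (t - T k) / l k" "(t - T k) / l k \<le> 1"
        using k lpos[of k] by (auto simp: TSuc divide_le_eq)
      ultimately show ?thesis
        by (intro exI[of _ k]) (auto simp: in_segment algebra_simps intro!: exI[of _ "(t - T k) / l k"])
    qed
  qed
qed

section \<open>Trajectories from solutions of the bounce equations\<close>

text \<open>Equal norms force \<open>2 * (u \<bullet> N) = - (c * (N \<bullet> N))\<close>. The
  reflection law thus reduces to conservation of speed and the direction of the velocity jump; the
  second conclusion gives transversality.\<close>

lemma specular_reflectionI:
  fixes u N :: "'a::euclidean_space"
  assumes "norm (u + c *\<^sub>R N) = norm u" "c \<noteq> 0" "N \<noteq> 0"
  shows "specular_reflection (N /\<^sub>R norm N) u = u + c *\<^sub>R N" "u \<bullet> N \<noteq> 0"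
proof -
  have "(u + c *\<^sub>R N) \<bullet> (u + c *\<^sub>R N) = u \<bullet> u"
    using assms(1) by (simp add: norm_eq)
  then have "c * (2 * (u \<bullet> N) + c * (N \<bullet> N)) = 0"
    by (simp add: inner_add_left inner_add_right inner_commute algebra_simps)
  then have uN: "2 * (u \<bullet> N) = - (c * (N \<bullet> N))"
    using assms(2) by simp
  have NN: "N \<bullet> N > 0" "(norm N)\<^sup>2 = N \<bullet> N"
    using assms(3) by (simp_all add: power2_norm_eq_inner)
  show "u \<bullet> N \<noteq> 0"
    using uN NN assms(2) by auto
  have "2 * (u \<bullet> (N /\<^sub>R norm N)) * inverse (norm N) = 2 * (u \<bullet> N) / (norm N)\<^sup>2"
    by (simp add: power2_eq_square divide_inverse)
  also have "\<dots> = - c"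
    unfolding uN using NN by simp
  finally show "specular_reflection (N /\<^sub>R norm N) u = u + c *\<^sub>R N"
    by (simp add: specular_reflection_def)
qed

lemma norm_convex_combination_squared:
  fixes y y' :: "'a::real_inner"
  shows "(norm ((1 - t) *\<^sub>R y + t *\<^sub>R y'))\<^sup>2
    = (1 - t) * (norm y)\<^sup>2 + t * (norm y')\<^sup>2 - t * (1 - t) * (norm (y' - y))\<^sup>2"
  unfolding power2_norm_eq_inner
  by (simp add: inner_add_left inner_add_right inner_diff_left inner_diff_right inner_commute algebra_simps)

context neck
begin

section \<open>Metric relations on a single chord\<close>

lemma chord_dot_commute: "chord_dot x x' j = chord_dot x' x j"
  by (simp add: chord_dot_def power2_commute[of x x'] mult.commute)

lemma chord_length_commute: "chord_length x x' j = chord_length x' x j"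
  by (simp add: chord_length_def chord_dot_commute[of x x'] power2_commute[of x x'] algebra_simps)

lemma chord_length_squared:
  assumes "admissible x x' j"
  shows "(chord_length x x' j)\<^sup>2 = (x' - x)\<^sup>2 + (\<rho> x)\<^sup>2 + (\<rho> x')\<^sup>2 - 2 * chord_dot x x' j"
  using chord_length_radicand_pos[OF assms] by (simp add: chord_length_def power2_commute[of x x'])

lemma chord_dot_squared:
  assumes "admissible x x' j"
  shows "(chord_dot x x' j)\<^sup>2 = (\<rho> x)\<^sup>2 * (\<rho> x')\<^sup>2 - j * (chord_length x x' j)\<^sup>2"
proof -
  have "(j - chord_dot x x' j)\<^sup>2 = ((\<rho> x)\<^sup>2 - j) * ((\<rho> x')\<^sup>2 - j) - j * (x - x')\<^sup>2"
    using assms by (simp add: chord_dot_def admissible_def)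
  then show ?thesis
    unfolding chord_length_squared[OF assms] by (simp add: power2_eq_square algebra_simps)
qed

lemma chord_dot_less: "admissible x x' j \<Longrightarrow> chord_dot x x' j < (\<rho> x)\<^sup>2"
proof -
  assume "admissible x x' j"
  then have "j < (\<rho> x)\<^sup>2" "0 \<le> sqrt (((\<rho> x)\<^sup>2 - j) * ((\<rho> x')\<^sup>2 - j) - j * (x - x')\<^sup>2)"
    by (simp_all add: admissible_def)
  then show ?thesis unfolding chord_dot_def by linarith
qed

text \<open>Unit speed split into axial, radial and azimuthal parts, the last with square
  \<open>j / (\<rho> x)\<^sup>2\<close>. It follows by eliminating \<open>\<rho> x'\<close> between
  the formulas for the squared length and the squared dot product.\<close>

lemma chord_energy:
  assumes "admissible x x' j"
  shows "((x' - x) / chord_length x x' j)\<^sup>2 + (((\<rho> x)\<^sup>2 - chord_dot x x' j) / chord_length x x' j)\<^sup>2 / (\<rho> x)\<^sup>2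
     = 1 - j / (\<rho> x)\<^sup>2"
proof -
  define l Q R where "l = (chord_length x x' j)\<^sup>2" and "Q = chord_dot x x' j" and "R = (\<rho> x)\<^sup>2"
  have "l > 0" "R > 0"
    using chord_length_pos[OF assms] pos[of x] by (simp_all add: l_def R_def)
  have l: "l = (x' - x)\<^sup>2 + R + (\<rho> x')\<^sup>2 - 2 * Q" and Q: "Q\<^sup>2 = R * (\<rho> x')\<^sup>2 - j * l"
    using chord_length_squared[OF assms] chord_dot_squared[OF assms] by (simp_all add: l_def Q_def R_def)
  have "(x' - x)\<^sup>2 * R + (R - Q)\<^sup>2 = (R - j) * l"
  proof -
    have "(x' - x)\<^sup>2 * R + (R - Q)\<^sup>2 = (x' - x)\<^sup>2 * R + R * R - 2 * R * Q + Q\<^sup>2"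
      by (simp add: power2_eq_square algebra_simps)
    also have "\<dots> = R * l - j * l"
      unfolding Q by (subst (1) l) (simp add: algebra_simps)
    finally show ?thesis by (simp add: algebra_simps)
  qed
  then have "((x' - x)\<^sup>2 * R + (R - Q)\<^sup>2) / (l * R) = (R - j) / R"
    using \<open>l > 0\<close> by simp
  then have "(x' - x)\<^sup>2 / l + (R - Q)\<^sup>2 / l / R = 1 - j / R"
    using \<open>l > 0\<close> \<open>R > 0\<close> by (simp add: add_divide_distrib diff_divide_distrib)
  then show ?thesis
    by (simp add: power_divide l_def Q_def R_def)
qed

text \<open>Along the chord the squared radius falls below its linear interpolation by
  \<open>t * (1 - t) * (norm (y' - y))\<^sup>2\<close>, while the squared profile differs from its
  own by at most \<open>2 * L * t * (1 - t) * \<bar>x' - x\<bar>\<close>. A chord that is long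
  across the axis therefore stays strictly inside.\<close>

lemma chord_inside:
  fixes y y' :: "real ^ 'm"
  assumes "norm y = \<rho> x" "norm y' = \<rho> x'" "\<bar>x\<bar> \<le> a" "\<bar>x'\<bar> \<le> a" "0 < t" "t < 1"
    and lip: "\<And>s s'. \<bar>s\<bar> \<le> a \<Longrightarrow> \<bar>s'\<bar> \<le> a \<Longrightarrow> \<bar>(\<rho> s)\<^sup>2 - (\<rho> s')\<^sup>2\<bar> \<le> L * \<bar>s - s'\<bar>"
    and far: "(norm (y' - y))\<^sup>2 > 2 * L * \<bar>x' - x\<bar>"
  shows "norm ((1 - t) *\<^sub>R y + t *\<^sub>R y') < \<rho> ((1 - t) * x + t * x')"
proof -
  define s where "s = (1 - t) * x + t * x'"
  have "\<bar>s\<bar> \<le> (1 - t) * \<bar>x\<bar> + t * \<bar>x'\<bar>"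
    unfolding s_def using abs_triangle_ineq[of "(1 - t) * x" "t * x'"] assms(5,6) by (simp add: abs_mult)
  also have "\<dots> \<le> (1 - t) * a + t * a"
    using assms(3-6) by (intro add_mono mult_left_mono) auto
  finally have s: "\<bar>s\<bar> \<le> a" by (simp add: algebra_simps)
  have 1: "(1 - t) * ((\<rho> x)\<^sup>2 - (\<rho> s)\<^sup>2) \<le> (1 - t) * (L * (t * \<bar>x' - x\<bar>))"
  proof (intro mult_left_mono)
    have "x - s = - (t * (x' - x))" by (simp add: s_def algebra_simps)
    then have "\<bar>x - s\<bar> = t * \<bar>x' - x\<bar>" using assms(5) by (simp add: abs_mult)
    with lip[OF assms(3) s] show "(\<rho> x)\<^sup>2 - (\<rho> s)\<^sup>2 \<le> L * (t * \<bar>x' - x\<bar>)" by (simp add: abs_le_iff)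
  qed (use assms(6) in simp)
  have 2: "t * ((\<rho> x')\<^sup>2 - (\<rho> s)\<^sup>2) \<le> t * (L * ((1 - t) * \<bar>x' - x\<bar>))"
  proof (intro mult_left_mono)
    have "x' - s = (1 - t) * (x' - x)" by (simp add: s_def algebra_simps)
    then have "\<bar>x' - s\<bar> = (1 - t) * \<bar>x' - x\<bar>" using assms(6) by (simp add: abs_mult)
    with lip[OF assms(4) s] show "(\<rho> x')\<^sup>2 - (\<rho> s)\<^sup>2 \<le> L * ((1 - t) * \<bar>x' - x\<bar>)" by (simp add: abs_le_iff)
  qed (use assms(5) in simp)
  have 3: "t * (1 - t) * (2 * L * \<bar>x' - x\<bar>) < t * (1 - t) * (norm (y' - y))\<^sup>2"
    using far assms(5,6) by (intro mult_strict_left_mono) auto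
  have "(norm ((1 - t) *\<^sub>R y + t *\<^sub>R y'))\<^sup>2 - (\<rho> s)\<^sup>2
      = (1 - t) * ((\<rho> x)\<^sup>2 - (\<rho> s)\<^sup>2) + t * ((\<rho> x')\<^sup>2 - (\<rho> s)\<^sup>2) - t * (1 - t) * (norm (y' - y))\<^sup>2"
    unfolding norm_convex_combination_squared assms(1,2) by (simp add: algebra_simps)
  also have "\<dots> < (1 - t) * (L * (t * \<bar>x' - x\<bar>)) + t * (L * ((1 - t) * \<bar>x' - x\<bar>)) - t * (1 - t) * (2 * L * \<bar>x' - x\<bar>)"
    using 1 2 3 by linarith
  also have "\<dots> = 0" by (simp add: algebra_simps)
  finally have "(norm ((1 - t) *\<^sub>R y + t *\<^sub>R y'))\<^sup>2 < (\<rho> s)\<^sup>2" by simp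
  then show ?thesis
    unfolding s_def[symmetric] using pos[of s] by (simp add: power_less_imp_less_base less_imp_le)
qed

text \<open>\<open>N\<close> is the gradient of \<open>norm y - \<rho> x\<close>.\<close>

lemma unit_normal_rotational_mirror:
  fixes y :: "real ^ 'm"
  assumes "norm y = \<rho> x"
  defines "N \<equiv> (- deriv \<rho> x, y /\<^sub>R \<rho> x)"
  shows "N \<noteq> 0" "unit_normal (rotational_mirror \<rho> a) (x, y) (N /\<^sub>R norm N)"
    "v \<in> tangent_space (rotational_mirror \<rho> a) (x, y) \<Longrightarrow> v \<bullet> N = 0"
proof -
  have "y \<noteq> 0" using assms(1) pos[of x] by auto
  then show N: "N \<noteq> 0" using pos[of x] by (auto simp: N_def zero_prod_def)
  show tan: "v \<bullet> N = 0" if "v \<in> tangent_space (rotational_mirror \<rho> a) (x, y)" for v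
    using tangent_space_rotational_mirror[OF that] pos[of x] by (simp add: N_def inner_prod_def)
  show "unit_normal (rotational_mirror \<rho> a) (x, y) (N /\<^sub>R norm N)"
    using N tan by (simp add: unit_normal_def)
qed

text \<open>The axial positions determine the rest: at each bounce the radial velocity changes by
  the multiple of the radial position that gives \<open>Y k \<bullet> V (Suc k)\<close> its required
  value. Unit speed comes from the energy identities, and the tangential equations put the velocity
  jump along the normal.\<close>

theorem trajectory_from_bounce_sequence:
  fixes x :: "nat \<Rightarrow> real" and a :: real and y0 v0 :: "real ^ 'm"
  defines "M \<equiv> rotational_mirror \<rho> a :: (real \<times> (real ^ 'm)) set"
  assumes adm: "\<And>k. admissible (x k) (x (Suc k)) j"
    and rad: "(\<rho> (x 0))\<^sup>2 * (1 - w\<^sup>2) - j \<ge> 0"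
    and y0: "norm y0 = \<rho> (x 0)" and v0: "w\<^sup>2 + v0 \<bullet> v0 = 1"
    and y0v0: "y0 \<bullet> v0 = sqrt ((\<rho> (x 0))\<^sup>2 * (1 - w\<^sup>2) - j)"
    and first: "chord_tangential (x 0) (x (Suc 0)) j = incoming_tangential (x 0) w j"
    and later: "\<And>k. chord_tangential (x (Suc k)) (x (Suc (Suc k))) j = - chord_tangential (x (Suc k)) (x k) j"
    and small: "\<And>k. \<bar>x k\<bar> < a"
    and l_min: "l_min > 0" "\<And>k. chord_length (x k) (x (Suc k)) j \<ge> l_min"
    and lip: "\<And>s s'. \<bar>s\<bar> \<le> a \<Longrightarrow> \<bar>s'\<bar> \<le> a \<Longrightarrow> \<bar>(\<rho> s)\<^sup>2 - (\<rho> s')\<^sup>2\<bar> \<le> L * \<bar>s - s'\<bar>"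
    and far: "\<And>k. (chord_length (x k) (x (Suc k)) j)\<^sup>2 > (x (Suc k) - x k)\<^sup>2 + 2 * L * \<bar>x (Suc k) - x k\<bar>"
    and incoming: "\<And>\<tau>. \<tau> > 0 \<Longrightarrow> (x 0, y0) - \<tau> *\<^sub>R (w, v0) \<notin> M"
  obtains \<gamma> where "billiard_trajectory {M} \<gamma>" "nonsingular {M} \<gamma>"
    "\<And>t. t \<le> t0 \<Longrightarrow> \<gamma> t = (x 0, y0) + (t - t0) *\<^sub>R (w, v0)"
    "\<And>t. t \<ge> t0 \<Longrightarrow> \<exists>p\<in>M. \<exists>p'\<in>M. \<gamma> t \<in> closed_segment p p'"
proof -
  define l where "l k = chord_length (x k) (x (Suc k)) j" for k
  define Q where "Q k = chord_dot (x k) (x (Suc k)) j" for k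
  \<comment> \<open>\<open>zp k\<close> and \<open>zm k\<close> are the values required of
    \<open>Y k \<bullet> V (Suc k)\<close> and \<open>Y k \<bullet> V k\<close>, the radius times
    the outgoing and the incoming radial velocity.\<close>
  define zp where "zp k = (Q k - (\<rho> (x k))\<^sup>2) / l k" for k
  define zm where "zm k = (case k of 0 \<Rightarrow> sqrt ((\<rho> (x 0))\<^sup>2 * (1 - w\<^sup>2) - j) | Suc i \<Rightarrow> ((\<rho> (x (Suc i)))\<^sup>2 - Q i) / l i)" for k
  define W where "W k = (case k of 0 \<Rightarrow> w | Suc i \<Rightarrow> (x (Suc i) - x i) / l i)" for k
  define st where "st = rec_nat (y0, v0) (\<lambda>k (y, v). let v' = v + ((zp k - zm k) / (\<rho> (x k))\<^sup>2) *\<^sub>R y in (y + l k *\<^sub>R v', v'))"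
  define Y where "Y k = fst (st k)" for k
  define V where "V k = snd (st k)" for k
  have YV0: "Y 0 = y0" "V 0 = v0"
    by (simp_all add: Y_def V_def st_def)
  have VSuc: "V (Suc k) = V k + ((zp k - zm k) / (\<rho> (x k))\<^sup>2) *\<^sub>R Y k" for k
    by (simp add: Y_def V_def st_def Let_def case_prod_beta)
  have YSuc: "Y (Suc k) = Y k + l k *\<^sub>R V (Suc k)" for k
    by (simp add: Y_def V_def st_def Let_def case_prod_beta)
  have W0: "W 0 = w" and WSuc: "W (Suc k) = (x (Suc k) - x k) / l k" for k
    by (simp_all add: W_def)
  have l: "l k > 0" for k
    unfolding l_def by (rule chord_length_pos[OF adm])
  have l2: "(l k)\<^sup>2 = (x (Suc k) - x k)\<^sup>2 + (\<rho> (x k))\<^sup>2 + (\<rho> (x (Suc k)))\<^sup>2 - 2 * Q k" for k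
    unfolding l_def Q_def by (rule chord_length_squared[OF adm])
  have \<rho>2: "(\<rho> (x k))\<^sup>2 > 0" for k using pos[of "x k"] by simp
  have adm': "admissible (x (Suc k)) (x k) j" for k
    using adm[of k] by (simp add: admissible_def power2_commute[of "x k"] mult.commute)
  have energy_out: "(W (Suc k))\<^sup>2 + (zp k)\<^sup>2 / (\<rho> (x k))\<^sup>2 = 1 - j / (\<rho> (x k))\<^sup>2" for k
  proof -
    have "(zp k)\<^sup>2 = (((\<rho> (x k))\<^sup>2 - Q k) / l k)\<^sup>2"
      by (simp add: zp_def power_divide power2_commute)
    then show ?thesis
      using chord_energy[OF adm[of k]] by (simp add: WSuc l_def Q_def)
  qed
  have energy_in: "(W k)\<^sup>2 + (zm k)\<^sup>2 / (\<rho> (x k))\<^sup>2 = 1 - j / (\<rho> (x k))\<^sup>2" for k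
  proof (cases k)
    case 0
    have "(zm 0)\<^sup>2 = (\<rho> (x 0))\<^sup>2 * (1 - w\<^sup>2) - j"
      using rad by (simp add: zm_def)
    then show ?thesis
      unfolding 0 W0 using \<rho>2[of 0] by (simp add: diff_divide_distrib)
  next
    case (Suc i)
    have "(W (Suc i))\<^sup>2 = ((x i - x (Suc i)) / l i)\<^sup>2"
      by (simp add: WSuc power_divide power2_commute)
    then show ?thesis
      using chord_energy[OF adm'[of i]]
      by (simp add: Suc zm_def l_def Q_def chord_length_commute[of "x (Suc i)"] chord_dot_commute[of "x (Suc i)"])
  qed
  \<comment> \<open>Speed is unchanged at a bounce because the energy identities before and after it
    have the same right-hand side, with the same \<open>j\<close>.\<close>
  have inv: "Y k \<bullet> Y k = (\<rho> (x k))\<^sup>2 \<and> Y k \<bullet> V k = zm k \<and> (W k)\<^sup>2 + V k \<bullet> V k = 1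
      \<and> Y k \<bullet> V (Suc k) = zp k \<and> (W (Suc k))\<^sup>2 + V (Suc k) \<bullet> V (Suc k) = 1" for k
  proof -
    have half: "Y k \<bullet> V (Suc k) = zp k \<and> (W (Suc k))\<^sup>2 + V (Suc k) \<bullet> V (Suc k) = 1"
      if Yk: "Y k \<bullet> Y k = (\<rho> (x k))\<^sup>2" "Y k \<bullet> V k = zm k" "(W k)\<^sup>2 + V k \<bullet> V k = 1" for k
    proof -
      define c where "c = (zp k - zm k) / (\<rho> (x k))\<^sup>2"
      have c: "c * (\<rho> (x k))\<^sup>2 = zp k - zm k"
        using \<rho>2[of k] by (simp add: c_def)
      have "Y k \<bullet> V (Suc k) = zp k"
        unfolding VSuc c_def[symmetric] by (simp add: inner_add_right Yk c)
      moreover have "V (Suc k) \<bullet> V (Suc k) = V k \<bullet> V k + 2 * c * zm k + c * (c * (\<rho> (x k))\<^sup>2)"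
        unfolding VSuc c_def[symmetric]
        by (simp add: inner_add_left inner_add_right Yk inner_commute[of "V k" "Y k"] algebra_simps)
      then have "V (Suc k) \<bullet> V (Suc k) = V k \<bullet> V k + ((zp k)\<^sup>2 / (\<rho> (x k))\<^sup>2 - (zm k)\<^sup>2 / (\<rho> (x k))\<^sup>2)"
        unfolding c by (simp add: c_def power2_eq_square algebra_simps diff_divide_distrib)
      then have "(W (Suc k))\<^sup>2 + V (Suc k) \<bullet> V (Suc k) = 1"
        using energy_in[of k] energy_out[of k] Yk(3) by linarith
      ultimately show ?thesis by blast
    qed
    have "Y k \<bullet> Y k = (\<rho> (x k))\<^sup>2 \<and> Y k \<bullet> V k = zm k \<and> (W k)\<^sup>2 + V k \<bullet> V k = 1"
    proof (induction k)
      case 0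
      show ?case using y0 v0 y0v0 by (simp add: YV0 W0 zm_def dot_square_norm)
    next
      case (Suc k)
      then have h: "Y k \<bullet> V (Suc k) = zp k" "(W (Suc k))\<^sup>2 + V (Suc k) \<bullet> V (Suc k) = 1"
        using half[of k] by auto
      have lW: "l k * W (Suc k) = x (Suc k) - x k"
        using l[of k] by (simp add: WSuc)
      have VV: "V (Suc k) \<bullet> V (Suc k) = 1 - (W (Suc k))\<^sup>2"
        using h(2) by simp
      have lz: "l k * zp k = Q k - (\<rho> (x k))\<^sup>2"
        using l[of k] by (simp add: zp_def)
      have l2V: "(l k)\<^sup>2 * (V (Suc k) \<bullet> V (Suc k)) = (l k)\<^sup>2 - (x (Suc k) - x k)\<^sup>2"
        unfolding VV lW[symmetric] by (simp add: power_mult_distrib algebra_simps)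
      have "Y (Suc k) \<bullet> Y (Suc k) = Y k \<bullet> Y k + 2 * (l k * (Y k \<bullet> V (Suc k))) + (l k)\<^sup>2 * (V (Suc k) \<bullet> V (Suc k))"
        unfolding YSuc
        by (simp add: inner_add_left inner_add_right inner_commute power2_eq_square algebra_simps)
      also have "\<dots> = (\<rho> (x (Suc k)))\<^sup>2"
        using Suc unfolding h(1) lz l2V unfolding l2 by simp
      finally have YY: "Y (Suc k) \<bullet> Y (Suc k) = (\<rho> (x (Suc k)))\<^sup>2" .
      have "l k * (Y (Suc k) \<bullet> V (Suc k)) = l k * zp k + (l k)\<^sup>2 * (V (Suc k) \<bullet> V (Suc k))"
        unfolding YSuc by (simp add: inner_add_left h(1) power2_eq_square algebra_simps)
      also have "\<dots> = (\<rho> (x (Suc k)))\<^sup>2 - Q k"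
        unfolding lz l2V unfolding l2 by simp
      also have "\<dots> = l k * zm (Suc k)"
        using l[of k] by (simp add: zm_def)
      finally have "Y (Suc k) \<bullet> V (Suc k) = zm (Suc k)"
        using l[of k] by simp
      with YY h(2) show ?case by blast
    qed
    with half[of k] show ?thesis by blast
  qed
  have Ynorm: "norm (Y k) = \<rho> (x k)" for k
    using inv[of k] pos[of "x k"] by (simp add: norm_eq_square less_imp_le)
  \<comment> \<open>The radial velocity is nonnegative on arrival and negative on departure, so the
    jump is nonzero and no bounce is tangential.\<close>
  have zneg: "zp k - zm k < 0" for k
  proof -
    have "zp k < 0"
      using chord_dot_less[OF adm[of k]] l[of k] by (simp add: zp_def Q_def divide_neg_pos)
    moreover have "zm k \<ge> 0"
    proof (cases k)
      case 0
      then show ?thesis using rad by (simp add: zm_def)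
    next
      case (Suc i)
      then show ?thesis
        using chord_dot_less[OF adm'[of i]] l[of i]
        by (simp add: zm_def Q_def chord_dot_commute[of "x (Suc i)"])
    qed
    ultimately show ?thesis by linarith
  qed
  have tangential: "W (Suc k) + deriv \<rho> (x k) * zp k / \<rho> (x k) = W k + deriv \<rho> (x k) * zm k / \<rho> (x k)" for k
  proof -
    have out: "chord_tangential (x k) (x (Suc k)) j = W (Suc k) + deriv \<rho> (x k) * zp k / \<rho> (x k)" for k
    proof -
      have "chord_tangential (x k) (x (Suc k)) j = ((x (Suc k) - x k) - deriv \<rho> (x k) * (((\<rho> (x k))\<^sup>2 - Q k) / \<rho> (x k))) / l k"
        by (simp add: chord_tangential_def Q_def l_def)
      also have "\<dots> = W (Suc k) + deriv \<rho> (x k) * zp k / \<rho> (x k)"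
        using l[of k] pos[of "x k"] by (simp add: WSuc zp_def field_simps)
      finally show ?thesis .
    qed
    show ?thesis
    proof (cases k)
      case 0
      then show ?thesis
        using first out[of 0] by (simp add: incoming_tangential_def W0 zm_def)
    next
      case (Suc i)
      \<comment> \<open>Here the chord is traversed backwards, which accounts for the minus sign in
        the bounce equation.\<close>
      have "chord_tangential (x (Suc i)) (x i) j = ((x i - x (Suc i)) - deriv \<rho> (x (Suc i)) * (((\<rho> (x (Suc i)))\<^sup>2 - Q i) / \<rho> (x (Suc i)))) / l i"
        by (simp add: chord_tangential_def Q_def l_def chord_length_commute[of "x (Suc i)"] chord_dot_commute[of "x (Suc i)"])
      also have "\<dots> = - (W (Suc i) + deriv \<rho> (x (Suc i)) * zm (Suc i) / \<rho> (x (Suc i)))"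
        using l[of i] pos[of "x (Suc i)"] by (simp add: WSuc zm_def field_simps)
      finally show ?thesis
        using later[of i] out[of "Suc i"] by (simp add: Suc)
    qed
  qed
  define P where "P k = (x k, Y k)" for k
  define U where "U k = (W k, V k)" for k
  have unit: "norm (U k) = 1" for k
    using inv[of k] by (simp add: U_def norm_Pair power2_norm_eq_inner)
  have PM: "P k \<in> M" for k
    using Ynorm[of k] small[of k] by (simp add: P_def M_def rotational_mirror_def)
  \<comment> \<open>The axial part of the jump comes from the tangential equation, the radial part
    from the recursion.\<close>
  have bounce: "U (Suc k) = U k + ((zp k - zm k) / \<rho> (x k)) *\<^sub>R (- deriv \<rho> (x k), Y k /\<^sub>R \<rho> (x k))" for k
  proof -
    have "W (Suc k) = W k + (zp k - zm k) / \<rho> (x k) * (- deriv \<rho> (x k))"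
      using tangential[of k] by (simp add: diff_divide_distrib algebra_simps)
    moreover have "V (Suc k) = V k + ((zp k - zm k) / \<rho> (x k)) *\<^sub>R (Y k /\<^sub>R \<rho> (x k))"
      unfolding VSuc by (simp add: power2_eq_square divide_inverse mult_ac)
    ultimately show ?thesis
      by (simp only: U_def scaleR_Pair add_Pair real_scaleR_def)
  qed
  have mirrored: "specular_reflection (N /\<^sub>R norm N) (U k) = U (Suc k) \<and> U k \<bullet> N \<noteq> 0"
    if "N = (- deriv \<rho> (x k), Y k /\<^sub>R \<rho> (x k))" for N k
  proof -
    have "N \<noteq> 0" unfolding that by (rule unit_normal_rotational_mirror[OF Ynorm])
    moreover have "(zp k - zm k) / \<rho> (x k) \<noteq> 0"
      using zneg[of k] pos[of "x k"] by auto
    moreover have "U (Suc k) = U k + ((zp k - zm k) / \<rho> (x k)) *\<^sub>R N"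
      unfolding that by (rule bounce)
    ultimately show ?thesis
      using specular_reflectionI[of "U k" "(zp k - zm k) / \<rho> (x k)" N] unit by metis
  qed
  show thesis
  proof (rule billiard_trajectory_through_bounces[of U l_min l P M t0])
    show "norm (U k) = 1" for k by (rule unit)
    show "l_min > 0" "l k \<ge> l_min" for k using l_min by (simp_all add: l_def)
    show flight: "P (Suc k) = P k + l k *\<^sub>R U (Suc k)" for k
      using l[of k] by (simp add: P_def U_def YSuc WSuc)
    show "P k \<in> mirror_interior M" for k
      unfolding P_def M_def by (rule rotational_mirror_interior[OF Ynorm small])
    show "\<exists>\<nu>. unit_normal M (P k) \<nu> \<and> U (Suc k) = specular_reflection \<nu> (U k)" for k
      using mirrored[OF refl, of k] unit_normal_rotational_mirror(2)[OF Ynorm[of k], of a]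
      unfolding P_def M_def by metis
    show "U k \<notin> tangent_space M (P k)" for k
      using mirrored[OF refl, of k] unit_normal_rotational_mirror(3)[OF Ynorm[of k], of "U k" a]
      unfolding P_def M_def by blast
    show "P k + \<tau> *\<^sub>R U (Suc k) \<notin> M" if \<tau>: "0 < \<tau>" "\<tau> < l k" for k \<tau>
    proof -
      define t where "t = \<tau> / l k"
      have t: "0 < t" "t < 1" "\<tau> = t * l k"
        using \<tau> l[of k] by (auto simp: t_def)
      have lU: "l k *\<^sub>R U (Suc k) = P (Suc k) - P k"
        by (simp add: flight)
      have "P k + \<tau> *\<^sub>R U (Suc k) = (1 - t) *\<^sub>R P k + t *\<^sub>R P (Suc k)"
        unfolding t(3) scaleR_scaleR[symmetric] lU by (simp add: algebra_simps)
      then have eq: "P k + \<tau> *\<^sub>R U (Suc k) = ((1 - t) * x k + t * x (Suc k), (1 - t) *\<^sub>R Y k + t *\<^sub>R Y (Suc k))"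
        by (simp add: P_def)
      have "norm ((1 - t) *\<^sub>R Y k + t *\<^sub>R Y (Suc k)) < \<rho> ((1 - t) * x k + t * x (Suc k))"
      proof (rule chord_inside[OF Ynorm Ynorm _ _ t(1,2) lip])
        have "(norm (Y (Suc k) - Y k))\<^sup>2 = (l k)\<^sup>2 * (V (Suc k) \<bullet> V (Suc k))"
          unfolding YSuc power2_norm_eq_inner by (simp add: power2_eq_square)
        also have "V (Suc k) \<bullet> V (Suc k) = 1 - (W (Suc k))\<^sup>2"
          using inv[of k] by simp
        also have "(l k)\<^sup>2 * (1 - (W (Suc k))\<^sup>2) = (l k)\<^sup>2 - (x (Suc k) - x k)\<^sup>2"
          using l[of k] by (simp add: WSuc power_divide algebra_simps)
        finally show "(norm (Y (Suc k) - Y k))\<^sup>2 > 2 * L * \<bar>x (Suc k) - x k\<bar>"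
          using far[of k] by (simp add: l_def)
      qed (use small[of k] small[of "Suc k"] in auto)
      then show ?thesis unfolding eq M_def rotational_mirror_def by simp
    qed
    show "P 0 - \<tau> *\<^sub>R U 0 \<notin> M" if "\<tau> > 0" for \<tau>
      using incoming[OF that] by (simp add: P_def U_def YV0 W0)
  next
    fix \<gamma>
    assume "billiard_trajectory {M} \<gamma>" "nonsingular {M} \<gamma>"
      "\<And>t. t \<le> t0 \<Longrightarrow> \<gamma> t = P 0 + (t - t0) *\<^sub>R U 0"
      "\<And>t. t \<ge> t0 \<Longrightarrow> \<exists>k. \<gamma> t \<in> closed_segment (P k) (P (Suc k))"
    then show thesis
      using PM by (intro that[of \<gamma>]) (auto simp: P_def U_def YV0 W0, blast)
  qed
qed

end

section \<open>The family of trapped lines\<close>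

text \<open>The Gram determinant of \<open>v\<close> and \<open>y\<close>, that is, the squared norm
  of their exterior product.\<close>

definition squared_momentum :: "'b::real_inner \<Rightarrow> 'b \<Rightarrow> real" where
  "squared_momentum v y = (v \<bullet> v) * (y \<bullet> y) - (y \<bullet> v)\<^sup>2"

lemma squared_momentum_shift: "squared_momentum v (y + k *\<^sub>R v) = squared_momentum v y"
  by (simp add: squared_momentum_def inner_add_left inner_add_right inner_commute power2_eq_square algebra_simps)

text \<open>On an oriented line \<open>x * w + y \<bullet> v = 0\<close>, so for
  \<open>w \<noteq> 0\<close> the equation prescribes the axial coordinate of the foot point as a
  function of \<open>w\<close> and the squared momentum.\<close>

definition line_family :: "(real \<times> real) set \<Rightarrow> (real \<times> real \<Rightarrow> real) \<Rightarrow> ((real \<times> 'b::euclidean_space) \<times> (real \<times> 'b)) set" where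
  "line_family \<Theta> K = {q \<in> oriented_lines. (fst (fst q), squared_momentum (snd (fst q)) (snd (snd q))) \<in> \<Theta> \<and>
     snd (snd q) \<bullet> snd (fst q) = K (fst (fst q), squared_momentum (snd (fst q)) (snd (snd q)))}"

text \<open>
  Straightens a family of lines given by \<open>y \<bullet> v = K (w, squared_momentum v y)\<close>. Translating \<open>y\<close> along \<open>v\<close> does not
  change the squared momentum, so the shear making the right-hand side \<open>0\<close> has an explicit inverse; a second shear, along \<open>e\<close>,
  turns the coordinate \<open>y \<bullet> v\<close> into \<open>y \<bullet> e\<close>.
\<close>

definition line_chart ::
    "(real \<times> real \<Rightarrow> real) \<Rightarrow> 'b::euclidean_space \<Rightarrow> (real \<times> 'b) \<times> (real \<times> 'b) \<Rightarrow> (real \<times> 'b) \<times> (real \<times> 'b)" where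
  "line_chart K e q =
     (let w = fst (fst q); v = snd (fst q); x = fst (snd q); y = snd (snd q);
          z = y - (K (w, squared_momentum v y) / (v \<bullet> v)) *\<^sub>R v
      in ((w * w + v \<bullet> v - 1, v), (x * w + y \<bullet> v, z + (z \<bullet> v - z \<bullet> e) *\<^sub>R e)))"

lemma line_chart_diffeo:
  fixes e :: "'b::euclidean_space" and \<Theta> :: "(real \<times> real) set"
  assumes \<Theta>: "open \<Theta>" and K: "smooth_on \<Theta> K" and neg: "\<And>w j. (w, j) \<in> \<Theta> \<Longrightarrow> w < 0" and e: "e \<bullet> e = 1"
  defines "U \<equiv> {q :: (real \<times> 'b) \<times> (real \<times> 'b). (fst (fst q), squared_momentum (snd (fst q)) (snd (snd q))) \<in> \<Theta> \<and> snd (fst q) \<bullet> e > 0}"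
  shows "\<exists>V. diffeo_between U V (line_chart K e)"
proof -
  \<comment> \<open>The second shear multiplies \<open>z \<bullet> e - z \<bullet> v\<close> by
    \<open>v \<bullet> e\<close>, which is positive on the domain, so division by it recovers
    \<open>z\<close>.\<close>
  define unshear where "unshear q = snd (snd q) + ((snd (snd q) \<bullet> e - snd (snd q) \<bullet> snd (fst q)) / (snd (fst q) \<bullet> e)) *\<^sub>R e"
    for q :: "(real \<times> 'b) \<times> (real \<times> 'b)"
  \<comment> \<open>This is \<open>- w\<close>: since \<open>w < 0\<close>, the positive root
    recovers it from the coordinate \<open>w * w + v \<bullet> v - 1\<close>.\<close>
  define speed where "speed q = sqrt (1 + fst (fst q) - snd (fst q) \<bullet> snd (fst q))" for q :: "(real \<times> 'b) \<times> (real \<times> 'b)"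
  define V where "V = {q. 1 + fst (fst q) - snd (fst q) \<bullet> snd (fst q) > 0 \<and> snd (fst q) \<bullet> e > 0 \<and>
     (- speed q, squared_momentum (snd (fst q)) (unshear q)) \<in> \<Theta>}"
  define pos where "pos q = unshear q + (K (- speed q, squared_momentum (snd (fst q)) (unshear q)) / (snd (fst q) \<bullet> snd (fst q))) *\<^sub>R snd (fst q)"
    for q :: "(real \<times> 'b) \<times> (real \<times> 'b)"
  \<comment> \<open>Written \<open>0 - speed q\<close> so that the smoothness rule for differences
    applies.\<close>
  define \<psi> where "\<psi> q = ((0 - speed q, snd (fst q)), ((pos q \<bullet> snd (fst q) - fst (snd q)) / speed q, pos q))"
    for q :: "(real \<times> 'b) \<times> (real \<times> 'b)"
  have vv: "v \<bullet> v > 0" if "v \<bullet> e > 0" for v :: 'b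
    using that by auto
  have openU: "open U"
  proof -
    have "U = (\<lambda>q. (fst (fst q), squared_momentum (snd (fst q)) (snd (snd q)))) -` \<Theta> \<inter> {q. 0 < snd (fst q) \<bullet> e}"
      by (auto simp: U_def)
    moreover have "open ((\<lambda>q::(real \<times> 'b) \<times> (real \<times> 'b). (fst (fst q), squared_momentum (snd (fst q)) (snd (snd q)))) -` \<Theta>)"
      unfolding squared_momentum_def by (rule open_vimage[OF \<Theta>]) (intro continuous_intros)
    moreover have "open {q::(real \<times> 'b) \<times> (real \<times> 'b). 0 < snd (fst q) \<bullet> e}"
      by (intro open_Collect_less continuous_intros)
    ultimately show ?thesis by auto
  qed
  define V0 where "V0 = {q::(real \<times> 'b) \<times> (real \<times> 'b). 1 + fst (fst q) - snd (fst q) \<bullet> snd (fst q) > 0 \<and> snd (fst q) \<bullet> e > 0}"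
  have openV0: "open V0"
    unfolding V0_def by (intro open_Collect_conj open_Collect_less continuous_intros)
  note sm = smooth_on_add smooth_on_diff smooth_on_scaleR smooth_on_divide smooth_on_inner smooth_on_fst smooth_on_snd
    smooth_on_ident smooth_on_const smooth_on_sqrt smooth_on_mult smooth_on_power2 smooth_on_Pair
  have sm_unshear: "smooth_on V0 unshear"
    unfolding unshear_def by (intro sm openV0) (auto simp: V0_def)
  have sm_speed: "smooth_on V0 speed"
    unfolding speed_def by (intro sm openV0) (auto simp: V0_def)
  have sm_arg: "smooth_on V0 (\<lambda>q. (0 - speed q, squared_momentum (snd (fst q)) (unshear q)))"
    unfolding squared_momentum_def by (intro sm openV0 sm_unshear sm_speed)
  have openV: "open V"
  proof -
    have "V = V0 \<inter> (\<lambda>q. (0 - speed q, squared_momentum (snd (fst q)) (unshear q))) -` \<Theta>"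
      by (auto simp: V_def V0_def)
    then show ?thesis
      using continuous_open_preimage[OF smooth_on_imp_continuous_on[OF sm_arg] openV0 \<Theta>] by simp
  qed
  have "V \<subseteq> V0" by (auto simp: V_def V0_def)
  have sm_pos: "smooth_on V pos"
  proof -
    have "smooth_on V (\<lambda>q. K (0 - speed q, squared_momentum (snd (fst q)) (unshear q)))"
      by (rule smooth_on_compose[OF smooth_on_subset[OF sm_arg \<open>V \<subseteq> V0\<close>] openV K \<Theta>]) (auto simp: V_def)
    then have sK: "smooth_on V (\<lambda>q. K (- speed q, squared_momentum (snd (fst q)) (unshear q)))"
      by simp
    show ?thesis
      unfolding pos_def
      by (intro sm openV sK smooth_on_subset[OF sm_unshear \<open>V \<subseteq> V0\<close>]) (auto simp: V_def intro!: vv)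
  qed
  have "smooth_on V \<psi>"
    unfolding \<psi>_def
    by (intro sm openV sm_pos smooth_on_subset[OF sm_speed \<open>V \<subseteq> V0\<close>]) (auto simp: V_def speed_def)
  moreover have "smooth_on U (line_chart K e)"
  proof -
    have "smooth_on U (\<lambda>q. (fst (fst q), squared_momentum (snd (fst q)) (snd (snd q))))"
      unfolding squared_momentum_def by (intro sm openU)
    then have sK: "smooth_on U (\<lambda>q. K (fst (fst q), squared_momentum (snd (fst q)) (snd (snd q))))"
      by (rule smooth_on_compose[OF _ openU K \<Theta>]) (auto simp: U_def)
    show ?thesis
      unfolding line_chart_def Let_def by (intro sm openU sK) (auto simp: U_def intro!: vv)
  qed
  moreover have inv1: "\<psi> (line_chart K e q) = q \<and> line_chart K e q \<in> V" if q: "q \<in> U" for q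
  proof -
    obtain w v x y where qe: "q = ((w, v), (x, y))" by (metis surj_pair)
    have w\<Theta>: "(w, squared_momentum v y) \<in> \<Theta>" and ve: "v \<bullet> e > 0"
      using q by (auto simp: U_def qe)
    have w: "w < 0" using neg[OF w\<Theta>] .
    define k where "k = K (w, squared_momentum v y) / (v \<bullet> v)"
    define z where "z = y - k *\<^sub>R v"
    define \<zeta> where "\<zeta> = z + (z \<bullet> v - z \<bullet> e) *\<^sub>R e"
    have \<phi>: "line_chart K e q = ((w * w + v \<bullet> v - 1, v), (x * w + y \<bullet> v, \<zeta>))"
      by (simp add: line_chart_def qe Let_def k_def z_def \<zeta>_def)
    have "\<zeta> \<bullet> e - \<zeta> \<bullet> v = (z \<bullet> e - z \<bullet> v) * (v \<bullet> e)"
      using e by (simp add: \<zeta>_def inner_add_left inner_commute algebra_simps)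
    then have us: "unshear (line_chart K e q) = z"
      unfolding unshear_def \<phi> using ve by (simp add: \<zeta>_def scaleR_add_left[symmetric])
    have sp: "speed (line_chart K e q) = - w"
      unfolding speed_def \<phi> using w by (simp add: power2_eq_square[symmetric])
    have sq: "squared_momentum v z = squared_momentum v y"
      using squared_momentum_shift[of v y "- k"] by (simp add: z_def)
    have pq: "pos (line_chart K e q) = y"
      unfolding pos_def us sp unfolding \<phi> fst_conv snd_conv minus_minus sq k_def[symmetric] by (simp add: z_def)
    have "\<psi> (line_chart K e q) = q"
      unfolding \<psi>_def pq sp unfolding \<phi> using w by (simp add: qe field_simps)
    moreover have "line_chart K e q \<in> V"
      unfolding V_def mem_Collect_eq us sp using w\<Theta> ve w by (simp add: \<phi> sq mult_neg_neg)
    ultimately show ?thesis by blast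
  qed
  moreover have inv2: "line_chart K e (\<psi> q) = q \<and> \<psi> q \<in> U" if q: "q \<in> V" for q
  proof -
    obtain s v t \<zeta> where qe: "q = ((s, v), (t, \<zeta>))" by (metis surj_pair)
    define z where "z = \<zeta> + ((\<zeta> \<bullet> e - \<zeta> \<bullet> v) / (v \<bullet> e)) *\<^sub>R e"
    define w where "w = - sqrt (1 + s - v \<bullet> v)"
    have us: "unshear q = z" and sp: "speed q = - w"
      by (simp_all add: unshear_def speed_def qe z_def w_def)
    have ve: "v \<bullet> e > 0" and rad: "1 + s - v \<bullet> v > 0" and w\<Theta>: "(w, squared_momentum v z) \<in> \<Theta>"
      using q unfolding V_def mem_Collect_eq us sp by (simp_all add: qe)
    have w: "w < 0" "w * w = 1 + s - v \<bullet> v"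
      using rad by (simp_all add: w_def)
    define y where "y = z + (K (w, squared_momentum v z) / (v \<bullet> v)) *\<^sub>R v"
    have pq: "pos q = y"
      unfolding pos_def us sp by (simp add: qe y_def)
    have \<psi>: "\<psi> q = ((w, v), ((y \<bullet> v - t) / (- w), y))"
      unfolding \<psi>_def pq sp by (simp add: qe)
    have sq: "squared_momentum v y = squared_momentum v z"
      unfolding y_def by (rule squared_momentum_shift)
    have yz: "y - (K (w, squared_momentum v z) / (v \<bullet> v)) *\<^sub>R v = z"
      by (simp add: y_def)
    have ze: "z \<bullet> e = \<zeta> \<bullet> e + (\<zeta> \<bullet> e - \<zeta> \<bullet> v) / (v \<bullet> e)"
      using e by (simp add: z_def inner_add_left)
    have zv: "z \<bullet> v = \<zeta> \<bullet> e"
      using ve by (simp add: z_def inner_add_left inner_commute[of e v])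
    have "z + (z \<bullet> v - z \<bullet> e) *\<^sub>R e = \<zeta>"
      unfolding ze zv by (simp add: z_def)
    moreover have "(y \<bullet> v - t) / (- w) * w + y \<bullet> v = t"
      using w(1) by simp
    ultimately have "line_chart K e (\<psi> q) = q"
      unfolding line_chart_def \<psi> Let_def fst_conv snd_conv sq yz by (simp add: qe w(2))
    moreover have "\<psi> q \<in> U"
      unfolding U_def mem_Collect_eq \<psi> using w\<Theta> ve by (simp add: sq)
    ultimately show ?thesis by blast
  qed
  moreover have "line_chart K e ` U = V"
  proof (intro equalityI image_subsetI)
    show "line_chart K e p \<in> V" if "p \<in> U" for p using inv1[OF that] by blast
    show "V \<subseteq> line_chart K e ` U" using inv2 by (metis image_eqI subsetI)
  qed
  ultimately show ?thesis
    using openU openV unfolding diffeo_between_def by blast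
qed

lemma dim_line_family_slice:
  fixes e :: "'b::euclidean_space"
  assumes "e \<noteq> 0"
  shows "dim {q :: (real \<times> 'b) \<times> (real \<times> 'b). fst (fst q) = 0 \<and> fst (snd q) = 0 \<and> e \<bullet> snd (snd q) = 0} = 2 * DIM(real \<times> 'b) - 3"
proof -
  define f where "f p = ((0 :: real, fst p), (0 :: real, snd p))" for p :: "'b \<times> 'b"
  have lin: "linear f"
    by (rule linearI) (auto simp: f_def)
  have "{q :: (real \<times> 'b) \<times> (real \<times> 'b). fst (fst q) = 0 \<and> fst (snd q) = 0 \<and> e \<bullet> snd (snd q) = 0}
      = f ` (UNIV \<times> {z. e \<bullet> z = 0})"
    by (auto simp: f_def image_iff)
  moreover have "inj_on f A" for A
    by (auto simp: f_def inj_on_def prod_eq_iff)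
  ultimately have "dim {q :: (real \<times> 'b) \<times> (real \<times> 'b). fst (fst q) = 0 \<and> fst (snd q) = 0 \<and> e \<bullet> snd (snd q) = 0}
      = dim ((UNIV :: 'b set) \<times> {z. e \<bullet> z = 0})"
    using dim_image_eq[OF lin] by metis
  also have "\<dots> = DIM('b) + (DIM('b) - 1)"
    using dim_Times[of "UNIV :: 'b set" "{z. e \<bullet> z = 0}"] dim_hyperplane[OF assms] subspace_hyperplane[of e] by simp
  finally show ?thesis
    using DIM_positive[where 'a = 'b] by simp
qed

text \<open>The chart vector \<open>e\<close> is the direction of \<open>v\<close> at the given
  line; \<open>j > 0\<close> ensures \<open>v \<noteq> 0\<close>. Two vanishing chart coordinates
  characterize oriented lines and a third the family, hence the codimension 3 among all
  pairs.\<close>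

lemma embedded_submanifold_line_family:
  fixes \<Theta> :: "(real \<times> real) set"
  assumes \<Theta>: "open \<Theta>" and K: "smooth_on \<Theta> K" and neg: "\<And>w j. (w, j) \<in> \<Theta> \<Longrightarrow> w < 0 \<and> j > 0"
  shows "embedded_submanifold_in (oriented_lines :: ((real \<times> 'b::euclidean_space) \<times> (real \<times> 'b)) set)
     (2 * DIM(real \<times> 'b) - 3) (line_family \<Theta> K)"
  unfolding embedded_submanifold_in_def
proof (intro conjI ballI)
  show "line_family \<Theta> K \<subseteq> (oriented_lines :: ((real \<times> 'b) \<times> (real \<times> 'b)) set)"
    by (auto simp: line_family_def)
  fix q :: "(real \<times> 'b) \<times> (real \<times> 'b)" assume q: "q \<in> line_family \<Theta> K"
  define v where "v = snd (fst q)"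
  have "squared_momentum v (snd (snd q)) > 0"
    using q neg by (auto simp: line_family_def v_def)
  then have "v \<noteq> 0" by (auto simp: squared_momentum_def)
  define e where "e = v /\<^sub>R norm v"
  have e: "e \<bullet> e = 1" "v \<bullet> e > 0" "e \<noteq> 0"
    using \<open>v \<noteq> 0\<close> by (simp_all add: e_def dot_square_norm power2_eq_square)
  define U :: "((real \<times> 'b) \<times> (real \<times> 'b)) set" where "U = {q. (fst (fst q), squared_momentum (snd (fst q)) (snd (snd q))) \<in> \<Theta> \<and> snd (fst q) \<bullet> e > 0}"
  obtain V where V: "diffeo_between U V (line_chart K e)"
    unfolding U_def using line_chart_diffeo[OF \<Theta> K _ e(1)] neg by blast
  have img: "line_chart K e ` U = V"
    using V by (simp add: diffeo_between_def)
  define S where "S = {q :: (real \<times> 'b) \<times> (real \<times> 'b). fst (fst q) = 0 \<and> fst (snd q) = 0}"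
  define W where "W = {q :: (real \<times> 'b) \<times> (real \<times> 'b). fst (fst q) = 0 \<and> fst (snd q) = 0 \<and> e \<bullet> snd (snd q) = 0}"
  have N: "p \<in> oriented_lines \<longleftrightarrow> line_chart K e p \<in> S" for p
  proof -
    obtain w v x y where p: "p = ((w, v), (x, y))" by (metis surj_pair)
    have "norm (w, v) = 1 \<longleftrightarrow> w * w + v \<bullet> v = 1"
      by (simp add: norm_Pair dot_square_norm power2_eq_square)
    then show ?thesis
      by (simp add: p oriented_lines_def S_def line_chart_def Let_def)
  qed
  have F: "p \<in> line_family \<Theta> K \<longleftrightarrow> line_chart K e p \<in> W" if pU: "p \<in> U" for p
  proof -
    obtain w v x y where p: "p = ((w, v), (x, y))" by (metis surj_pair)
    have "v \<noteq> 0" using pU by (auto simp: U_def p)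
    define z where "z = y - (K (w, squared_momentum v y) / (v \<bullet> v)) *\<^sub>R v"
    have "e \<bullet> (z + (z \<bullet> v - z \<bullet> e) *\<^sub>R e) = z \<bullet> v"
      using e(1) by (simp add: inner_add_right inner_commute)
    also have "\<dots> = y \<bullet> v - K (w, squared_momentum v y)"
      using \<open>v \<noteq> 0\<close> by (simp add: z_def inner_diff_left)
    finally have zv: "e \<bullet> (z + (z \<bullet> v - z \<bullet> e) *\<^sub>R e) = y \<bullet> v - K (w, squared_momentum v y)" .
    have "line_chart K e p \<in> W \<longleftrightarrow> line_chart K e p \<in> S \<and> y \<bullet> v = K (w, squared_momentum v y)"
      using zv by (auto simp: W_def S_def line_chart_def p Let_def z_def[symmetric])
    with N[of p] pU show ?thesis
      by (auto simp: line_family_def U_def p)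
  qed
  have "subspace S" "subspace W"
    by (auto simp: subspace_def S_def W_def inner_add_right)
  moreover have "W \<subseteq> S" by (auto simp: W_def S_def)
  moreover have "dim W = 2 * DIM(real \<times> 'b) - 3"
    unfolding W_def by (rule dim_line_family_slice[OF e(3)])
  moreover have "line_chart K e ` (U \<inter> oriented_lines) = V \<inter> S"
    by (rule image_Int_eqI[OF img N])
  moreover have "line_chart K e ` (U \<inter> line_family \<Theta> K) = V \<inter> W"
    by (rule image_Int_eqI[OF img F])
  moreover have "q \<in> U"
    using q e(2) by (auto simp: U_def line_family_def v_def)
  ultimately have "q \<in> U \<and> diffeo_between U V (line_chart K e) \<and> subspace S \<and> subspace W \<and> W \<subseteq> S \<and>
      dim W = 2 * DIM(real \<times> 'b) - 3 \<and> line_chart K e ` (U \<inter> oriented_lines) = V \<inter> S \<and>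
      line_chart K e ` (U \<inter> line_family \<Theta> K) = V \<inter> W"
    using V by (intro conjI)
  then show "\<exists>U V S W. \<exists>\<phi> :: (real \<times> 'b) \<times> (real \<times> 'b) \<Rightarrow> (real \<times> 'b) \<times> (real \<times> 'b).
      q \<in> U \<and> diffeo_between U V \<phi> \<and> subspace S \<and> subspace W \<and> W \<subseteq> S \<and> dim W = 2 * DIM(real \<times> 'b) - 3 \<and>
      \<phi> ` (U \<inter> oriented_lines) = V \<inter> S \<and> \<phi> ` (U \<inter> line_family \<Theta> K) = V \<inter> W"
    by (rule exI[where x = "line_chart K e", THEN exI[where x = W], THEN exI[where x = S],
          THEN exI[where x = V], THEN exI[where x = U]])
qed

text \<open>Orthogonality of \<open>p\<close> and \<open>u\<close> makes the line meet the ball in a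
  parameter interval symmetric about 0. It contains \<open>t0\<close>, so the ray enters at its left
  end and does not leave before \<open>t0\<close>.\<close>

lemma entry_time:
  fixes u p :: "'a::euclidean_space"
  assumes "norm u = 1" "p \<bullet> u = 0" "norm (p + t0 *\<^sub>R u) \<le> R"
    and before: "\<And>t. t \<le> t0 \<Longrightarrow> \<gamma> t = p + t *\<^sub>R u" and after: "\<And>t. t \<ge> t0 \<Longrightarrow> \<gamma> t \<in> cball 0 R"
  shows "\<exists>t1. (\<forall>t<t1. \<gamma> t \<notin> cball 0 R) \<and> (\<forall>t\<ge>t1. \<gamma> t \<in> cball 0 R)"
proof -
  have R: "R \<ge> 0" using assms(3) norm_ge_zero order_trans by blast
  have sq: "(norm (p + t *\<^sub>R u))\<^sup>2 = (norm p)\<^sup>2 + t\<^sup>2" for t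
    using assms(1,2) unfolding power2_norm_eq_inner
    by (simp add: inner_add_left inner_add_right inner_commute norm_eq_1 power2_eq_square)
  have le: "norm (p + t *\<^sub>R u) \<le> R \<longleftrightarrow> (norm p)\<^sup>2 + t\<^sup>2 \<le> R\<^sup>2" for t
    unfolding sq[symmetric] using R by (simp add: abs_le_square_iff[symmetric])
  define s where "s = sqrt (R\<^sup>2 - (norm p)\<^sup>2)"
  have "(norm p)\<^sup>2 + t0\<^sup>2 \<le> R\<^sup>2" using assms(3) le by blast
  then have nn: "R\<^sup>2 - (norm p)\<^sup>2 \<ge> 0" using zero_le_power2[of t0] by linarith
  have "t\<^sup>2 \<le> R\<^sup>2 - (norm p)\<^sup>2 \<longleftrightarrow> \<bar>t\<bar> \<le> s" for t
    using real_sqrt_le_iff[of "t\<^sup>2" "R\<^sup>2 - (norm p)\<^sup>2"] by (simp add: s_def)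
  then have le': "norm (p + t *\<^sub>R u) \<le> R \<longleftrightarrow> \<bar>t\<bar> \<le> s" for t
    unfolding le by (metis add.commute le_diff_eq)
  have t0: "\<bar>t0\<bar> \<le> s" using assms(3) le' by blast
  show ?thesis
  proof (intro exI[of _ "- s"] conjI allI impI)
    fix t assume "t < - s"
    then show "\<gamma> t \<notin> cball 0 R"
      using le'[of t] before[of t] t0 by auto
  next
    fix t assume "t \<ge> - s"
    then show "\<gamma> t \<in> cball 0 R"
      using le'[of t] before[of t] after[of t] t0 by (cases "t \<le> t0") auto
  qed
qed

section \<open>Entry of the rays and choice of scales\<close>

context neck
begin

text \<open>The first bounce point \<open>(x0, y0)\<close> has parameter
  \<open>(x0, y0) \<bullet> (w, v) = w * x0 + z\<close> with \<open>z = y0 \<bullet> v\<close>.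
  Subtracting this multiple of \<open>v\<close> from \<open>y0\<close> yields the assumed value of
  \<open>y \<bullet> v\<close>; this is the origin of the function that cuts out the family.\<close>

lemma incoming_ray:
  fixes v y :: "real ^ 'm"
  assumes j: "j = squared_momentum v y"
    and uv: "w\<^sup>2 + v \<bullet> v = 1" "x * w + y \<bullet> v = 0" and w: "w < 0" "w\<^sup>2 < 1"
    and rad: "(\<rho> x0)\<^sup>2 * (1 - w\<^sup>2) - j \<ge> 0"
    and z: "z = sqrt ((\<rho> x0)\<^sup>2 * (1 - w\<^sup>2) - j)"
    and yv: "y \<bullet> v = w\<^sup>2 * z - w * (1 - w\<^sup>2) * x0"
  shows "x + (w * x0 + z) * w = x0" "norm (y + (w * x0 + z) *\<^sub>R v) = \<rho> x0" "(y + (w * x0 + z) *\<^sub>R v) \<bullet> v = z"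
proof -
  have vv: "v \<bullet> v = 1 - w\<^sup>2" using uv(1) by simp
  have "w * x = w * ((1 - w\<^sup>2) * x0 - w * z)"
    using uv(2) yv by (simp add: power2_eq_square algebra_simps)
  then have x: "x = (1 - w\<^sup>2) * x0 - w * z"
    using w(1) by simp
  show "x + (w * x0 + z) * w = x0"
    unfolding x by (simp add: power2_eq_square algebra_simps)
  show y0v: "(y + (w * x0 + z) *\<^sub>R v) \<bullet> v = z"
    using yv by (simp add: inner_add_left vv power2_eq_square algebra_simps)
  have "(v \<bullet> v) * ((y + (w * x0 + z) *\<^sub>R v) \<bullet> (y + (w * x0 + z) *\<^sub>R v)) - z\<^sup>2 = j"
    using squared_momentum_shift[of v y "w * x0 + z"] unfolding j by (simp add: squared_momentum_def y0v)
  moreover have "z\<^sup>2 = (\<rho> x0)\<^sup>2 * (1 - w\<^sup>2) - j"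
    using rad by (simp add: z)
  ultimately have "(1 - w\<^sup>2) * ((y + (w * x0 + z) *\<^sub>R v) \<bullet> (y + (w * x0 + z) *\<^sub>R v)) = (1 - w\<^sup>2) * (\<rho> x0)\<^sup>2"
    unfolding vv by (simp add: mult.commute)
  then have "(y + (w * x0 + z) *\<^sub>R v) \<bullet> (y + (w * x0 + z) *\<^sub>R v) = (\<rho> x0)\<^sup>2"
    using w(2) by simp
  then show "norm (y + (w * x0 + z) *\<^sub>R v) = \<rho> x0"
    using pos[of x0] by (simp add: norm_eq_square less_imp_le)
qed

text \<open>Backwards from the first bounce, the ray passes the end \<open>a\<close> before time
  \<open>\<rho> 0 / 2\<close>. Until then the linear decrease of the squared radius, at rate
  \<open>2 * z > \<rho> 0\<close>, outweighs both its quadratic term and the change of the squared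
  profile.\<close>

lemma incoming_ray_free:
  fixes y v :: "real ^ 'm"
  assumes "norm y = \<rho> x" "y \<bullet> v = z" "w\<^sup>2 + v \<bullet> v = 1" "0 < x" "x < a" "w < 0" "\<tau> > 0"
    and lip: "\<And>s s'. \<bar>s\<bar> \<le> a \<Longrightarrow> \<bar>s'\<bar> \<le> a \<Longrightarrow> \<bar>(\<rho> s)\<^sup>2 - (\<rho> s')\<^sup>2\<bar> \<le> L * \<bar>s - s'\<bar>"
    and enter: "a < x - \<rho> 0 / 2 * w" and z: "z > \<rho> 0 / 2" and Lw: "L * \<bar>w\<bar> < \<rho> 0 / 2"
  shows "(x, y) - \<tau> *\<^sub>R (w, v) \<notin> rotational_mirror \<rho> a"
proof
  assume "(x, y) - \<tau> *\<^sub>R (w, v) \<in> rotational_mirror \<rho> a"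
  then have hit: "norm (y - \<tau> *\<^sub>R v) = \<rho> (x - \<tau> * w)" "\<bar>x - \<tau> * w\<bar> \<le> a"
    by (auto simp: rotational_mirror_def)
  have "\<tau> * (- w) < \<rho> 0 / 2 * (- w)"
    using hit(2) enter by (simp add: abs_le_iff)
  then have \<tau>: "\<tau> < \<rho> 0 / 2"
    using \<open>w < 0\<close> by (simp add: mult_less_cancel_right)
  have "v \<bullet> v \<le> 1" using assms(3) zero_le_power2[of w] by linarith
  then have "\<tau> * (v \<bullet> v) \<le> \<tau>"
    using \<open>\<tau> > 0\<close> by (simp add: mult_left_le)
  then have neg: "\<tau> * (v \<bullet> v) + L * \<bar>w\<bar> - 2 * z < 0"
    using \<tau> z Lw by linarith
  have "(\<rho> (x - \<tau> * w))\<^sup>2 = (norm (y - \<tau> *\<^sub>R v))\<^sup>2"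
    using hit(1) by simp
  also have "\<dots> = (\<rho> x)\<^sup>2 - 2 * (\<tau> * z) + \<tau> * (\<tau> * (v \<bullet> v))"
    using assms(2) unfolding assms(1)[symmetric] power2_norm_eq_inner
    by (simp add: inner_diff_left inner_diff_right inner_commute algebra_simps)
  finally have "(\<rho> x)\<^sup>2 - (\<rho> (x - \<tau> * w))\<^sup>2 = 2 * (\<tau> * z) - \<tau> * (\<tau> * (v \<bullet> v))"
    by simp
  moreover have "(\<rho> x)\<^sup>2 - (\<rho> (x - \<tau> * w))\<^sup>2 \<le> \<tau> * (L * \<bar>w\<bar>)"
    using lip[of x "x - \<tau> * w"] hit(2) assms(4,5) \<open>\<tau> > 0\<close> by (simp add: abs_mult mult_ac)
  moreover have "\<tau> * (\<tau> * (v \<bullet> v) + L * \<bar>w\<bar> - 2 * z) < 0"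
    using neg \<open>\<tau> > 0\<close> by (simp add: mult_pos_neg)
  ultimately show False by (simp add: algebra_simps)
qed

text \<open>All requirements are open conditions that hold at the neck. \<open>L\<close> is fixed
  first, on \<open>[-1, 1]\<close>, because the conditions determining \<open>\<epsilon>\<close>
  involve it.\<close>

lemma neck_scale:
  obtains \<epsilon> L where "0 < \<epsilon>" "\<epsilon> < 1" "L * \<epsilon> < \<rho> 0 / 2" "L \<ge> 0"
    and "\<And>s s'. \<bar>s\<bar> \<le> \<epsilon> \<Longrightarrow> \<bar>s'\<bar> \<le> \<epsilon> \<Longrightarrow> \<bar>(\<rho> s)\<^sup>2 - (\<rho> s')\<^sup>2\<bar> \<le> L * \<bar>s - s'\<bar>"
    and "\<And>x x' w j. \<lbrakk>\<bar>x\<bar> < \<epsilon>; \<bar>x'\<bar> < \<epsilon>; \<bar>w\<bar> < \<epsilon>; \<bar>j - (\<rho> 0)\<^sup>2 / 2\<bar> < \<epsilon>\<rbrakk> \<Longrightarrow>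
      admissible x x' j \<and> \<rho> 0 \<le> chord_length x x' j \<and>
      (x' - x)\<^sup>2 + 2 * L * \<bar>x' - x\<bar> < (chord_length x x' j)\<^sup>2 \<and>
      \<rho> 0 / 2 < sqrt ((\<rho> x)\<^sup>2 * (1 - w\<^sup>2) - j) \<and> 0 < j"
proof -
  have "smooth_on UNIV (\<lambda>x. (\<rho> x)\<^sup>2)"
    by (intro smooth_on_power2 smooth open_UNIV)
  then have "Ck_family 0 (cball 0 1) (\<lambda>i::unit. \<lambda>x. (\<rho> x)\<^sup>2)"
    by (rule smooth_on_Ck_family[OF _ compact_cball convex_cball]) auto
  from Ck_family_0D[OF this] obtain L where L: "L \<ge> 0"
    "\<forall>i::unit. \<forall>x\<in>cball 0 1. \<forall>y\<in>cball 0 1. norm ((\<rho> x)\<^sup>2 - (\<rho> y)\<^sup>2) \<le> L * norm (x - y)"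
    by blast
  define G where "G = {z :: (real \<times> real) \<times> (real \<times> real). admissible (fst (fst z)) (snd (fst z)) (snd (snd z)) \<and>
     \<rho> 0 < chord_length (fst (fst z)) (snd (fst z)) (snd (snd z)) \<and>
     (snd (fst z) - fst (fst z))\<^sup>2 + 2 * L * \<bar>snd (fst z) - fst (fst z)\<bar> < (chord_length (fst (fst z)) (snd (fst z)) (snd (snd z)))\<^sup>2 \<and>
     \<rho> 0 / 2 < sqrt ((\<rho> (fst (fst z)))\<^sup>2 * (1 - (fst (snd z))\<^sup>2) - snd (snd z)) \<and> 0 < snd (snd z)}"
  have "open G"
    unfolding G_def admissible_def chord_length_def chord_dot_def
    by (intro open_Collect_conj open_Collect_less continuous_intros continuous_on_profile)
  moreover have "((0, 0), (0, (\<rho> 0)\<^sup>2 / 2)) \<in> G"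
  proof -
    have half_square: "(\<rho> 0)\<^sup>2 - (\<rho> 0)\<^sup>2 / 2 = (\<rho> 0)\<^sup>2 / 2"
      by simp
    have "chord_dot 0 0 ((\<rho> 0)\<^sup>2 / 2) = (\<rho> 0)\<^sup>2 / 2 - sqrt ((\<rho> 0)\<^sup>2 / 2 * ((\<rho> 0)\<^sup>2 / 2))"
      unfolding chord_dot_def half_square by simp
    then have "chord_dot 0 0 ((\<rho> 0)\<^sup>2 / 2) = 0"
      by (simp only: real_sqrt_abs2) simp
    then have len: "chord_length 0 0 ((\<rho> 0)\<^sup>2 / 2) = sqrt 2 * \<rho> 0"
      using pos[of 0] by (simp add: chord_length_def real_sqrt_mult)
    have "sqrt ((\<rho> 0)\<^sup>2 / 4) < sqrt ((\<rho> 0)\<^sup>2 / 2)"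
      using pos[of 0] by (intro real_sqrt_less_mono) simp
    moreover have "sqrt ((\<rho> 0)\<^sup>2 / 4) = \<rho> 0 / 2"
      using pos[of 0] by (simp add: real_sqrt_divide)
    ultimately have half: "\<rho> 0 / 2 < sqrt ((\<rho> 0)\<^sup>2 / 2)" by simp
    have "1 * \<rho> 0 < sqrt 2 * \<rho> 0"
      using pos[of 0] by (intro mult_strict_right_mono) auto
    then show ?thesis
      using half pos[of 0] by (simp add: G_def len admissible_def)
  qed
  ultimately obtain e where e: "e > 0" "ball ((0, 0), (0, (\<rho> 0)\<^sup>2 / 2)) e \<subseteq> G"
    using open_contains_ball by blast
  \<comment> \<open>The entries place four coordinates in the ball of radius \<open>e\<close>, keep
    \<open>\<epsilon>\<close> below 1, and give
    \<open>L * \<epsilon> < \<rho> 0 / 2\<close>.\<close>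
  define \<epsilon> where "\<epsilon> = min (e / 4) (min (1 / 2) (\<rho> 0 / (4 * (L + 1))))"
  have \<epsilon>: "0 < \<epsilon>" "\<epsilon> < 1" "4 * \<epsilon> \<le> e"
    using e(1) pos[of 0] L(1) by (auto simp: \<epsilon>_def)
  have "\<epsilon> * (4 * (L + 1)) \<le> \<rho> 0"
    using L(1) by (subst pos_le_divide_eq[symmetric]) (auto simp: \<epsilon>_def)
  then have L\<epsilon>: "L * \<epsilon> < \<rho> 0 / 2"
    using \<epsilon>(1) L(1) mult_nonneg_nonneg[of L \<epsilon>] pos[of 0] by (simp add: algebra_simps)
  show thesis
  proof (rule that[OF \<epsilon>(1,2) L\<epsilon> L(1)])
    show "\<bar>(\<rho> s)\<^sup>2 - (\<rho> s')\<^sup>2\<bar> \<le> L * \<bar>s - s'\<bar>" if "\<bar>s\<bar> \<le> \<epsilon>" "\<bar>s'\<bar> \<le> \<epsilon>" for s s'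
      using L(2) that \<epsilon>(2) by auto
    fix x x' w j assume b: "\<bar>x\<bar> < \<epsilon>" "\<bar>x'\<bar> < \<epsilon>" "\<bar>w\<bar> < \<epsilon>" "\<bar>j - (\<rho> 0)\<^sup>2 / 2\<bar> < \<epsilon>"
    have "dist ((x, x'), (w, j)) ((0, 0), (0, (\<rho> 0)\<^sup>2 / 2)) = norm ((x, x'), (w, j - (\<rho> 0)\<^sup>2 / 2))"
      by (simp add: dist_norm)
    also have "\<dots> \<le> (\<bar>x\<bar> + \<bar>x'\<bar>) + (\<bar>w\<bar> + \<bar>j - (\<rho> 0)\<^sup>2 / 2\<bar>)"
      using norm_Pair_le[of "(x, x')" "(w, j - (\<rho> 0)\<^sup>2 / 2)"] norm_Pair_le[of x x']
        norm_Pair_le[of w "j - (\<rho> 0)\<^sup>2 / 2"] by simp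
    also have "\<dots> < e" using b \<epsilon>(3) by linarith
    finally have "((x, x'), (w, j)) \<in> ball ((0, 0), (0, (\<rho> 0)\<^sup>2 / 2)) e"
      by (simp add: dist_commute)
    with e(2) have "((x, x'), (w, j)) \<in> G" by blast
    then show "admissible x x' j \<and> \<rho> 0 \<le> chord_length x x' j \<and>
      (x' - x)\<^sup>2 + 2 * L * \<bar>x' - x\<bar> < (chord_length x x' j)\<^sup>2 \<and>
      \<rho> 0 / 2 < sqrt ((\<rho> x)\<^sup>2 * (1 - w\<^sup>2) - j) \<and> 0 < j"
      by (simp add: G_def)
  qed
qed

text \<open>Two orthogonal radial directions are used: \<open>e1\<close> carries \<open>v\<close>
  and the prescribed product \<open>y \<bullet> v\<close>, and \<open>e2\<close> carries the angular
  momentum.\<close>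

lemma line_family_nonempty:
  assumes "(w, j) \<in> \<Theta>" "w < 0" "w\<^sup>2 < 1" "j > 0" "CARD('m) \<ge> 2"
  shows "(line_family \<Theta> K :: ((real \<times> (real ^ 'm)) \<times> (real \<times> (real ^ 'm))) set) \<noteq> {}"
proof -
  obtain i1 i2 :: 'm where "i1 \<noteq> i2"
    using assms(5) by (metis card_1_singleton_iff card_2_iff' UNIV_I card_le_Suc0_iff_eq finite_class.finite_UNIV not_less_eq_eq numeral_2_eq_2)
  define e1 e2 :: "real ^ 'm" where "e1 = axis i1 1" and "e2 = axis i2 1"
  have e: "e1 \<bullet> e1 = 1" "e2 \<bullet> e2 = 1" "e1 \<bullet> e2 = 0" "e2 \<bullet> e1 = 0"
    using \<open>i1 \<noteq> i2\<close> by (auto simp: e1_def e2_def inner_axis_axis)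
  define s where "s = sqrt (1 - w\<^sup>2)"
  have s: "s > 0" "s\<^sup>2 = 1 - w\<^sup>2"
    using assms(3) by (simp_all add: s_def)
  define k where "k = K (w, j)"
  define v y where "v = s *\<^sub>R e1" and "y = (k / s) *\<^sub>R e1 + (sqrt j / s) *\<^sub>R e2"
  have vv: "v \<bullet> v = s\<^sup>2" by (simp add: v_def e power2_eq_square)
  have yv: "y \<bullet> v = k" using s(1) by (simp add: v_def y_def e inner_add_left)
  have "y \<bullet> y = (k\<^sup>2 + j) / s\<^sup>2"
    using assms(4) by (simp add: y_def e inner_add_left inner_add_right power2_eq_square add_divide_distrib)
  then have sq: "squared_momentum v y = j"
    using s(1) by (simp add: squared_momentum_def vv yv)
  have "norm (w, v) = 1"
    using s(2) vv by (simp add: norm_Pair power2_norm_eq_inner)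
  moreover have "(- k / w, y) \<bullet> (w, v) = 0"
    using assms(2) yv by simp
  ultimately have "((w, v), (- k / w, y)) \<in> line_family \<Theta> K"
    using assms(1) by (simp add: line_family_def oriented_lines_def sq yv k_def)
  then show ?thesis by blast
qed

text \<open>One family of bounce sequences over a fixed parameter set \<open>\<Theta>\<close> serves
  all \<open>a < a0\<close>; only the piece of it that enters through the end depends on
  \<open>a\<close>.\<close>

theorem rotational_mirror_traps_family:
  assumes m: "CARD('m) \<ge> 2"
  shows "\<exists>a0>0. \<forall>a. 0 < a \<and> a < a0 \<longrightarrow> (\<exists>F. F \<noteq> {} \<and>
    traps_family {rotational_mirror \<rho> a :: (real \<times> (real ^ 'm)) set} (2 * DIM(real \<times> (real ^ 'm)) - 3) F)"
proof -
  obtain \<epsilon> L where \<epsilon>: "0 < \<epsilon>" "\<epsilon> < 1" and L\<epsilon>: "L * \<epsilon> < \<rho> 0 / 2" and L: "L \<ge> 0"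
    and lip: "\<And>s s'. \<bar>s\<bar> \<le> \<epsilon> \<Longrightarrow> \<bar>s'\<bar> \<le> \<epsilon> \<Longrightarrow> \<bar>(\<rho> s)\<^sup>2 - (\<rho> s')\<^sup>2\<bar> \<le> L * \<bar>s - s'\<bar>"
    and sc: "\<And>x x' w j. \<lbrakk>\<bar>x\<bar> < \<epsilon>; \<bar>x'\<bar> < \<epsilon>; \<bar>w\<bar> < \<epsilon>; \<bar>j - (\<rho> 0)\<^sup>2 / 2\<bar> < \<epsilon>\<rbrakk> \<Longrightarrow>
      admissible x x' j \<and> \<rho> 0 \<le> chord_length x x' j \<and>
      (x' - x)\<^sup>2 + 2 * L * \<bar>x' - x\<bar> < (chord_length x x' j)\<^sup>2 \<and>
      \<rho> 0 / 2 < sqrt ((\<rho> x)\<^sup>2 * (1 - w\<^sup>2) - j) \<and> 0 < j"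
    by (rule neck_scale) (rule that)
  define j0 where "j0 = (\<rho> 0)\<^sup>2 / 2"
  obtain \<delta> X where \<delta>: "0 < \<delta>" "\<delta> \<le> \<epsilon>"
    and Xbd: "\<And>k w j. \<lbrakk>\<bar>w\<bar> < \<delta>; \<bar>j - j0\<bar> < \<delta>\<rbrakk> \<Longrightarrow> \<bar>X k (w, j)\<bar> < \<epsilon>"
    and first: "\<And>w j. \<lbrakk>\<bar>w\<bar> < \<delta>; \<bar>j - j0\<bar> < \<delta>\<rbrakk> \<Longrightarrow>
      chord_tangential (X 0 (w, j)) (X (Suc 0) (w, j)) j = incoming_tangential (X 0 (w, j)) w j"
    and later: "\<And>k w j. \<lbrakk>\<bar>w\<bar> < \<delta>; \<bar>j - j0\<bar> < \<delta>\<rbrakk> \<Longrightarrow>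
      chord_tangential (X (Suc k) (w, j)) (X (Suc (Suc k)) (w, j)) j
        = - chord_tangential (X (Suc k) (w, j)) (X k (w, j)) j"
    and decay: "\<And>k w j. \<lbrakk>\<bar>w\<bar> < \<delta>; \<bar>j - j0\<bar> < \<delta>\<rbrakk> \<Longrightarrow> \<bar>X k (w, j)\<bar> \<le> \<bar>X 0 (w, j)\<bar>"
    and Xpos: "\<And>w j. \<lbrakk>\<bar>w\<bar> < \<delta>; \<bar>j - j0\<bar> < \<delta>; w < 0\<rbrakk> \<Longrightarrow> X 0 (w, j) > 0"
    and Xzero: "\<And>j. \<bar>j - j0\<bar> < \<delta> \<Longrightarrow> X 0 (0, j) = 0"
    and Xsmooth: "smooth_on {(w, j). \<bar>w\<bar> < \<delta> \<and> \<bar>j - j0\<bar> < \<delta>} (X 0)"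
    by (rule stable_bounce_sequences[OF \<epsilon>(1), folded j0_def]) (rule that)
  define \<Theta> where "\<Theta> = {(w, j). \<bar>w\<bar> < \<delta> \<and> \<bar>j - j0\<bar> < \<delta>}"
  have "\<Theta> = {-\<delta><..<\<delta>} \<times> {j0 - \<delta><..<j0 + \<delta>}" by (auto simp: \<Theta>_def)
  then have open\<Theta>: "open \<Theta>" by (simp add: open_Times)
  have contX: "continuous_on \<Theta> (X 0)"
    using smooth_on_imp_continuous_on[OF Xsmooth] by (simp add: \<Theta>_def)
  \<comment> \<open>The first bounce position at slope \<open>- \<delta> / 2\<close>; slopes between
    this and 0 then reach every smaller \<open>a\<close>.\<close>
  define a0 where "a0 = X 0 (- \<delta> / 2, j0)"
  have a0: "a0 > 0" "a0 < \<epsilon>"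
    using Xpos[of "- \<delta> / 2" j0] Xbd[of "- \<delta> / 2" j0 0] \<delta> by (auto simp: a0_def)
  have "\<exists>F. F \<noteq> {} \<and> traps_family {rotational_mirror \<rho> a :: (real \<times> (real ^ 'm)) set} (2 * DIM(real \<times> (real ^ 'm)) - 3) F"
    if a: "0 < a" "a < a0" for a
  proof -
    let ?M = "rotational_mirror \<rho> a :: (real \<times> (real ^ 'm)) set"
    \<comment> \<open>The last two conditions say that the first bounce lies inside the end
      \<open>a\<close> and that the reversed ray passes this end within time
      \<open>\<rho> 0 / 2\<close>.\<close>
    define \<Theta>a where "\<Theta>a = {\<theta> \<in> \<Theta>. fst \<theta> < 0 \<and> X 0 \<theta> < a \<and> a < X 0 \<theta> - \<rho> 0 / 2 * fst \<theta>}"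
    define z where "z \<theta> = sqrt ((\<rho> (X 0 \<theta>))\<^sup>2 * (1 - (fst \<theta>)\<^sup>2) - snd \<theta>)" for \<theta>
    define K where "K \<theta> = (fst \<theta>)\<^sup>2 * z \<theta> - fst \<theta> * (1 - (fst \<theta>)\<^sup>2) * X 0 \<theta>" for \<theta>
    define F where "F = (line_family \<Theta>a K :: ((real \<times> (real ^ 'm)) \<times> (real \<times> (real ^ 'm))) set)"
    have scale: "admissible (X k (w, j)) (X k' (w, j)) j \<and> \<rho> 0 \<le> chord_length (X k (w, j)) (X k' (w, j)) j \<and>
      (X k' (w, j) - X k (w, j))\<^sup>2 + 2 * L * \<bar>X k' (w, j) - X k (w, j)\<bar> < (chord_length (X k (w, j)) (X k' (w, j)) j)\<^sup>2 \<and>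
      \<rho> 0 / 2 < sqrt ((\<rho> (X k (w, j)))\<^sup>2 * (1 - w\<^sup>2) - j) \<and> 0 < j"
      if "(w, j) \<in> \<Theta>" for k k' w j
    proof -
      have "\<bar>w\<bar> < \<delta>" "\<bar>j - j0\<bar> < \<delta>" using that by (auto simp: \<Theta>_def)
      then show ?thesis
        using sc[OF Xbd Xbd, of w j w j w j] \<delta>(2) unfolding j0_def[symmetric] by auto
    qed
    have open\<Theta>a: "open \<Theta>a"
    proof -
      have "continuous_on \<Theta> (\<lambda>\<theta>. (fst \<theta>, X 0 \<theta>, X 0 \<theta> - \<rho> 0 / 2 * fst \<theta>))"
        by (intro continuous_intros contX)
      then have "open (\<Theta> \<inter> (\<lambda>\<theta>. (fst \<theta>, X 0 \<theta>, X 0 \<theta> - \<rho> 0 / 2 * fst \<theta>)) -` ({..<0} \<times> {..<a} \<times> {a<..}))"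
        by (rule continuous_open_preimage[OF _ open\<Theta>]) (intro open_Times open_lessThan open_greaterThan)
      moreover have "\<Theta> \<inter> (\<lambda>\<theta>. (fst \<theta>, X 0 \<theta>, X 0 \<theta> - \<rho> 0 / 2 * fst \<theta>)) -` ({..<0} \<times> {..<a} \<times> {a<..}) = \<Theta>a"
        by (auto simp: \<Theta>a_def)
      ultimately show ?thesis by simp
    qed
    have zpos: "z \<theta> > \<rho> 0 / 2" "(\<rho> (X 0 \<theta>))\<^sup>2 * (1 - (fst \<theta>)\<^sup>2) - snd \<theta> > 0" if "\<theta> \<in> \<Theta>" for \<theta>
    proof -
      show "z \<theta> > \<rho> 0 / 2"
        using scale[of "fst \<theta>" "snd \<theta>" 0] that by (simp add: z_def)
      then have "z \<theta> > 0" using pos[of 0] by linarith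
      then show "(\<rho> (X 0 \<theta>))\<^sup>2 * (1 - (fst \<theta>)\<^sup>2) - snd \<theta> > 0"
        by (simp add: z_def)
    qed
    have smoothK: "smooth_on \<Theta>a K"
    proof -
      have "smooth_on \<Theta>a (X 0)"
        using smooth_on_subset[OF Xsmooth] by (auto simp: \<Theta>a_def \<Theta>_def)
      then show ?thesis
        unfolding K_def z_def
        by (intro smooth_on_intros smooth_on_profile open\<Theta>a) (use zpos in \<open>auto simp: \<Theta>a_def\<close>)
    qed
    have "embedded_submanifold_in oriented_lines (2 * DIM(real \<times> (real ^ 'm)) - 3) F"
      unfolding F_def
    proof (rule embedded_submanifold_line_family[OF open\<Theta>a smoothK])
      fix w j assume "(w, j) \<in> \<Theta>a"
      then show "w < 0 \<and> j > 0"
        using scale[of w j 0 0] by (auto simp: \<Theta>a_def)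
    qed
    moreover have "F \<noteq> {}"
    proof -
      \<comment> \<open>The coefficient \<open>\<rho> 0 / 4\<close> is half of that in
        \<open>\<Theta>a\<close>: it puts \<open>a\<close> midway between the two bounds there, so
        both strict inequalities hold.\<close>
      have "\<exists>w\<ge>- \<delta> / 2. w \<le> 0 \<and> X 0 (w, j0) - \<rho> 0 / 4 * w = a"
      proof (rule IVT2')
        show "X 0 (0, j0) - \<rho> 0 / 4 * 0 \<le> a" using Xzero[of j0] \<delta> a by simp
        have "\<rho> 0 / 4 * (\<delta> / 2) > 0" using pos[of 0] \<delta> by simp
        then show "a \<le> X 0 (- \<delta> / 2, j0) - \<rho> 0 / 4 * (- \<delta> / 2)"
          using a by (simp add: a0_def)
        have "continuous_on {- \<delta> / 2..0} (\<lambda>w. X 0 (w, j0))"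
          by (rule continuous_on_compose2[OF contX]) (use \<delta> in \<open>auto simp: \<Theta>_def intro!: continuous_intros\<close>)
        then show "continuous_on {- \<delta> / 2..0} (\<lambda>w. X 0 (w, j0) - \<rho> 0 / 4 * w)"
          by (intro continuous_intros)
      qed (use \<delta> in simp)
      then obtain w where w: "- \<delta> / 2 \<le> w" "w \<le> 0" "X 0 (w, j0) - \<rho> 0 / 4 * w = a" by blast
      have "w \<noteq> 0" using w(3) Xzero[of j0] \<delta> a by auto
      then have w0: "w < 0" using w(2) by simp
      have \<theta>: "(w, j0) \<in> \<Theta>" using w(1) w0 \<delta> by (auto simp: \<Theta>_def)
      have "\<rho> 0 * w < 0" using w0 pos[of 0] by (simp add: mult_pos_neg)
      then have "(w, j0) \<in> \<Theta>a"
        using \<theta> w0 w(3) by (simp add: \<Theta>a_def)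
      moreover have "\<bar>w\<bar> < 1" using w(1) w0 \<delta> \<epsilon> by linarith
      then have "w\<^sup>2 < 1" by (simp add: abs_square_less_1)
      moreover have "j0 > 0" using pos[of 0] by (simp add: j0_def)
      ultimately show ?thesis
        unfolding F_def using line_family_nonempty[OF _ w0 _ _ m] by blast
    qed
    moreover have "trap {?M}"
      by (simp add: trap_def mirror_rotational[OF a(1)])
    moreover have "\<exists>R>0. \<Union>{?M} \<subseteq> interior (cball 0 R) \<and>
        (\<forall>l\<in>F. \<exists>\<gamma>. billiard_trajectory {?M} \<gamma> \<and> nonsingular {?M} \<gamma> \<and> comes_from_infinity_along \<gamma> l \<and>
           (\<exists>t1. (\<forall>t<t1. \<gamma> t \<notin> cball 0 R) \<and> (\<forall>t\<ge>t1. \<gamma> t \<in> cball 0 R)))"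
    proof -
      obtain B where B: "B > 0" "\<And>x. \<bar>x\<bar> \<le> a \<Longrightarrow> \<rho> x \<le> B"
        using profile_bounded by blast
      \<comment> \<open>The ball contains the mirror in its interior and, being convex, every chord
        between mirror points.\<close>
      define R where "R = a + B + 1"
      have R: "R > 0" using a B by (simp add: R_def)
      have M_R: "norm p < R" if "p \<in> ?M" for p
        using that B(2)[of "fst p"] norm_Pair_le[of "fst p" "snd p"] by (auto simp: rotational_mirror_def R_def)
      have "\<exists>\<gamma>. billiard_trajectory {?M} \<gamma> \<and> nonsingular {?M} \<gamma> \<and> comes_from_infinity_along \<gamma> q \<and>
           (\<exists>t1. (\<forall>t<t1. \<gamma> t \<notin> cball 0 R) \<and> (\<forall>t\<ge>t1. \<gamma> t \<in> cball 0 R))" if q: "q \<in> F" for q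
      proof -
        obtain w v x y where qe: "q = ((w, v), (x, y))" by (metis surj_pair)
        define j where "j = squared_momentum v y"
        define \<theta> where "\<theta> = (w, j)"
        have "\<theta> \<in> \<Theta>a" and yv: "y \<bullet> v = K \<theta>" and line: "((w, v), (x, y)) \<in> oriented_lines"
          using q by (auto simp: F_def line_family_def qe \<theta>_def j_def)
        then have \<theta>: "\<theta> \<in> \<Theta>" and w: "w < 0" and X0a: "X 0 \<theta> < a" "a < X 0 \<theta> - \<rho> 0 / 2 * w"
          by (auto simp: \<Theta>a_def \<theta>_def)
        have wj: "\<bar>w\<bar> < \<delta>" "\<bar>j - j0\<bar> < \<delta>" using \<theta> by (auto simp: \<Theta>_def \<theta>_def)
        have u: "norm (w, v) = 1" and pu: "(x, y) \<bullet> (w, v) = 0"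
          using line by (auto simp: oriented_lines_def)
        have uv: "w\<^sup>2 + v \<bullet> v = 1"
          using u by (simp add: norm_Pair power2_norm_eq_inner)
        have "\<bar>w\<bar> < 1" using wj \<delta> \<epsilon> by linarith
        then have w1: "w\<^sup>2 < 1" by (simp add: abs_square_less_1)
        define x0 where "x0 = X 0 \<theta>"
        define t0 where "t0 = w * x0 + z \<theta>"
        define y0 where "y0 = y + t0 *\<^sub>R v"
        have rad: "(\<rho> x0)\<^sup>2 * (1 - w\<^sup>2) - j \<ge> 0"
          using zpos(2)[OF \<theta>] by (simp add: x0_def \<theta>_def)
        have z\<theta>: "z \<theta> = sqrt ((\<rho> x0)\<^sup>2 * (1 - w\<^sup>2) - j)"
          by (simp add: z_def x0_def \<theta>_def)
        have hit: "x + t0 * w = x0" "norm y0 = \<rho> x0" "y0 \<bullet> v = z \<theta>"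
          unfolding y0_def t0_def
          by (rule incoming_ray[OF j_def uv _ w w1 rad z\<theta>];
              use pu yv in \<open>simp add: K_def x0_def \<theta>_def\<close>)+
        have P0: "(x, y) + t0 *\<^sub>R (w, v) = (x0, y0)"
          using hit(1) by (simp add: y0_def)
        have x0: "0 < x0" "x0 < a"
          using Xpos[OF wj w] X0a by (simp_all add: x0_def \<theta>_def)
        have lipa: "\<bar>(\<rho> s)\<^sup>2 - (\<rho> s')\<^sup>2\<bar> \<le> L * \<bar>s - s'\<bar>" if "\<bar>s\<bar> \<le> a" "\<bar>s'\<bar> \<le> a" for s s'
          using lip[of s s'] that a a0 by linarith
        have Lw: "L * \<bar>w\<bar> < \<rho> 0 / 2"
          using mult_left_mono[of "\<bar>w\<bar>" \<epsilon> L] wj(1) \<delta>(2) L L\<epsilon> by linarith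
        have sc\<theta>: "admissible (X k \<theta>) (X (Suc k) \<theta>) j" "\<rho> 0 \<le> chord_length (X k \<theta>) (X (Suc k) \<theta>) j"
          "(X (Suc k) \<theta> - X k \<theta>)\<^sup>2 + 2 * L * \<bar>X (Suc k) \<theta> - X k \<theta>\<bar> < (chord_length (X k \<theta>) (X (Suc k) \<theta>) j)\<^sup>2" for k
          using scale[of w j k "Suc k"] \<theta> unfolding \<theta>_def by blast+
        have free: "(x0, y0) - \<tau> *\<^sub>R (w, v) \<notin> ?M" if "\<tau> > 0" for \<tau>
          by (rule incoming_ray_free[OF hit(2,3) uv x0 w that lipa _ zpos(1)[OF \<theta>] Lw]) (use X0a in \<open>simp_all add: x0_def\<close>)
        obtain \<gamma> where \<gamma>: "billiard_trajectory {?M} \<gamma>" "nonsingular {?M} \<gamma>"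
          "\<And>t. t \<le> t0 \<Longrightarrow> \<gamma> t = (x0, y0) + (t - t0) *\<^sub>R (w, v)"
          "\<And>t. t \<ge> t0 \<Longrightarrow> \<exists>p\<in>?M. \<exists>p'\<in>?M. \<gamma> t \<in> closed_segment p p'"
        proof (rule trajectory_from_bounce_sequence[where x = "\<lambda>k. X k \<theta>" and a = a and ?y0.0 = y0 and ?v0.0 = v and w = w
              and j = j and l_min = "\<rho> 0" and L = L and ?t0.0 = t0])
          show "chord_tangential (X 0 \<theta>) (X (Suc 0) \<theta>) j = incoming_tangential (X 0 \<theta>) w j"
            unfolding \<theta>_def by (rule first[OF wj])
          show "chord_tangential (X (Suc k) \<theta>) (X (Suc (Suc k)) \<theta>) j = - chord_tangential (X (Suc k) \<theta>) (X k \<theta>) j" for k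
            unfolding \<theta>_def by (rule later[OF wj])
          show "\<bar>X k \<theta>\<bar> < a" for k
            using decay[OF wj, of k] x0 by (simp add: x0_def \<theta>_def)
        qed (use sc\<theta> rad hit(2,3) z\<theta> uv pos lipa free in \<open>auto simp: x0_def\<close>)
        have before: "\<gamma> t = (x, y) + t *\<^sub>R (w, v)" if "t \<le> t0" for t
          unfolding \<gamma>(3)[OF that] P0[symmetric] by (simp add: algebra_simps)
        have after: "\<gamma> t \<in> cball 0 R" if t: "t \<ge> t0" for t
        proof -
          obtain p p' where p: "p \<in> ?M" "p' \<in> ?M" "\<gamma> t \<in> closed_segment p p'"
            using \<gamma>(4)[OF t] by blast
          have "closed_segment p p' \<subseteq> cball 0 R"
            using M_R[OF p(1)] M_R[OF p(2)] by (intro closed_segment_subset) auto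
          with p(3) show ?thesis by blast
        qed
        have "norm ((x, y) + t0 *\<^sub>R (w, v)) \<le> R"
          using after[of t0] before[of t0] by simp
        from entry_time[OF u pu this before after]
        have "\<exists>t1. (\<forall>t<t1. \<gamma> t \<notin> cball 0 R) \<and> (\<forall>t\<ge>t1. \<gamma> t \<in> cball 0 R)" .
        moreover have "comes_from_infinity_along \<gamma> q"
          using before by (auto simp: comes_from_infinity_along_def qe)
        ultimately show ?thesis using \<gamma>(1,2) by blast
      qed
      then show ?thesis
        using R M_R by (intro exI[of _ R]) auto
    qed
    ultimately show ?thesis
      unfolding traps_family_def by (intro exI[of _ F] conjI)
  qed
  with a0(1) show ?thesis by blast
qed

end

text \<open>Nonemptiness is part of the conclusion because the empty set counts as an embedded
  submanifold of every dimension.\<close>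

theorem proposition5p2:
  fixes \<rho> :: "real \<Rightarrow> real" and n :: nat
  assumes "smooth_on UNIV \<rho>"
    and "\<And>x. \<rho> x > 0"
    and "\<rho> 0 > 0"
    and "deriv \<rho> 0 = 0"
    and "deriv (deriv \<rho>) 0 > 0"
    and "n = DIM(real \<times> (real ^ 'm))"
    and "n \<ge> 3"
  shows "\<exists>a0>0. \<forall>a. 0 < a \<and> a < a0 \<longrightarrow>
           (\<exists>F. F \<noteq> {} \<and>
             traps_family {rotational_mirror \<rho> a :: (real \<times> (real ^ 'm)) set} (2 * n - 3) F)"
proof -
  interpret neck \<rho>
    by unfold_locales (fact assms)+
  have "CARD('m) \<ge> 2"
    using assms(6,7) by simp
  from rotational_mirror_traps_family[OF this] show ?thesis
    by (simp only: assms(6))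
qed

end
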